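(* Let $G$ be a countable abelian group, let $X$ be a compact metric space, let $G\curvearrowright X$ be a continuous action, and let $\mu$ be an ergodic Borel probability measure on $X$. Let $(x,y)\in X^2$. The following are equivalent: 1. $(x,y)$ is a $\mu$-sequence entropy pair. 2. There exists a tempered Følner sequence of $G$ with respect to which $(x,y)$ is a $\mu$-mean sensitivity pair. 3. $(x,y)$ is a $\mu$-mean sensitivity pair with respect to every tempered Følner sequence of $G$.
   Context: Here $G$ is discrete; a continuous action means that $x\mapsto sx$ is continuous for every $s\in G$. A Borel probability measure $\mu$ is ergodic if it is $G$-invariant and every $G$-invariant Borel set has measure $0$ or $1$. $\mathcal{B}_\mu^+(X)$ denotes the set of Borel subsets of $X$ of positive $\mu$-measure. A Følner sequence of $G$ is a sequence $\{F_n\}_{n\in\mathbb{N}}$ of nonempty finite subsets of $G$ with $|sF_n\Delta F_n|/|F_n|\to 0$ as $n\to\infty$ for every $s\in G$. It is tempered if there is $C>0$ with $\left|\bigcup_{k=1}^{n-1}F_k^{-1}F_n\right|\le C|F_n|$ for all $n>1$. For $S\subseteq G$, the upper density (with respect to $\{F_n\}$) is $\overline{D}(S)=\limsup_{n\to\infty}|S\cap F_n|/|F_n|$. For a finite measurable partition $\mathcal{P}$ of $X$, $H_\mu(\mathcal{P})=-\sum_{A\in\mathcal{P}}\mu(A)\log\mu(A)$. For a sequence $S=\{s_i\}_{i=0}^\infty$ of elements of $G$, $h_\mu^S(X,\mathcal{P})=\limsup_{n\to\infty}\frac1n H_\mu\left(\bigvee_{i=0}^{n-1}s_i^{-1}\mathcal{P}\right)$.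 $(x,y)\in X^2$ is a $\mu$-sequence entropy pair if $x\neq y$ and for any finite measurable partition $\mathcal{P}$ of $X$ such that there is no $P\in\mathcal{P}$ with $x,y\in\overline{P}$, there exists a sequence $S$ in $G$ with $h_\mu^S(X,\mathcal{P})>0$. $(x,y)\in X^2$ is a $\mu$-mean sensitivity pair with respect to a Følner sequence $\{F_n\}$ if $x\neq y$ and for all open neighbourhoods $U_x$ of $x$ and $U_y$ of $y$ there exists $\varepsilon>0$ such that for every $A\in\mathcal{B}_\mu^+(X)$ there exist $p,q\in A$ with $\overline{D}(\{s\in G: sp\in U_x\text{ and }sq\in U_y\})>\varepsilon$, where $\overline{D}$ is taken with respect to $\{F_n\}$. *)

theory Defs
  imports "HOL-Probability.Probability" "HOL-Library.Disjoint_Sets"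
begin

text \<open>
  The abelian group is the type \<open>'g\<close>, written additively, so that \<open>s\<^sup>-\<^sup>1\<close> reads \<open>- s\<close>; the
  compact space is the whole of the type \<open>'x\<close>.
\<close>

definition continuous_action ::
    "('g::group_add \<Rightarrow> 'x::topological_space \<Rightarrow> 'x) \<Rightarrow> bool" where
  "continuous_action act \<longleftrightarrow>
     (\<forall>x. act 0 x = x) \<and>
     (\<forall>s t x. act (s + t) x = act s (act t x)) \<and>
     (\<forall>s. continuous_on UNIV (act s))"

definition ergodic_borel_prob ::
    "('g \<Rightarrow> 'x::topological_space \<Rightarrow> 'x) \<Rightarrow> 'x measure \<Rightarrow> bool" where
  "ergodic_borel_prob act \<mu> \<longleftrightarrow>
     sets \<mu> = sets borel \<and> prob_space \<mu> \<and>
     (\<forall>s. \<forall>A\<in>sets borel. measure \<mu> (act s -` A) = measure \<mu> A) \<and>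
     (\<forall>A\<in>sets borel. (\<forall>s. act s ` A = A) \<longrightarrow> measure \<mu> A = 0 \<or> measure \<mu> A = 1)"

definition folner_seq :: "(nat \<Rightarrow> 'g::group_add set) \<Rightarrow> bool" where
  "folner_seq F \<longleftrightarrow>
     (\<forall>n. finite (F n) \<and> F n \<noteq> {}) \<and>
     (\<forall>s. (\<lambda>n. real (card (sym_diff ((+) s ` F n) (F n))) / real (card (F n))) \<longlonglongrightarrow> 0)"

text \<open>
  The union runs over \<open>k \<ge> 1\<close>, for a sequence indexed from 1. Whether the value at 0 is counted
  as a term does not matter: including it only enlarges the constant by \<open>card (F 0)\<close>.
\<close>
definition tempered :: "(nat \<Rightarrow> 'g::group_add set) \<Rightarrow> bool" where
  "tempered F \<longleftrightarrow>
     (\<exists>C>0. \<forall>n>1. real (card (\<Union>k\<in>{1..n-1}. {- a + b | a b. a \<in> F k \<and> b \<in> F n}))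
                    \<le> C * real (card (F n)))"

definition upper_density :: "(nat \<Rightarrow> 'g set) \<Rightarrow> 'g set \<Rightarrow> ereal" where
  "upper_density F S = limsup (\<lambda>n. ereal (real (card (S \<inter> F n)) / real (card (F n))))"

definition finite_borel_partition :: "'x::topological_space set set \<Rightarrow> bool" where
  "finite_borel_partition P \<longleftrightarrow> finite P \<and> P \<subseteq> sets borel \<and> partition_on UNIV P"

definition partition_entropy :: "'x measure \<Rightarrow> 'x set set \<Rightarrow> real" where
  "partition_entropy \<mu> P = - (\<Sum>A\<in>P. measure \<mu> A * ln (measure \<mu> A))"

definition pullback_partition :: "('x \<Rightarrow> 'x) \<Rightarrow> 'x set set \<Rightarrow> 'x set set" where
  "pullback_partition f P = (\<lambda>A. f -` A) ` P"

definition sequence_entropy ::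
    "('g \<Rightarrow> 'x \<Rightarrow> 'x) \<Rightarrow> 'x measure \<Rightarrow> (nat \<Rightarrow> 'g) \<Rightarrow> 'x set set \<Rightarrow> ereal" where
  "sequence_entropy act \<mu> s P =
     limsup (\<lambda>n. ereal (1 / real n *
       partition_entropy \<mu>
         (common_refinement ((\<lambda>i. pullback_partition (act (s i)) P) ` {..<n}))))"

definition sequence_entropy_pair ::
    "('g \<Rightarrow> 'x::topological_space \<Rightarrow> 'x) \<Rightarrow> 'x measure \<Rightarrow> 'x \<Rightarrow> 'x \<Rightarrow> bool" where
  "sequence_entropy_pair act \<mu> x y \<longleftrightarrow>
     x \<noteq> y \<and>
     (\<forall>P. finite_borel_partition P \<and> \<not> (\<exists>A\<in>P. x \<in> closure A \<and> y \<in> closure A) \<longrightarrow>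
        (\<exists>s :: nat \<Rightarrow> 'g. sequence_entropy act \<mu> s P > 0))"

definition mean_sensitivity_pair ::
    "('g \<Rightarrow> 'x::topological_space \<Rightarrow> 'x) \<Rightarrow> 'x measure \<Rightarrow> (nat \<Rightarrow> 'g set) \<Rightarrow> 'x \<Rightarrow> 'x \<Rightarrow> bool" where
  "mean_sensitivity_pair act \<mu> F x y \<longleftrightarrow>
     x \<noteq> y \<and>
     (\<forall>U V. open U \<and> x \<in> U \<and> open V \<and> y \<in> V \<longrightarrow>
        (\<exists>\<epsilon>::real. \<epsilon> > 0 \<and>
          (\<forall>A\<in>sets borel. measure \<mu> A > 0 \<longrightarrow>
             (\<exists>p\<in>A. \<exists>q\<in>A. upper_density F {s. act s p \<in> U \<and> act s q \<in> V} > ereal \<epsilon>))))"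

end

theory Submission
  imports Defs "HOL-Real_Asymp.Real_Asymp"
begin

text \<open>
Both notions are measured against the Kronecker algebra of the action, the Borel sets \<open>W\<close> whose
orbit \<open>(s\<^sup>-\<^sup>1 W)\<^sub>s\<close> is totally bounded for the distance \<open>\<mu> (A \<triangle> B)\<close>. Call \<open>x\<close> and \<open>y\<close> separated if
some Kronecker set \<open>W\<close> contains a neighbourhood of \<open>x\<close> and misses a neighbourhood of \<open>y\<close>. For
\<open>x \<noteq> y\<close> each of the three conditions says that \<open>x\<close> and \<open>y\<close> are not separated; for \<open>x = y\<close> all of
them fail.

For entropy this is Kushnirenko's dichotomy. If \<open>W\<close> is a Kronecker set, then every translate of
\<open>{W, - W}\<close> is nearly equal to one of finitely many translates, so a joint refinement of \<open>n\<close>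
translates has entropy \<open>o(n)\<close> (\<open>almost_periodic_imp_zero_sequence_entropy\<close>). If a block \<open>A\<close> of \<open>P\<close>
is not a Kronecker set, the component of its indicator orthogonal to all almost periodic functions
is nonzero and weakly mixing; a translate of \<open>P\<close> that is almost independent of it given the past
can therefore be chosen again and again, and each choice adds a fixed amount of entropy
(\<open>positive_sequence_entropy\<close>). Hence a partition that separates \<open>x\<close> from \<open>y\<close> in the sense of
closures and has entropy zero along all sequences consists of Kronecker sets, and the union of its
blocks whose closure contains \<open>x\<close> separates the two points.

For mean sensitivity, let first \<open>W\<close> separate the points. An almost periodic function is close in
\<open>L\<^sup>1\<close> to a function \<open>g\<close> whose orbit is totally bounded in the supremum norm
(\<open>almost_periodic_uniform_approximation\<close>), so there is a set of positive measure on which all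
\<open>g (s p)\<close> depend little on \<open>p\<close>. The maximal inequality along a tempered sequence bounds the frequency
with which \<open>g\<close> and the indicator of \<open>W\<close> differ along an orbit. Therefore \<open>s p \<in> W\<close> and \<open>s q \<notin> W\<close>
happens rarely (\<open>kronecker_separation_imp_not_mean_sensitive\<close>). Conversely let \<open>\<phi>\<close> and \<open>\<psi>\<close> be the
conditional expectations of the indicators of disjoint neighbourhoods \<open>U\<close> and \<open>V\<close> given the Kronecker
algebra. If \<open>\<phi> \<psi> = 0\<close> almost everywhere, the set \<open>{\<phi> > 0}\<close>, corrected on a null set, separates. If
not, take a positive part \<open>C\<close> of a given set on which the orbit of \<open>\<phi>\<close> is almost constant: weak
mixing allows one to replace indicators by conditional expectations, and on average over \<open>s\<close> the
proportion of \<open>(p, q) \<in> C \<times> C\<close> with \<open>s p \<in> U\<close> and \<open>s q \<in> V\<close> is at least about \<open>\<integral> \<phi> \<psi>\<close>, a bound that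
does not depend on the given set (\<open>not_kronecker_separated_imp_mean_sensitive\<close>). This direction
holds along every Foelner sequence, so the choice of sequence is immaterial.
\<close>

section \<open>Averages over Foelner sequences\<close>

definition avg :: "'g set \<Rightarrow> ('g \<Rightarrow> real) \<Rightarrow> real" where
  "avg F \<phi> = (\<Sum>s\<in>F. \<phi> s) / real (card F)"

lemma avg_mono: "(\<And>s. s \<in> F \<Longrightarrow> \<phi> s \<le> \<psi> s) \<Longrightarrow> avg F \<phi> \<le> avg F \<psi>"
  unfolding avg_def by (intro divide_right_mono sum_mono) auto

lemma avg_const [simp]: "finite F \<Longrightarrow> F \<noteq> {} \<Longrightarrow> avg F (\<lambda>s. c) = c"
  unfolding avg_def by simp

lemma avg_add: "avg F (\<lambda>s. \<phi> s + \<psi> s) = avg F \<phi> + avg F \<psi>"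
  unfolding avg_def by (simp add: sum.distrib add_divide_distrib)

lemma avg_diff: "avg F (\<lambda>s. \<phi> s - \<psi> s) = avg F \<phi> - avg F \<psi>"
  unfolding avg_def by (simp add: sum_subtractf diff_divide_distrib)

lemma avg_cmult: "avg F (\<lambda>s. c * \<phi> s) = c * avg F \<phi>"
  unfolding avg_def by (simp add: sum_distrib_left)

lemma avg_mult_right: "avg F (\<lambda>s. \<phi> s * c) = avg F \<phi> * c"
  unfolding avg_def by (simp add: sum_distrib_right)

lemma avg_sum: "avg F (\<lambda>s. \<Sum>i\<in>I. \<phi> i s) = (\<Sum>i\<in>I. avg F (\<phi> i))"
  unfolding avg_def by (simp add: sum.swap[of _ I F] sum_divide_distrib)

lemma avg_avg: "avg F (\<lambda>s. avg H (\<lambda>t. \<phi> s t)) = avg H (\<lambda>t. avg F (\<lambda>s. \<phi> s t))"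
  unfolding avg_def by (simp add: sum.swap[of _ H F] sum_divide_distrib[symmetric] mult.commute)

lemma avg_cong: "(\<And>s. s \<in> F \<Longrightarrow> \<phi> s = \<psi> s) \<Longrightarrow> avg F \<phi> = avg F \<psi>"
  unfolding avg_def by simp

lemma avg_abs: "\<bar>avg F \<phi>\<bar> \<le> avg F (\<lambda>s. \<bar>\<phi> s\<bar>)"
  unfolding avg_def by (simp add: divide_right_mono)

lemma avg_nonneg: "(\<And>s. s \<in> F \<Longrightarrow> 0 \<le> \<phi> s) \<Longrightarrow> 0 \<le> avg F \<phi>"
  unfolding avg_def by (simp add: sum_nonneg)

lemma avg_le: "finite F \<Longrightarrow> F \<noteq> {} \<Longrightarrow> (\<And>s. s \<in> F \<Longrightarrow> \<phi> s \<le> c) \<Longrightarrow> avg F \<phi> \<le> c"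
  using avg_mono[of F \<phi> "\<lambda>_. c"] by simp

lemma avg_abs_le:
  "finite F \<Longrightarrow> F \<noteq> {} \<Longrightarrow> (\<And>s. s \<in> F \<Longrightarrow> \<bar>\<phi> s\<bar> \<le> c) \<Longrightarrow> \<bar>avg F \<phi>\<bar> \<le> c"
  by (rule order_trans[OF avg_abs avg_le])

lemma avg_square_le: "(avg F \<phi>)\<^sup>2 \<le> avg F (\<lambda>s. (\<phi> s)\<^sup>2)"
proof -
  have "(\<Sum>s\<in>F. \<phi> s)\<^sup>2 \<le> real (card F) * (\<Sum>s\<in>F. (\<phi> s)\<^sup>2)"
    using Cauchy_Schwarz_ineq_sum[of "\<lambda>_. 1" \<phi> F] by simp
  then show ?thesis
    unfolding avg_def
    by (cases "card F = 0") (auto simp: field_simps power2_eq_square)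
qed

lemma avg_translate_le:
  fixes s :: "'g::group_add"
  assumes "finite F" and "\<And>t. \<bar>\<phi> t\<bar> \<le> B"
  shows "\<bar>avg F (\<lambda>t. \<phi> (s + t)) - avg F \<phi>\<bar>
           \<le> B * (real (card (sym_diff ((+) s ` F) F)) / real (card F))"
proof -
  let ?A = "(+) s ` F"
  have fA: "finite ?A" using assms(1) by simp
  have e: "(\<Sum>t\<in>F. \<phi> (s + t)) = sum \<phi> ?A"
    by (simp add: sum.reindex inj_on_def)
  have 1: "sum \<phi> ?A = sum \<phi> (?A - F) + sum \<phi> (?A \<inter> F)"
    using fA by (metis sum.Int_Diff add.commute)
  have 2: "sum \<phi> F = sum \<phi> (F - ?A) + sum \<phi> (?A \<inter> F)"
    using assms(1) by (metis sum.Int_Diff add.commute Int_commute)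
  have "\<bar>sum \<phi> ?A - sum \<phi> F\<bar> \<le> \<bar>sum \<phi> (?A - F)\<bar> + \<bar>sum \<phi> (F - ?A)\<bar>"
    using 1 2 by linarith
  also have "\<dots> \<le> (\<Sum>t\<in>?A - F. B) + (\<Sum>t\<in>F - ?A. B)"
    by (intro add_mono order_trans[OF sum_abs] sum_mono assms(2))
  also have "\<dots> = B * real (card (?A - F) + card (F - ?A))"
    by (simp add: algebra_simps)
  also have "card (?A - F) + card (F - ?A) = card (sym_diff ?A F)"
    using fA assms(1) by (subst card_Un_disjoint) auto
  finally have "\<bar>sum \<phi> ?A - sum \<phi> F\<bar> / card F \<le> B * card (sym_diff ?A F) / card F"
    by (rule divide_right_mono) simp
  then show ?thesis
    unfolding avg_def e by (simp add: diff_divide_distrib[symmetric])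
qed

lemma folner_seq_finite: "folner_seq F \<Longrightarrow> finite (F n)"
  and folner_seq_nonempty: "folner_seq F \<Longrightarrow> F n \<noteq> {}"
  by (simp_all add: folner_seq_def)

text \<open>
The bound is uniform in the function \<open>\<phi>\<close>. This is what later gives estimates that are uniform in
the point of the space, with \<open>\<phi>\<close> read along an orbit.
\<close>
lemma folner_avg_translate:
  fixes F :: "nat \<Rightarrow> 'g::group_add set" and s :: 'g
  assumes F: "folner_seq F" and "0 < \<epsilon>"
  shows "\<forall>\<^sub>F n in sequentially. \<forall>\<phi>. (\<forall>t. \<bar>\<phi> t\<bar> \<le> B) \<longrightarrow>
           \<bar>avg (F n) (\<lambda>t. \<phi> (s + t)) - avg (F n) \<phi>\<bar> \<le> \<epsilon>"
proof -
  let ?r = "\<lambda>n. real (card (sym_diff ((+) s ` F n) (F n))) / real (card (F n))"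
  have "(\<lambda>n. B * ?r n) \<longlonglongrightarrow> B * 0"
    using F unfolding folner_seq_def by (intro tendsto_mult_left) auto
  then have "\<forall>\<^sub>F n in sequentially. B * ?r n < \<epsilon>"
    using assms(2) by (intro order_tendstoD) auto
  then show ?thesis
    by eventually_elim
      (blast intro: order_trans[OF avg_translate_le[OF folner_seq_finite[OF F]]] less_imp_le)
qed

section \<open>Existence of tempered Foelner sequences\<close>

lemma card_sym_diff_le:
  fixes s :: "'g::group_add"
  assumes "finite F" "finite B" and "F \<subseteq> B" "(+) s ` F \<subseteq> B"
  shows "card (sym_diff ((+) s ` F) F) \<le> 2 * (card B - card F)"
proof -
  have c: "card ((+) s ` F) = card F"
    by (simp add: card_image inj_on_def)
  have "card (sym_diff ((+) s ` F) F) \<le> card ((+) s ` F - F) + card (F - (+) s ` F)"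
    by (rule card_Un_le)
  also have "\<dots> \<le> card (B - F) + card (B - (+) s ` F)"
    using assms by (intro add_mono card_mono) auto
  also have "\<dots> = 2 * (card B - card F)"
    using assms c by (simp add: card_Diff_subset finite_subset)
  finally show ?thesis .
qed

text \<open>
Abelian groups are amenable because of polynomial growth: the number of sums
\<open>\<Sum>t\<in>T. a t \<cdot> t\<close> with coefficients below \<open>n\<close> is at most \<open>n ^ card T\<close>, so these boxes cannot grow by
a fixed factor at every step, and a box that hardly grows is almost invariant under \<open>T\<close>.
\<close>
lemma ab_group_almost_invariant_set:
  fixes T :: "'g::ab_group_add set"
  assumes "finite T" and "0 < \<epsilon>"
  shows "\<exists>F. finite F \<and> F \<noteq> {} \<and>
           (\<forall>s\<in>T. real (card (sym_diff ((+) s ` F) F)) \<le> \<epsilon> * real (card F))"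
proof -
  define mul where "mul = (\<lambda>(n::nat) (t::'g). \<Sum>i<n. t)"
  define box where "box = (\<lambda>n. (\<lambda>a. \<Sum>t\<in>T. mul (a t) t) ` (T \<rightarrow>\<^sub>E {..<n::nat}))"
  have fin: "finite (box n)" for n
    unfolding box_def by (intro finite_imageI finite_PiE assms(1)) auto
  have card_le: "card (box n) \<le> n ^ card T" for n
    unfolding box_def
    by (rule order_trans[OF card_image_le]) (auto intro!: finite_PiE assms(1) simp: card_PiE assms(1))
  have mono: "box n \<subseteq> box (Suc n)" for n
    unfolding box_def by (rule image_mono) (auto simp: PiE_iff less_Suc_eq)
  have shift: "(+) s ` box n \<subseteq> box (Suc n)" if "s \<in> T" for s n
  proof safe
    fix g assume "g \<in> box n"
    then obtain a where a: "a \<in> T \<rightarrow>\<^sub>E {..<n}" and g: "g = (\<Sum>t\<in>T. mul (a t) t)"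
      unfolding box_def by auto
    let ?a = "a(s := Suc (a s))"
    have "?a \<in> T \<rightarrow>\<^sub>E {..<Suc n}"
      using a that by (auto simp: PiE_iff extensional_def less_Suc_eq)
    moreover have "s + g = (\<Sum>t\<in>T. mul (?a t) t)"
      unfolding g using assms(1) that
      by (simp add: sum.remove[of T s] mul_def algebra_simps)
    ultimately show "s + g \<in> box (Suc n)"
      unfolding box_def by blast
  qed
  have nonempty: "box (Suc n) \<noteq> {}" for n
    unfolding box_def by (auto simp: PiE_eq_empty_iff)
  have "\<exists>n. real (card (box (Suc (Suc n)))) \<le> (1 + \<epsilon> / 2) * real (card (box (Suc n)))"
  proof (rule ccontr)
    assume "\<not> ?thesis"
    then have step: "(1 + \<epsilon> / 2) * real (card (box (Suc n))) \<le> real (card (box (Suc (Suc n))))" for n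
      by (auto simp: not_le intro: less_imp_le)
    have "(1 + \<epsilon> / 2) ^ n \<le> real (card (box (Suc n)))" for n
    proof (induction n)
      case 0
      then show ?case using nonempty[of 0] fin[of "Suc 0"]
        by (simp add: Suc_le_eq card_gt_0_iff)
    next
      case (Suc n)
      have "(1 + \<epsilon> / 2) ^ Suc n \<le> (1 + \<epsilon> / 2) * real (card (box (Suc n)))"
        using Suc assms(2) by (simp add: mult_left_mono)
      then show ?case using step[of n] by linarith
    qed
    then have le: "(1 + \<epsilon> / 2) ^ n \<le> real (Suc n ^ card T)" for n
      using card_le[of "Suc n"] by (meson of_nat_le_iff order_trans)
    define c k where "c = 1 + \<epsilon> / 2" and "k = card T"
    have "c > 1" using assms(2) by (simp add: c_def)
    then have "eventually (\<lambda>n. (real n + 1) ^ k < c ^ n) at_top"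
      by real_asymp
    then obtain n where "(real n + 1) ^ k < c ^ n"
      using eventually_sequentially by auto
    then show False using le[of n] by (simp add: c_def k_def add.commute)
  qed
  then obtain n where n: "real (card (box (Suc (Suc n)))) \<le> (1 + \<epsilon> / 2) * real (card (box (Suc n)))"
    by blast
  have "real (card (sym_diff ((+) s ` box (Suc n)) (box (Suc n)))) \<le> \<epsilon> * real (card (box (Suc n)))"
    if "s \<in> T" for s
  proof -
    have "card (sym_diff ((+) s ` box (Suc n)) (box (Suc n)))
            \<le> 2 * (card (box (Suc (Suc n))) - card (box (Suc n)))"
      by (rule card_sym_diff_le[OF fin fin mono shift[OF that]])
    then have "real (card (sym_diff ((+) s ` box (Suc n)) (box (Suc n))))
            \<le> 2 * (real (card (box (Suc (Suc n)))) - real (card (box (Suc n))))"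
      by (subst of_nat_diff[OF card_mono[OF fin mono], symmetric]) linarith
    then show ?thesis using n by (simp add: algebra_simps)
  qed
  then show ?thesis using fin[of "Suc n"] nonempty[of n] by (intro exI[of _ "box (Suc n)"] conjI ballI)
qed

lemma card_union_translates_le:
  fixes F :: "'g::group_add set"
  assumes "finite T" "finite F"
    and "\<And>t. t \<in> T \<Longrightarrow> real (card (sym_diff ((+) t ` F) F)) \<le> \<epsilon> * real (card F)"
  shows "real (card (\<Union>t\<in>T. (+) t ` F)) \<le> (1 + real (card T) * \<epsilon>) * real (card F)"
proof -
  have "card (\<Union>t\<in>T. (+) t ` F) \<le> card (F \<union> (\<Union>t\<in>T. (+) t ` F - F))"
    using assms by (intro card_mono) auto
  also have "\<dots> \<le> card F + (\<Sum>t\<in>T. card ((+) t ` F - F))"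
    using card_UN_le[OF assms(1), of "\<lambda>t. (+) t ` F - F"]
    by (intro order_trans[OF card_Un_le] add_left_mono)
  finally have "real (card (\<Union>t\<in>T. (+) t ` F)) \<le> real (card F) + (\<Sum>t\<in>T. real (card ((+) t ` F - F)))"
    by (simp flip: of_nat_sum of_nat_add)
  also have "\<dots> \<le> real (card F) + (\<Sum>t\<in>T. \<epsilon> * real (card F))"
  proof (intro add_left_mono sum_mono)
    fix t assume "t \<in> T"
    have "card ((+) t ` F - F) \<le> card (sym_diff ((+) t ` F) F)"
      using assms by (intro card_mono) auto
    then show "real (card ((+) t ` F - F)) \<le> \<epsilon> * real (card F)"
      using assms(3)[OF \<open>t \<in> T\<close>] by linarith
  qed
  finally show ?thesis by (simp add: algebra_simps)
qed

text \<open>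
Each term is chosen almost invariant under the first elements of an enumeration of the group and
under the negatives of all elements of the earlier terms. The union of translates that enters
temperedness is then at most twice as large as the term.
\<close>
theorem exists_tempered_folner_seq:
  assumes "countable (UNIV :: 'g::ab_group_add set)"
  shows "\<exists>F :: nat \<Rightarrow> 'g set. folner_seq F \<and> tempered F"
proof -
  define e :: "nat \<Rightarrow> 'g" where "e = from_nat_into UNIV"
  have e: "range e = UNIV"
    unfolding e_def using assms by (simp add: range_from_nat_into)
  define T where "T = (\<lambda>(f :: nat \<Rightarrow> 'g set) n. e ` {..n} \<union> (\<Union>k<n. uminus ` f k))"
  \<comment> \<open>Because of the factor \<open>card (T f n) + 1\<close> the errors at all elements of \<open>T f n\<close> add up to at most
    \<open>card r\<close>; because of the factor \<open>n + 1\<close> the relative error at a fixed element tends to 0.\<close>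
  define good where "good = (\<lambda>f n r. finite r \<and> r \<noteq> {} \<and>
     (\<forall>s\<in>T f n. real (card (sym_diff ((+) s ` r) r))
        \<le> 1 / (real (n + 1) * (real (card (T f n)) + 1)) * real (card r)))"
  have "\<exists>f. \<forall>n. good f n (f n)"
  proof (rule dependent_wf_choice[where R=less_than])
    fix f g :: "nat \<Rightarrow> 'g set" and n r
    assume "\<And>k. (k, n) \<in> less_than \<Longrightarrow> f k = g k"
    then have "T f n = T g n" unfolding T_def by auto
    then show "good f n r = good g n r" unfolding good_def by simp
  next
    fix n f assume "\<And>k. (k, n) \<in> less_than \<Longrightarrow> good f k (f k)"
    then have "finite (T f n)" unfolding T_def good_def by auto
    then show "\<exists>r. good f n r"
      unfolding good_def by (intro ab_group_almost_invariant_set) auto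
  qed auto
  then obtain F where F: "\<And>n. good F n (F n)" by blast
  then have fin: "finite (F n)" and ne: "F n \<noteq> {}" for n
    unfolding good_def by auto
  have finT: "finite (T F n)" for n unfolding T_def using fin by auto
  have inv: "real (card (sym_diff ((+) s ` F n) (F n)))
      \<le> 1 / (real (n + 1) * (real (card (T F n)) + 1)) * real (card (F n))" if "s \<in> T F n" for s n
    using F[of n] that unfolding good_def by auto
  have "(\<lambda>n. real (card (sym_diff ((+) s ` F n) (F n))) / real (card (F n))) \<longlonglongrightarrow> 0" for s
  proof -
    obtain m where m: "s = e m" using e by (metis rangeE UNIV_I)
    have upper: "\<forall>\<^sub>F n in sequentially.
        real (card (sym_diff ((+) s ` F n) (F n))) / real (card (F n)) \<le> 1 / real (n + 1)"
    proof (rule eventually_sequentiallyI[of m])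
      fix n assume "m \<le> n"
      then have "s \<in> T F n" unfolding T_def m by auto
      have "real (card (sym_diff ((+) s ` F n) (F n))) \<le> 1 / (real (n + 1) * (real (card (T F n)) + 1)) * real (card (F n))"
        by (rule inv) fact
      also have "\<dots> \<le> 1 / (real (n + 1) * 1) * real (card (F n))"
        by (intro mult_right_mono divide_left_mono mult_left_mono) auto
      finally show "real (card (sym_diff ((+) s ` F n) (F n))) / real (card (F n)) \<le> 1 / real (n + 1)"
        using fin ne by (simp only: mult_1_right pos_divide_le_eq of_nat_0_less_iff card_gt_0_iff not_False_eq_True simp_thms)
    qed
    have lim: "(\<lambda>n. 1 / real (n + 1)) \<longlonglongrightarrow> 0"
      using LIMSEQ_Suc[OF lim_1_over_n] by (simp add: add.commute)
    have lower: "\<forall>\<^sub>F n in sequentially. 0 \<le> real (card (sym_diff ((+) s ` F n) (F n))) / real (card (F n))"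
      by (intro always_eventually allI divide_nonneg_nonneg) simp_all
    show ?thesis
      by (rule tendsto_sandwich[OF lower upper tendsto_const lim])
  qed
  then have "folner_seq F"
    unfolding folner_seq_def using fin ne by auto
  moreover have "real (card (\<Union>k\<in>{1..n-1}. {- a + b | a b. a \<in> F k \<and> b \<in> F n})) \<le> 2 * real (card (F n))"
    if "n > 1" for n
  proof -
    have "(\<Union>k\<in>{1..n-1}. {- a + b | a b. a \<in> F k \<and> b \<in> F n}) \<subseteq> (\<Union>t\<in>T F n. (+) t ` F n)"
      using that unfolding T_def by fastforce
    then have "real (card (\<Union>k\<in>{1..n-1}. {- a + b | a b. a \<in> F k \<and> b \<in> F n})) \<le> real (card (\<Union>t\<in>T F n. (+) t ` F n))"
      using fin finT by (intro of_nat_mono card_mono) auto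
    also have "\<dots> \<le> (1 + real (card (T F n)) * (1 / (real (n + 1) * (real (card (T F n)) + 1)))) * real (card (F n))"
      by (rule card_union_translates_le[OF finT fin inv])
    also have "\<dots> \<le> (1 + 1) * real (card (F n))"
    proof (intro mult_right_mono add_left_mono)
      have "real (card (T F n)) \<le> real (n + 1) * (real (card (T F n)) + 1)"
        by (simp add: algebra_simps)
      then show "real (card (T F n)) * (1 / (real (n + 1) * (real (card (T F n)) + 1))) \<le> 1"
        by (simp add: divide_le_eq)
    qed auto
    finally show ?thesis by simp
  qed
  then have "tempered F" unfolding tempered_def by (intro exI[of _ 2]) auto
  ultimately show ?thesis by blast
qed

section \<open>A covering lemma for tempered sequences\<close>

text \<open>
A fractional form of Lindenstrauss' random covering lemma. Every point \<open>a\<close> of \<open>A\<close> carries a translate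
\<open>a + F (lev a)\<close>; the aim is to give these translates weights that never add up to more than 1 at a
point of the group but carry a fixed share of the mass of \<open>A\<close>. The weights are assigned greedily from
the highest level down: a translate gets weight \<open>1 / (2 |F (lev a)|)\<close> unless the load caused by
higher levels exceeds one half somewhere on it. Translates of one level together never load a point
by more than one half. If \<open>a\<close> is rejected, the \<open>b\<close> of higher level with
\<open>a \<in> b + (F (lev b) - F (lev a))\<close> have total weight above one half. For given \<open>b\<close>, temperedness bounds
the number of possible \<open>a\<close> by a multiple of \<open>|F (lev b)|\<close>, so the rejected points are controlled by
the mass of the accepted translates.
\<close>
lemma fractional_covering:
  fixes F :: "nat \<Rightarrow> 'g::ab_group_add set"
  assumes fin: "\<And>n. finite (F n)" and ne: "\<And>n. F n \<noteq> {}"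
    and temp: "\<And>n. n > 1 \<Longrightarrow>
       real (card (\<Union>k\<in>{1..n-1}. {- a + b | a b. a \<in> F k \<and> b \<in> F n})) \<le> C * real (card (F n))"
    and "0 \<le> C" and A: "finite A" and lev: "\<And>a. a \<in> A \<Longrightarrow> 1 \<le> lev a"
  shows "\<exists>w. (\<forall>a. 0 \<le> w a) \<and>
             (\<forall>g. (\<Sum>a | a \<in> A \<and> g \<in> (+) a ` F (lev a). w a) \<le> 1) \<and>
             real (card A) \<le> (2 + 2 * C) * (\<Sum>a\<in>A. w a * real (card (F (lev a))))"
proof -
  define load where "load = (\<lambda>w m g. \<Sum>b | b \<in> A \<and> lev b > m \<and> g \<in> (+) b ` F (lev b). w b :: real)"
  define free where "free = (\<lambda>w a. \<forall>g\<in>(+) a ` F (lev a). load w (lev a) g \<le> 1 / 2)"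
  \<comment> \<open>The weight of \<open>a\<close> refers only to weights at higher levels.\<close>
  have "\<exists>w. \<forall>a. w a = (if free w a then 1 / (2 * real (card (F (lev a)))) else 0)"
  proof (rule dependent_wf_choice[where R="Wellfounded.measure (\<lambda>a. Max (lev ` A) - lev a)"])
    fix v w :: "'g \<Rightarrow> real" and a r
    assume eq: "\<And>b. (b, a) \<in> Wellfounded.measure (\<lambda>a. Max (lev ` A) - lev a) \<Longrightarrow> v b = w b"
    have "load v (lev a) g = load w (lev a) g" for g
      unfolding load_def
    proof (rule sum.cong[OF refl])
      fix b assume "b \<in> {b \<in> A. lev b > lev a \<and> g \<in> (+) b ` F (lev b)}"
      then have "lev b \<le> Max (lev ` A)" "lev b > lev a" using A by auto
      then show "v b = w b" by (intro eq) auto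
    qed
    then show "(r = (if free v a then 1 / (2 * real (card (F (lev a)))) else 0)) =
               (r = (if free w a then 1 / (2 * real (card (F (lev a)))) else 0))"
      unfolding free_def by simp
  qed auto
  then obtain w where w: "\<And>a. w a = (if free w a then 1 / (2 * real (card (F (lev a)))) else 0)"
    by blast
  have w0: "0 \<le> w a" for a by (subst w) auto
  have le1: "(\<Sum>a | a \<in> A \<and> g \<in> (+) a ` F (lev a). w a) \<le> 1" for g
  proof -
    define S where "S = {a. a \<in> A \<and> g \<in> (+) a ` F (lev a)}"
    define S' where "S' = {a \<in> S. w a > 0}"
    have finS: "finite S" unfolding S_def using A by auto
    have sum_S: "sum w S = sum w S'"
      unfolding S'_def using w0 by (intro sum.mono_neutral_right[OF finS]) (auto simp: less_le)
    show ?thesis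
    proof (cases "S' = {}")
      case True then show ?thesis using sum_S by (simp add: S_def)
    next
      case False
      \<comment> \<open>All translates through \<open>g\<close> with positive weight have level at least that of \<open>a\<close>, and \<open>a\<close> is free.\<close>
      then obtain a where a: "a \<in> S'" and min: "\<And>b. b \<in> S' \<Longrightarrow> lev a \<le> lev b"
        using ex_has_least_nat[of "\<lambda>a. a \<in> S'" _ lev] by blast
      have "free w a" using a w[of a] unfolding S'_def by (auto split: if_splits)
      then have l1: "load w (lev a) g \<le> 1 / 2"
        using a unfolding free_def S'_def S_def by auto
      let ?E = "{b \<in> S'. lev b = lev a}"
      let ?H = "{b. b \<in> A \<and> lev b > lev a \<and> g \<in> (+) b ` F (lev b)}"
      have "card ?E \<le> card ((\<lambda>f. g - f) ` F (lev a))"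
        using fin by (intro card_mono) (auto simp: S'_def S_def image_iff algebra_simps)
      also have "\<dots> \<le> card (F (lev a))" using fin by (rule card_image_le)
      finally have "sum w ?E \<le> real (card (F (lev a))) * (1 / (2 * real (card (F (lev a)))))"
        by (intro order_trans[OF sum_bounded_above[where K="1 / (2 * real (card (F (lev a))))"]] mult_right_mono)
          (auto simp: w)
      then have l2: "sum w ?E \<le> 1 / 2" using fin ne by (simp add: card_gt_0_iff)
      have "sum w S' \<le> sum w (?E \<union> ?H)"
        using min A w0 by (intro sum_mono2) (force simp: S'_def S_def)+
      also have "\<dots> \<le> sum w ?E + sum w ?H"
        using A finS w0 by (subst sum.union_disjoint) (auto simp: S'_def)
      finally show ?thesis using l1 l2 sum_S unfolding load_def S_def by linarith
    qed
  qed
  define E where "E = (\<lambda>n. \<Union>k\<in>{1..n-1}. {- a + b | a b. a \<in> F k \<and> b \<in> F n})"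
  have cardE: "real (card (E n)) \<le> C * real (card (F n))" if "n \<ge> 1" for n
  proof (cases "n = 1")
    case True then show ?thesis using \<open>0 \<le> C\<close> by (simp add: E_def)
  next
    case False then show ?thesis using that temp[of n] by (simp add: E_def)
  qed
  have finE: "finite (E n)" for n
  proof -
    have "E n \<subseteq> (\<Union>k\<in>{1..n-1}. (\<lambda>(a,b). - a + b) ` (F k \<times> F n))" unfolding E_def by auto
    then show ?thesis using fin by (auto intro: finite_subset)
  qed
  let ?W = "\<Sum>a\<in>A. w a * real (card (F (lev a)))"
  define good bad where "good = {a \<in> A. free w a}" and "bad = {a \<in> A. \<not> free w a}"
  have fg: "finite good" "finite bad" using A by (auto simp: good_def bad_def)
  have "real (card good) / 2 = (\<Sum>a\<in>good. w a * real (card (F (lev a))))"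
    using fin ne by (simp add: good_def w card_gt_0_iff)
  also have "\<dots> \<le> ?W"
    using A w0 by (intro sum_mono2) (auto simp: good_def)
  finally have 1: "real (card good) \<le> 2 * ?W" by simp
  have bad: "1 / 2 \<le> (\<Sum>b\<in>A. if a - b \<in> E (lev b) then w b else 0)" if "a \<in> bad" for a
  proof -
    obtain f where f: "f \<in> F (lev a)" and l: "load w (lev a) (a + f) > 1 / 2"
      using \<open>a \<in> bad\<close> unfolding bad_def free_def by (auto simp: not_le)
    have aA: "a \<in> A" using that by (simp add: bad_def)
    have "load w (lev a) (a + f) \<le> (\<Sum>b | b \<in> A \<and> a - b \<in> E (lev b). w b)"
      unfolding load_def
    proof (rule sum_mono2)
      show "{b. b \<in> A \<and> lev a < lev b \<and> a + f \<in> (+) b ` F (lev b)} \<subseteq> {b. b \<in> A \<and> a - b \<in> E (lev b)}"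
      proof safe
        fix b h assume b: "b \<in> A" "lev a < lev b" "h \<in> F (lev b)" "a + f = b + h"
        have "a - b = - f + h" using b(4) by (simp add: algebra_simps)
        moreover have "lev a \<in> {1..lev b - 1}" using lev[OF aA] b(2) by auto
        ultimately show "a - b \<in> E (lev b)" unfolding E_def using f b(3) by blast
      qed
    qed (use A w0 in auto)
    also have "\<dots> = (\<Sum>b\<in>A. if a - b \<in> E (lev b) then w b else 0)"
      using A by (simp add: sum.inter_filter)
    finally show ?thesis using l by simp
  qed
  have "real (card bad) / 2 \<le> (\<Sum>a\<in>bad. \<Sum>b\<in>A. if a - b \<in> E (lev b) then w b else 0)"
    using sum_mono[OF bad, of bad "\<lambda>a. a"] by simp
  also have "\<dots> = (\<Sum>b\<in>A. \<Sum>a\<in>bad. if a - b \<in> E (lev b) then w b else 0)"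
    by (rule sum.swap)
  also have "\<dots> \<le> (\<Sum>b\<in>A. C * (w b * real (card (F (lev b)))))"
  proof (rule sum_mono)
    fix b assume b: "b \<in> A"
    have "(\<Sum>a\<in>bad. if a - b \<in> E (lev b) then w b else 0) = real (card {a \<in> bad. a - b \<in> E (lev b)}) * w b"
      using fg by (simp flip: sum.inter_filter)
    also have "card {a \<in> bad. a - b \<in> E (lev b)} \<le> card ((+) b ` E (lev b))"
      using finE by (intro card_mono) (auto intro!: image_eqI[where f="(+) b", of _ "_ - b"])
    then have "real (card {a \<in> bad. a - b \<in> E (lev b)}) \<le> C * real (card (F (lev b)))"
      using card_image_le[OF finE, of "(+) b" "lev b"] cardE[OF lev[OF b]] by linarith
    then have "real (card {a \<in> bad. a - b \<in> E (lev b)}) * w b \<le> C * (w b * real (card (F (lev b))))"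
      using mult_right_mono[OF _ w0[of b]] by (metis mult.assoc mult.commute)
    finally show "(\<Sum>a\<in>bad. if a - b \<in> E (lev b) then w b else 0) \<le> C * (w b * real (card (F (lev b))))" .
  qed
  also have "\<dots> = C * ?W" by (simp add: sum_distrib_left)
  finally have 2: "real (card bad) \<le> 2 * C * ?W" by simp
  have "A = good \<union> bad" "good \<inter> bad = {}" by (auto simp: good_def bad_def)
  then have "card A = card good + card bad" using fg by (simp add: card_Un_disjoint)
  then have "real (card A) \<le> (2 + 2 * C) * ?W"
    using 1 2 by (simp add: algebra_simps)
  then show ?thesis using w0 le1 by blast
qed

section \<open>Measure-preserving actions of an abelian group\<close>

lemma (in finite_measure) integrable_bounded:
  fixes f :: "'a \<Rightarrow> real"
  assumes "f \<in> borel_measurable M" and "\<And>x. \<bar>f x\<bar> \<le> B"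
  shows "integrable M f"
  using assms by (intro integrable_const_bound[where B=B]) auto

lemma (in prob_space) integral_le_bound:
  fixes f :: "'a \<Rightarrow> real"
  assumes "f \<in> borel_measurable M" and "\<And>x. \<bar>f x\<bar> \<le> B" and "\<And>x. f x \<le> c"
  shows "(\<integral>x. f x \<partial>M) \<le> c"
  using integral_mono[OF integrable_bounded[OF assms(1,2)] integrable_const[of c]] assms(3)
  by (simp add: prob_space)

text \<open>
The comparison of the \<open>L\<^sup>1\<close> and \<open>L\<^sup>2\<close> norms, obtained by integrating
\<open>\<bar>f\<bar> \<le> f\<^sup>2 / (2 \<epsilon>) + \<epsilon> / 2\<close>.
\<close>
lemma (in prob_space) L1_bound_by_square:
  fixes f :: "'a \<Rightarrow> real"
  assumes [measurable]: "f \<in> borel_measurable M" and B: "\<And>x. \<bar>f x\<bar> \<le> B"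
    and "0 < \<epsilon>" and sq: "(\<integral>x. (f x)\<^sup>2 \<partial>M) < \<epsilon>\<^sup>2"
  shows "(\<integral>x. \<bar>f x\<bar> \<partial>M) < \<epsilon>"
proof -
  have i: "integrable M (\<lambda>x. (f x)\<^sup>2)"
    using B by (intro integrable_bounded[where B="B\<^sup>2"]) (auto simp flip: abs_le_square_iff intro: order_trans[OF _ abs_ge_self])
  have "\<bar>f x\<bar> \<le> (f x)\<^sup>2 / (2 * \<epsilon>) + \<epsilon> / 2" for x
  proof -
    have "0 \<le> (\<bar>f x\<bar> - \<epsilon>)\<^sup>2" by simp
    then show ?thesis using \<open>0 < \<epsilon>\<close> by (simp add: field_simps power2_eq_square)
  qed
  then have "(\<integral>x. \<bar>f x\<bar> \<partial>M) \<le> (\<integral>x. (f x)\<^sup>2 / (2 * \<epsilon>) + \<epsilon> / 2 \<partial>M)"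
    using B i integrable_bounded[of "\<lambda>x. \<bar>f x\<bar>" B] by (intro integral_mono) auto
  also have "\<dots> = (\<integral>x. (f x)\<^sup>2 \<partial>M) / (2 * \<epsilon>) + \<epsilon> / 2"
    using i by (simp add: prob_space)
  also have "\<dots> < \<epsilon>\<^sup>2 / (2 * \<epsilon>) + \<epsilon> / 2"
    using sq \<open>0 < \<epsilon>\<close> by (simp add: divide_strict_right_mono)
  also have "\<dots> = \<epsilon>" using \<open>0 < \<epsilon>\<close> by (simp add: power2_eq_square)
  finally show ?thesis .
qed

text \<open>
The limit \<open>g\<close> is an argument because it sometimes has to be constructed by hand, so as to keep a
property that holds at every point and not only almost everywhere.
\<close>
lemma (in prob_space) L1_Cauchy_AE_subseq_tendsto:
  fixes f :: "nat \<Rightarrow> 'a \<Rightarrow> real"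
  assumes [measurable]: "\<And>n. f n \<in> borel_measurable M" "g \<in> borel_measurable M"
    and B: "\<And>n x. \<bar>f n x\<bar> \<le> B" "\<And>x. \<bar>g x\<bar> \<le> B"
    and Cauchy: "\<And>\<epsilon>. 0 < \<epsilon> \<Longrightarrow> \<exists>N. \<forall>i\<ge>N. \<forall>j\<ge>N. (\<integral>x. \<bar>f i x - f j x\<bar> \<partial>M) < \<epsilon>"
    and r: "strict_mono r" and ae: "AE x in M. (\<lambda>j. f (r j) x) \<longlonglongrightarrow> g x"
  shows "(\<lambda>n. \<integral>x. \<bar>f n x - g x\<bar> \<partial>M) \<longlonglongrightarrow> 0"
proof (rule LIMSEQ_I)
  fix \<epsilon> :: real assume "0 < \<epsilon>"
  then obtain N where N: "\<And>i j. i \<ge> N \<Longrightarrow> j \<ge> N \<Longrightarrow> (\<integral>x. \<bar>f i x - f j x\<bar> \<partial>M) < \<epsilon> / 2"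
    using Cauchy[of "\<epsilon> / 2"] by auto
  have "norm ((\<integral>x. \<bar>f n x - g x\<bar> \<partial>M) - 0) < \<epsilon>" if "n \<ge> N" for n
  proof -
    have "(\<lambda>j. \<integral>x. \<bar>f n x - f (r j) x\<bar> \<partial>M) \<longlonglongrightarrow> (\<integral>x. \<bar>f n x - g x\<bar> \<partial>M)"
    proof (rule integral_dominated_convergence[where w="\<lambda>_. 2 * B"])
      show "AE x in M. (\<lambda>j. \<bar>f n x - f (r j) x\<bar>) \<longlonglongrightarrow> \<bar>f n x - g x\<bar>"
        using ae by eventually_elim (auto intro!: tendsto_intros)
      show "AE x in M. norm \<bar>f n x - f (r j) x\<bar> \<le> 2 * B" for j
        using B(1)[of n] B(1)[of "r j"] by (intro always_eventually allI) (smt (verit) real_norm_def)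
    qed auto
    moreover have "\<forall>\<^sub>F j in sequentially. (\<integral>x. \<bar>f n x - f (r j) x\<bar> \<partial>M) \<le> \<epsilon> / 2"
      using N[OF that] order_trans[OF _ seq_suble[OF r]]
      by (intro eventually_sequentiallyI[of N] less_imp_le) blast
    ultimately have "(\<integral>x. \<bar>f n x - g x\<bar> \<partial>M) \<le> \<epsilon> / 2"
      by (rule tendsto_upperbound) simp
    then show ?thesis using \<open>0 < \<epsilon>\<close> by simp
  qed
  then show "\<exists>N. \<forall>n\<ge>N. norm ((\<integral>x. \<bar>f n x - g x\<bar> \<partial>M) - 0) < \<epsilon>" by blast
qed

lemma (in prob_space) L1_Cauchy_bounded_limit:
  fixes f :: "nat \<Rightarrow> 'a \<Rightarrow> real"
  assumes [measurable]: "\<And>n. f n \<in> borel_measurable M" and B: "\<And>n x. \<bar>f n x\<bar> \<le> B"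
    and Cauchy: "\<And>\<epsilon>. 0 < \<epsilon> \<Longrightarrow> \<exists>N. \<forall>i\<ge>N. \<forall>j\<ge>N. (\<integral>x. \<bar>f i x - f j x\<bar> \<partial>M) < \<epsilon>"
  shows "\<exists>g\<in>borel_measurable M. (\<forall>x. \<bar>g x\<bar> \<le> B) \<and> (\<lambda>n. \<integral>x. \<bar>f n x - g x\<bar> \<partial>M) \<longlonglongrightarrow> 0"
proof -
  have "0 \<le> B" using B[of 0 undefined] by linarith
  have int: "integrable M (f n)" for n by (rule integrable_bounded[OF _ B]) simp
  obtain r where r: "strict_mono r" and C: "AE x in M. Cauchy (\<lambda>j. f (r j) x)"
    using cauchy_L1_AE_cauchy_subseq[of M f] int Cauchy by auto
  define g where "g = (\<lambda>x. if Cauchy (\<lambda>j. f (r j) x) then lim (\<lambda>j. f (r j) x) else 0)"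
  have gm: "g \<in> borel_measurable M" unfolding g_def by measurable
  have lim: "(\<lambda>j. f (r j) x) \<longlonglongrightarrow> g x" if "Cauchy (\<lambda>j. f (r j) x)" for x
    using that unfolding g_def by (simp add: convergent_eq_Cauchy convergent_LIMSEQ_iff[symmetric] flip: Cauchy_convergent_iff)
  have gB: "\<bar>g x\<bar> \<le> B" for x
  proof (cases "Cauchy (\<lambda>j. f (r j) x)")
    case True
    show ?thesis
      by (rule tendsto_upperbound[OF tendsto_rabs[OF lim[OF True]]]) (use B in auto)
  next
    case False then show ?thesis using \<open>0 \<le> B\<close> by (simp add: g_def)
  qed
  have "(\<lambda>n. \<integral>x. \<bar>f n x - g x\<bar> \<partial>M) \<longlonglongrightarrow> 0"
    by (rule L1_Cauchy_AE_subseq_tendsto[where B=B and r=r]) (use gm B gB Cauchy r C lim in auto)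
  then show ?thesis using gm gB by blast
qed

locale measure_action = prob_space M for M :: "'a measure" +
  fixes T :: "'g::ab_group_add \<Rightarrow> 'a \<Rightarrow> 'a"
  assumes space_UNIV: "space M = UNIV"
    and T_measurable [measurable]: "T s \<in> measurable M M"
    and T_zero: "T 0 x = x"
    and T_add: "T (s + t) x = T s (T t x)"
    and distr_T: "distr M M (T s) = M"
begin

lemma integral_T:
  fixes f :: "'a \<Rightarrow> real"
  assumes "f \<in> borel_measurable M"
  shows "(\<integral>x. f (T s x) \<partial>M) = (\<integral>x. f x \<partial>M)"
proof -
  have "(\<integral>x. f (T s x) \<partial>M) = (\<integral>x. f x \<partial>distr M M (T s))"
    using assms by (simp add: integral_distr)
  then show ?thesis by (simp add: distr_T)
qed

lemma AE_T:
  assumes "AE x in M. P x"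
  shows "AE x in M. P (T s x)"
proof -
  have "AE x in distr M M (T s). P x" by (subst distr_T) (rule assms)
  then show ?thesis by (rule AE_distrD[rotated]) simp
qed

definition erg_avg :: "'g set \<Rightarrow> ('a \<Rightarrow> real) \<Rightarrow> 'a \<Rightarrow> real" where
  "erg_avg F h x = avg F (\<lambda>s. h (T s x))"

lemma erg_avg_measurable [measurable]:
  assumes [measurable]: "h \<in> borel_measurable M"
  shows "erg_avg F h \<in> borel_measurable M"
  unfolding erg_avg_def[abs_def] avg_def by measurable

lemma erg_avg_bounded:
  "finite F \<Longrightarrow> F \<noteq> {} \<Longrightarrow> (\<And>x. \<bar>h x\<bar> \<le> B) \<Longrightarrow> \<bar>erg_avg F h x\<bar> \<le> B"
  unfolding erg_avg_def by (rule avg_abs_le) auto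

lemma integral_erg_avg:
  assumes F: "finite F" "F \<noteq> {}" and [measurable]: "h \<in> borel_measurable M" and B: "\<And>x. \<bar>h x\<bar> \<le> B"
  shows "(\<integral>x. erg_avg F h x \<partial>M) = (\<integral>x. h x \<partial>M)"
proof -
  have "(\<integral>x. erg_avg F h x \<partial>M) = (\<Sum>s\<in>F. \<integral>x. h (T s x) \<partial>M) / card F"
    unfolding erg_avg_def avg_def using B
    by (simp add: Bochner_Integration.integral_sum integrable_bounded[where B=B])
  then show ?thesis using F by (simp add: integral_T)
qed

lemma erg_avg_almost_invariant:
  assumes "folner_seq F" and "\<And>x. \<bar>h x\<bar> \<le> B" and "0 < \<epsilon>"
  shows "\<forall>\<^sub>F n in sequentially. \<forall>x. \<bar>erg_avg (F n) h (T s x) - erg_avg (F n) h x\<bar> \<le> \<epsilon>"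
  using folner_avg_translate[OF assms(1,3), of B s]
proof eventually_elim
  case (elim n)
  show ?case
  proof
    fix x
    have "erg_avg (F n) h (T s x) = avg (F n) (\<lambda>t. h (T (s + t) x))"
      unfolding erg_avg_def by (simp add: T_add[symmetric] add.commute)
    then show "\<bar>erg_avg (F n) h (T s x) - erg_avg (F n) h x\<bar> \<le> \<epsilon>"
      using elim[rule_format, of "\<lambda>t. h (T t x)"] assms(2) by (simp add: erg_avg_def)
  qed
qed

text \<open>
The von Neumann ergodic theorem by the parallelogram law. Averaging over a far set \<open>F l\<close> does not
notice an earlier averaging, so the \<open>L\<^sup>2\<close> norms of the averages converge to their infimum \<open>c\<close>, and
midpoints of two averages have norm at least \<open>c\<close> as well. Two averages whose norms are close to \<open>c\<close>
and whose midpoint has norm at least \<open>c\<close> are close to each other.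
\<close>
lemma erg_avg_L1_Cauchy:
  assumes F: "folner_seq F" and hm [measurable]: "h \<in> borel_measurable M" and B: "\<And>x. \<bar>h x\<bar> \<le> B"
    and "0 < \<epsilon>"
  shows "\<exists>N. \<forall>i\<ge>N. \<forall>j\<ge>N. (\<integral>x. \<bar>erg_avg (F i) h x - erg_avg (F j) h x\<bar> \<partial>M) < \<epsilon>"
proof -
  have fin: "finite (F n)" "F n \<noteq> {}" for n
    using F by (auto simp: folner_seq_finite folner_seq_nonempty)
  have "0 \<le> B" using B[of undefined] by linarith
  define A where "A = (\<lambda>n. erg_avg (F n) h)"
  have Am [measurable]: "A n \<in> borel_measurable M" for n unfolding A_def by measurable
  have AB: "\<bar>A n x\<bar> \<le> B" for n x unfolding A_def by (rule erg_avg_bounded[OF fin B])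
  define P where "P = (\<lambda>m n x. (A m x + A n x) / 2)"
  have Pm [measurable]: "P m n \<in> borel_measurable M" for m n unfolding P_def by measurable
  have PB: "\<bar>P m n x\<bar> \<le> B" for m n x using AB[of m x] AB[of n x] unfolding P_def by (auto simp: abs_le_iff)
  have sq_le: "\<bar>y\<^sup>2\<bar> \<le> B\<^sup>2" if "\<bar>y\<bar> \<le> B" for y :: real
    using that power_mono[OF that, of 2] by simp
  define a where "a = (\<lambda>n. \<integral>x. (A n x)\<^sup>2 \<partial>M)"
  define q where "q = (\<lambda>m n. \<integral>x. (P m n x)\<^sup>2 \<partial>M)"
  have int_sq: "integrable M (\<lambda>x. (f x)\<^sup>2)" if "f \<in> borel_measurable M" "\<And>x. \<bar>f x\<bar> \<le> B" for f
    using that sq_le by (intro integrable_bounded[where B="B\<^sup>2"]) auto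
  have ev: "\<forall>\<^sub>F l in sequentially. a l \<le> q m n + \<delta>" if "0 < \<delta>" for m n \<delta>
  proof -
    define d where "d = \<delta> / (2 * B + 1)"
    have "0 < d" using that \<open>0 \<le> B\<close> unfolding d_def by simp
    have "\<forall>\<^sub>F l in sequentially. \<forall>s\<in>F m \<union> F n. \<forall>x. \<bar>A l (T s x) - A l x\<bar> \<le> d"
      unfolding A_def using fin erg_avg_almost_invariant[OF F B \<open>0 < d\<close>]
      by (intro eventually_ball_finite) auto
    then show ?thesis
    proof eventually_elim
      case (elim l)
      have swap: "\<bar>erg_avg (F l) (A k) x - A l x\<bar> \<le> d" if "k \<in> {m, n}" for k x
      proof -
        have "erg_avg (F l) (A k) x = avg (F k) (\<lambda>s. A l (T s x))"
          unfolding A_def erg_avg_def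
          by (subst avg_avg) (simp add: T_add[symmetric] add.commute)
        then have "erg_avg (F l) (A k) x - A l x = avg (F k) (\<lambda>s. A l (T s x) - A l x)"
          using fin by (simp add: avg_diff)
        then show ?thesis
          using avg_abs_le[OF fin, of k "\<lambda>s. A l (T s x) - A l x" d] elim that by auto
      qed
      have close: "\<bar>erg_avg (F l) (P m n) x - A l x\<bar> \<le> d" for x
      proof -
        have "erg_avg (F l) (P m n) x = (erg_avg (F l) (A m) x + erg_avg (F l) (A n) x) / 2"
          unfolding erg_avg_def P_def avg_def by (simp add: sum_divide_distrib[symmetric] sum.distrib add_divide_distrib)
        then show ?thesis using swap[of m x] swap[of n x] by (auto simp: abs_le_iff field_simps)
      qed
      have "(A l x)\<^sup>2 \<le> erg_avg (F l) (\<lambda>x. (P m n x)\<^sup>2) x + d * (2 * B)" for x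
      proof -
        have EB: "\<bar>erg_avg (F l) (P m n) x\<bar> \<le> B" by (rule erg_avg_bounded[OF fin PB])
        have "(A l x)\<^sup>2 - (erg_avg (F l) (P m n) x)\<^sup>2
              = (A l x - erg_avg (F l) (P m n) x) * (A l x + erg_avg (F l) (P m n) x)"
          by (simp add: power2_eq_square algebra_simps)
        also have "\<dots> \<le> \<bar>A l x - erg_avg (F l) (P m n) x\<bar> * \<bar>A l x + erg_avg (F l) (P m n) x\<bar>"
          by (metis abs_ge_self abs_mult)
        also have "\<dots> \<le> d * (2 * B)"
          using close[of x] AB[of l x] EB \<open>0 < d\<close> by (intro mult_mono) auto
        finally show ?thesis
          using avg_square_le[of "F l" "\<lambda>s. P m n (T s x)"] unfolding erg_avg_def by linarith
      qed
      then have "a l \<le> (\<integral>x. erg_avg (F l) (\<lambda>x. (P m n x)\<^sup>2) x + d * (2 * B) \<partial>M)"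
        unfolding a_def
        by (intro integral_mono int_sq Bochner_Integration.integrable_add integrable_const
            integrable_bounded[OF _ erg_avg_bounded[OF fin sq_le[OF PB]]] AB) measurable
      also have "\<dots> = q m n + d * (2 * B)"
        unfolding q_def
        by (subst Bochner_Integration.integral_add)
          (auto simp: prob_space integral_erg_avg[OF fin _ sq_le[OF PB]]
            intro!: integrable_bounded[OF _ erg_avg_bounded[OF fin sq_le[OF PB]]])
      also have "d * (2 * B) \<le> \<delta>"
        using that \<open>0 \<le> B\<close> unfolding d_def by (simp add: field_simps)
      finally show ?case by simp
    qed
  qed
  define c where "c = Inf (range a)"
  have a0: "0 \<le> a n" for n unfolding a_def by simp
  then have bdd: "bdd_below (range a)" by (intro bdd_belowI[of _ 0]) auto
  have c_le: "c \<le> a n" for n unfolding c_def using bdd by (intro cInf_lower) auto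
  have c_q: "c \<le> q m n" for m n
  proof (rule field_le_epsilon)
    fix \<delta> :: real assume "0 < \<delta>"
    then obtain l where "a l \<le> q m n + \<delta>" using ev[of \<delta> m n] by (auto simp: eventually_sequentially)
    then show "c \<le> q m n + \<delta>" using c_le[of l] by linarith
  qed
  define \<delta> where "\<delta> = \<epsilon>\<^sup>2 / 8"
  have "0 < \<delta>" using \<open>0 < \<epsilon>\<close> by (simp add: \<delta>_def)
  obtain m where "a m < c + \<delta>"
    using cInf_lessD[of "range a" "c + \<delta>"] \<open>0 < \<delta>\<close> unfolding c_def by auto
  moreover have "q m m = a m" unfolding q_def a_def P_def by simp
  ultimately obtain N where N: "\<And>l. l \<ge> N \<Longrightarrow> a l < c + 2 * \<delta>"
    using ev[OF \<open>0 < \<delta>\<close>, of m m] unfolding eventually_sequentially by fastforce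
  have "(\<integral>x. \<bar>A i x - A j x\<bar> \<partial>M) < \<epsilon>" if "i \<ge> N" "j \<ge> N" for i j
  proof (rule L1_bound_by_square[where B="2 * B"])
    show "\<bar>A i x - A j x\<bar> \<le> 2 * B" for x using AB[of i x] AB[of j x] by linarith
    have "(A i x - A j x)\<^sup>2 = 2 * (A i x)\<^sup>2 + 2 * (A j x)\<^sup>2 - 4 * (P i j x)\<^sup>2" for x
      unfolding P_def by (simp add: power2_eq_square field_simps)
    then have "(\<integral>x. (A i x - A j x)\<^sup>2 \<partial>M) = 2 * a i + 2 * a j - 4 * q i j"
      unfolding a_def q_def using int_sq[OF Am AB] int_sq[OF Pm PB] by simp
    also have "\<dots> < \<epsilon>\<^sup>2"
      using N[OF that(1)] N[OF that(2)] c_q[of i j] unfolding \<delta>_def by linarith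
    finally show "(\<integral>x. (A i x - A j x)\<^sup>2 \<partial>M) < \<epsilon>\<^sup>2" .
  qed (use \<open>0 < \<epsilon>\<close> in auto)
  then show ?thesis unfolding A_def by blast
qed

theorem mean_ergodic:
  assumes F: "folner_seq F" and hm [measurable]: "h \<in> borel_measurable M" and B: "\<And>x. \<bar>h x\<bar> \<le> B"
  shows "\<exists>k\<in>borel_measurable M. (\<forall>x. \<bar>k x\<bar> \<le> B) \<and> (\<forall>s. AE x in M. k (T s x) = k x) \<and>
           (\<lambda>n. \<integral>x. \<bar>erg_avg (F n) h x - k x\<bar> \<partial>M) \<longlonglongrightarrow> 0"
proof -
  have fin: "finite (F n)" "F n \<noteq> {}" for n
    using F by (auto simp: folner_seq_finite folner_seq_nonempty)
  obtain k where km [measurable]: "k \<in> borel_measurable M" and kB: "\<And>x. \<bar>k x\<bar> \<le> B"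
    and lim: "(\<lambda>n. \<integral>x. \<bar>erg_avg (F n) h x - k x\<bar> \<partial>M) \<longlonglongrightarrow> 0"
    using L1_Cauchy_bounded_limit[of "\<lambda>n. erg_avg (F n) h" B]
      erg_avg_L1_Cauchy[OF F hm B] erg_avg_bounded[OF fin B] by auto
  have "AE x in M. k (T s x) = k x" for s
  proof -
    have bd: "\<bar>erg_avg (F n) h x - k y\<bar> \<le> 2 * B" for n x y
    proof -
      have "\<bar>erg_avg (F n) h x\<bar> \<le> B" by (rule erg_avg_bounded[OF fin B])
      then show ?thesis using kB[of y] by linarith
    qed
    have kk: "\<bar>k x - k y\<bar> \<le> 2 * B" for x y
      using kB[of x] kB[of y] by linarith
    have "(\<integral>x. \<bar>k (T s x) - k x\<bar> \<partial>M) \<le> 0"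
    proof (rule field_le_epsilon)
      fix \<epsilon> :: real assume "0 < \<epsilon>"
      have "\<forall>\<^sub>F n in sequentially. (\<integral>x. \<bar>erg_avg (F n) h x - k x\<bar> \<partial>M) < \<epsilon> / 3"
        using \<open>0 < \<epsilon>\<close> by (intro order_tendstoD(2)[OF lim]) auto
      moreover have "\<forall>\<^sub>F n in sequentially. \<forall>x. \<bar>erg_avg (F n) h (T s x) - erg_avg (F n) h x\<bar> \<le> \<epsilon> / 3"
        using \<open>0 < \<epsilon>\<close> by (intro erg_avg_almost_invariant[OF F B]) auto
      ultimately obtain n where n: "(\<integral>x. \<bar>erg_avg (F n) h x - k x\<bar> \<partial>M) < \<epsilon> / 3"
        "\<And>x. \<bar>erg_avg (F n) h (T s x) - erg_avg (F n) h x\<bar> \<le> \<epsilon> / 3"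
        using eventually_happens'[OF sequentially_bot eventually_conj] by blast
      let ?D = "\<lambda>x. \<bar>erg_avg (F n) h x - k x\<bar>"
      have iD: "integrable M ?D" using bd by (intro integrable_bounded[where B="2*B"]) auto
      have iDT: "integrable M (\<lambda>x. ?D (T s x))"
        using bd by (intro integrable_bounded[where B="2*B"]) auto
      have "(\<integral>x. \<bar>k (T s x) - k x\<bar> \<partial>M) \<le> (\<integral>x. ?D (T s x) + (?D x + \<epsilon> / 3) \<partial>M)"
      proof (rule integral_mono)
        show "integrable M (\<lambda>x. \<bar>k (T s x) - k x\<bar>)"
          using kk by (intro integrable_bounded[where B="2*B"]) auto
        show "integrable M (\<lambda>x. ?D (T s x) + (?D x + \<epsilon> / 3))" using iD iDT by simp
        show "\<bar>k (T s x) - k x\<bar> \<le> ?D (T s x) + (?D x + \<epsilon> / 3)" for x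
          using n(2)[of x] by linarith
      qed
      also have "\<dots> = (\<integral>x. ?D (T s x) \<partial>M) + ((\<integral>x. ?D x \<partial>M) + \<epsilon> / 3)"
        using iD iDT by (simp add: prob_space)
      also have "(\<integral>x. ?D (T s x) \<partial>M) = (\<integral>x. ?D x \<partial>M)" by (rule integral_T) simp
      finally show "(\<integral>x. \<bar>k (T s x) - k x\<bar> \<partial>M) \<le> 0 + \<epsilon>" using n(1) by linarith
    qed
    then have "(\<integral>x. \<bar>k (T s x) - k x\<bar> \<partial>M) = 0"
      by (intro antisym) auto
    then have "AE x in M. \<bar>k (T s x) - k x\<bar> = 0"
      using kk by (subst (asm) integral_nonneg_eq_0_iff_AE) (auto intro!: integrable_bounded[where B="2*B"])
    then show ?thesis by simp
  qed
  then show ?thesis using km kB lim by blast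
qed

text \<open>
The maximal inequality on a single orbit, where it is a statement about functions on the group: each
\<open>a\<close> on the left owns a translate over which \<open>h\<close> has large average, and the weights of the covering
lemma sum these averages up with total weight at most one at each point.
\<close>
lemma maximal_pointwise:
  fixes F :: "nat \<Rightarrow> 'g set"
  assumes fin: "\<And>n. finite (F n)" and ne: "\<And>n. F n \<noteq> {}"
    and temp: "\<And>n. n > 1 \<Longrightarrow>
       real (card (\<Union>k\<in>{1..n-1}. {- a + b | a b. a \<in> F k \<and> b \<in> F n})) \<le> C * real (card (F n))"
    and "0 \<le> C" and K: "finite K" and h0: "\<And>x. 0 \<le> h x" and "0 < \<eta>"
  shows "real (card {a \<in> K. \<exists>n\<in>{1..N}. erg_avg (F n) h (T a x) > \<eta>})
           \<le> (2 + 2 * C) / \<eta> * (\<Sum>g\<in>(\<Union>t\<in>(\<Union>n\<in>{1..N}. F n). (+) t ` K). h (T g x))"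
proof -
  define A where "A = {a \<in> K. \<exists>n\<in>{1..N}. erg_avg (F n) h (T a x) > \<eta>}"
  have finA: "finite A" unfolding A_def using K by simp
  have "\<forall>a\<in>A. \<exists>n\<in>{1..N}. erg_avg (F n) h (T a x) > \<eta>" unfolding A_def by simp
  then obtain lev where lev: "\<And>a. a \<in> A \<Longrightarrow> lev a \<in> {1..N}"
    "\<And>a. a \<in> A \<Longrightarrow> erg_avg (F (lev a)) h (T a x) > \<eta>" by metis
  obtain w where w0: "\<And>a. 0 \<le> w a" and w1: "\<And>g. (\<Sum>a | a \<in> A \<and> g \<in> (+) a ` F (lev a). w a) \<le> 1"
    and wA: "real (card A) \<le> (2 + 2 * C) * (\<Sum>a\<in>A. w a * real (card (F (lev a))))"
    using fractional_covering[of F C A lev] fin ne temp \<open>0 \<le> C\<close> finA lev(1) by auto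
  define H where "H = (\<Union>t\<in>(\<Union>n\<in>{1..N}. F n). (+) t ` K)"
  have finH: "finite H" unfolding H_def using fin K by auto
  have "\<eta> * (\<Sum>a\<in>A. w a * real (card (F (lev a)))) = (\<Sum>a\<in>A. w a * (\<eta> * real (card (F (lev a)))))"
    by (simp add: sum_distrib_left algebra_simps)
  also have "\<dots> \<le> (\<Sum>a\<in>A. w a * (\<Sum>g\<in>(+) a ` F (lev a). h (T g x)))"
  proof (intro sum_mono mult_left_mono w0)
    fix a assume "a \<in> A"
    have "\<eta> * real (card (F (lev a))) \<le> (\<Sum>s\<in>F (lev a). h (T s (T a x)))"
      using lev(2)[OF \<open>a \<in> A\<close>] fin[of "lev a"] ne[of "lev a"]
      unfolding erg_avg_def avg_def by (simp add: less_divide_eq card_gt_0_iff)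
    also have "\<dots> = (\<Sum>g\<in>(+) a ` F (lev a). h (T g x))"
      by (simp add: sum.reindex inj_on_def T_add[symmetric] add.commute)
    finally show "\<eta> * real (card (F (lev a))) \<le> (\<Sum>g\<in>(+) a ` F (lev a). h (T g x))" .
  qed
  also have "\<dots> = (\<Sum>a\<in>A. \<Sum>g\<in>H. if g \<in> (+) a ` F (lev a) then w a * h (T g x) else 0)"
  proof (rule sum.cong[OF refl])
    fix a assume a: "a \<in> A"
    have "(+) a ` F (lev a) \<subseteq> H"
    proof
      fix g assume "g \<in> (+) a ` F (lev a)"
      then obtain t where t: "t \<in> F (lev a)" "g = t + a" by (auto simp: add.commute)
      then show "g \<in> H" unfolding H_def using lev(1)[OF a] a by (fastforce simp: A_def)
    qed
    then have "{g \<in> H. g \<in> (+) a ` F (lev a)} = (+) a ` F (lev a)" by blast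
    then show "w a * (\<Sum>g\<in>(+) a ` F (lev a). h (T g x)) =
        (\<Sum>g\<in>H. if g \<in> (+) a ` F (lev a) then w a * h (T g x) else 0)"
      using sum.inter_filter[OF finH, of "\<lambda>g. w a * h (T g x)" "\<lambda>g. g \<in> (+) a ` F (lev a)"]
      by (simp add: sum_distrib_left)
  qed
  also have "\<dots> = (\<Sum>g\<in>H. \<Sum>a\<in>A. if g \<in> (+) a ` F (lev a) then w a * h (T g x) else 0)"
    by (rule sum.swap)
  also have "\<dots> = (\<Sum>g\<in>H. (\<Sum>a | a \<in> A \<and> g \<in> (+) a ` F (lev a). w a) * h (T g x))"
    by (intro sum.cong refl) (simp only: sum_distrib_right sum.inter_filter[OF finA, symmetric])
  also have "\<dots> \<le> (\<Sum>g\<in>H. 1 * h (T g x))"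
    by (intro sum_mono mult_right_mono w1 h0)
  finally have "\<eta> * (\<Sum>a\<in>A. w a * real (card (F (lev a)))) \<le> (\<Sum>g\<in>H. h (T g x))" by simp
  then have "(\<Sum>a\<in>A. w a * real (card (F (lev a)))) \<le> (\<Sum>g\<in>H. h (T g x)) / \<eta>"
    using \<open>0 < \<eta>\<close> by (simp add: pos_le_divide_eq mult.commute)
  then have "real (card A) \<le> (2 + 2 * C) * ((\<Sum>g\<in>H. h (T g x)) / \<eta>)"
    using wA \<open>0 \<le> C\<close> by (meson mult_left_mono order_trans add_nonneg_nonneg mult_nonneg_nonneg zero_le_numeral)
  then show ?thesis unfolding A_def H_def by simp
qed

text \<open>
Calderon's transference: the inequality on orbits is integrated over the space. The window \<open>K\<close> of group
elements is taken so invariant that the enlarged window, on which \<open>h\<close> is summed, has at most twice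
its size.
\<close>
theorem maximal_inequality:
  fixes F :: "nat \<Rightarrow> 'g set"
  assumes F: "folner_seq F" and "tempered F"
  shows "\<exists>L>0. \<forall>h B \<eta>. h \<in> borel_measurable M \<longrightarrow> (\<forall>x. 0 \<le> h x \<and> h x \<le> B) \<longrightarrow> 0 < \<eta> \<longrightarrow>
           measure M {x. \<exists>n\<ge>1. erg_avg (F n) h x > \<eta>} \<le> L / \<eta> * (\<integral>x. h x \<partial>M)"
proof -
  obtain C where "C > 0" and temp: "\<And>n. n > 1 \<Longrightarrow>
       real (card (\<Union>k\<in>{1..n-1}. {- a + b | a b. a \<in> F k \<and> b \<in> F n})) \<le> C * real (card (F n))"
    using \<open>tempered F\<close> unfolding tempered_def by blast
  have fin: "finite (F n)" and ne: "F n \<noteq> {}" for n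
    using F by (auto simp: folner_seq_finite folner_seq_nonempty)
  have "measure M {x. \<exists>n\<ge>1. erg_avg (F n) h x > \<eta>} \<le> (4 + 4 * C) / \<eta> * (\<integral>x. h x \<partial>M)"
    if hm [measurable]: "h \<in> borel_measurable M" and h: "\<And>x. 0 \<le> h x" "\<And>x. h x \<le> B" and "0 < \<eta>" for h B \<eta>
  proof -
    define E where "E = (\<lambda>N. {x. \<exists>n\<in>{1..N}. erg_avg (F n) h x > \<eta>})"
    have E_sets [measurable]: "E N \<in> sets M" for N
    proof -
      have "{x \<in> space M. \<exists>n\<in>{1..N}. erg_avg (F n) h x > \<eta>} \<in> sets M" by measurable
      then show ?thesis by (simp add: E_def space_UNIV)
    qed
    have hB: "\<bar>h x\<bar> \<le> B" for x using h[of x] by simp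
    have bound: "measure M (E N) \<le> (4 + 4 * C) / \<eta> * (\<integral>x. h x \<partial>M)" for N
    proof -
      define S where "S = (\<Union>n\<in>{1..N}. F n)"
      have finS: "finite S" unfolding S_def using fin by auto
      \<comment> \<open>This accuracy makes the window grow by at most a factor 2 when it is enlarged by \<open>S\<close>.\<close>
      define \<delta> where "\<delta> = 1 / (real (card S) + 1)"
      have "\<delta> > 0" unfolding \<delta>_def by simp
      have "\<forall>\<^sub>F m in sequentially. \<forall>t\<in>S. real (card (sym_diff ((+) t ` F m) (F m))) / real (card (F m)) < \<delta>"
        using finS F \<open>\<delta> > 0\<close> unfolding folner_seq_def
        by (intro eventually_ball_finite ballI order_tendstoD(2)) auto
      then obtain m where m: "\<And>t. t \<in> S \<Longrightarrow> real (card (sym_diff ((+) t ` F m) (F m))) / real (card (F m)) < \<delta>"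
        unfolding eventually_sequentially by blast
      define K where "K = F m"
      have K: "finite K" "card K > 0" unfolding K_def using fin ne by (auto simp: card_gt_0_iff)
      define H where "H = (\<Union>t\<in>S. (+) t ` K)"
      have finH: "finite H" unfolding H_def using finS K by auto
      have "real (card H) \<le> (1 + real (card S) * \<delta>) * real (card K)"
        unfolding H_def
      proof (rule card_union_translates_le[OF finS K(1)])
        fix t assume "t \<in> S"
        from m[OF this] show "real (card (sym_diff ((+) t ` K) K)) \<le> \<delta> * real (card K)"
          using K(2) unfolding K_def by (simp add: pos_divide_less_eq)
      qed
      also have "\<dots> \<le> 2 * real (card K)"
        by (intro mult_right_mono) (auto simp: \<delta>_def field_simps)
      finally have cardH: "real (card H) \<le> 2 * real (card K)" .
      have "real (card K) * measure M (E N) = (\<Sum>a\<in>K. \<integral>x. indicator (E N) (T a x) \<partial>M)"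
        by (simp add: integral_T)
      also have "\<dots> = (\<integral>x. (\<Sum>a\<in>K. indicator (E N) (T a x)) \<partial>M)"
        by (subst Bochner_Integration.integral_sum) (auto intro!: integrable_bounded[where B=1] simp: indicator_def)
      also have "\<dots> \<le> (\<integral>x. (2 + 2 * C) / \<eta> * (\<Sum>g\<in>H. h (T g x)) \<partial>M)"
      proof (rule integral_mono)
        show "integrable M (\<lambda>x. (\<Sum>a\<in>K. indicator (E N) (T a x)) :: real)"
          by (intro Bochner_Integration.integrable_sum integrable_bounded[where B=1]) (auto simp: indicator_def)
        show "integrable M (\<lambda>x. (2 + 2 * C) / \<eta> * (\<Sum>g\<in>H. h (T g x)))"
          using hB by (intro Bochner_Integration.integrable_mult_right Bochner_Integration.integrable_sum
              integrable_bounded[where B=B]) auto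
        fix x
        have "(\<Sum>a\<in>K. indicator (E N) (T a x)) = real (card {a \<in> K. \<exists>n\<in>{1..N}. erg_avg (F n) h (T a x) > \<eta>})"
          using K by (simp add: indicator_def E_def sum.If_cases Int_def flip: sum.inter_filter)
        also have "\<dots> \<le> (2 + 2 * C) / \<eta> * (\<Sum>g\<in>H. h (T g x))"
          unfolding H_def S_def
          by (rule maximal_pointwise[OF fin ne temp]) (use \<open>C > 0\<close> K h \<open>0 < \<eta>\<close> in auto)
        finally show "(\<Sum>a\<in>K. indicator (E N) (T a x)) \<le> (2 + 2 * C) / \<eta> * (\<Sum>g\<in>H. h (T g x))" .
      qed
      also have "\<dots> = (2 + 2 * C) / \<eta> * (\<Sum>g\<in>H. \<integral>x. h (T g x) \<partial>M)"
        using hB by (simp add: Bochner_Integration.integral_sum integrable_bounded[where B=B])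
      also have "\<dots> = (2 + 2 * C) / \<eta> * (\<integral>x. h x \<partial>M) * real (card H)"
        by (simp add: integral_T)
      also have "\<dots> \<le> (2 + 2 * C) / \<eta> * (\<integral>x. h x \<partial>M) * (2 * real (card K))"
        using cardH h \<open>C > 0\<close> \<open>0 < \<eta>\<close> by (intro mult_left_mono mult_nonneg_nonneg) auto
      finally have "real (card K) * measure M (E N) \<le> real (card K) * ((4 + 4 * C) / \<eta> * (\<integral>x. h x \<partial>M))"
        by (simp add: algebra_simps add_divide_distrib)
      then show ?thesis using K(2) by (simp only: mult_le_cancel_left_pos of_nat_0_less_iff)
    qed
    have "{x. \<exists>n\<ge>1. erg_avg (F n) h x > \<eta>} = (\<Union>N. E N)"
      unfolding E_def by (auto, meson atLeastAtMost_iff order_refl One_nat_def)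
    moreover have "(\<lambda>N. measure M (E N)) \<longlonglongrightarrow> measure M (\<Union>N. E N)"
    proof (rule finite_Lim_measure_incseq)
      show "range E \<subseteq> sets M" using E_sets by blast
      have "{1..i} \<subseteq> {1..j}" if "i \<le> j" for i j :: nat using that by auto
      then show "incseq E" unfolding E_def incseq_def by blast
    qed
    ultimately show ?thesis using bound by (auto intro: LIMSEQ_le_const2)
  qed
  then show ?thesis using \<open>C > 0\<close> by (intro exI[of _ "4 + 4 * C"]) auto
qed

end

section \<open>Almost periodic functions and the Kronecker algebra\<close>

lemma levels_below:
  fixes y :: real
  assumes "0 \<le> y" "y \<le> real N"
  shows "{j \<in> {1..N}. real j \<le> y} = {1..nat \<lfloor>y\<rfloor>}"
proof -
  have "real j \<le> y \<longleftrightarrow> j \<le> nat \<lfloor>y\<rfloor>" for j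
    using assms(1) by (simp add: le_nat_iff le_floor_iff)
  moreover have "nat \<lfloor>y\<rfloor> \<le> N" using assms by linarith
  ultimately show ?thesis
    unfolding set_eq_iff mem_Collect_eq atLeastAtMost_iff by (meson order_trans)
qed

context measure_action
begin

text \<open>
Almost periodicity in the mean: the orbit of \<open>f\<close> is totally bounded in \<open>L\<^sup>1\<close>. A finite colouring of the
group whose classes have small diameter takes the place of a finite net; colourings for several
functions combine by pairing the colours, and no centre of a class has to be chosen.
\<close>
definition almost_periodic :: "('a \<Rightarrow> real) \<Rightarrow> bool" where
  "almost_periodic f \<longleftrightarrow> f \<in> borel_measurable M \<and> (\<exists>B. \<forall>x. \<bar>f x\<bar> \<le> B) \<and>
     (\<forall>\<epsilon>>0. \<exists>c :: 'g \<Rightarrow> nat. finite (range c) \<and>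
        (\<forall>s t. c s = c t \<longrightarrow> (\<integral>x. \<bar>f (T s x) - f (T t x)\<bar> \<partial>M) < \<epsilon>))"

lemma almost_periodicI:
  assumes "f \<in> borel_measurable M" and "\<And>x. \<bar>f x\<bar> \<le> B"
    and "\<And>\<epsilon>. 0 < \<epsilon> \<Longrightarrow> \<exists>c :: 'g \<Rightarrow> 'c. finite (range c) \<and>
        (\<forall>s t. c s = c t \<longrightarrow> (\<integral>x. \<bar>f (T s x) - f (T t x)\<bar> \<partial>M) < \<epsilon>)"
  shows "almost_periodic f"
  unfolding almost_periodic_def
proof (intro conjI allI impI)
  fix \<epsilon> :: real assume "0 < \<epsilon>"
  then obtain c :: "'g \<Rightarrow> 'c" where c: "finite (range c)"
    "\<And>s t. c s = c t \<Longrightarrow> (\<integral>x. \<bar>f (T s x) - f (T t x)\<bar> \<partial>M) < \<epsilon>"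
    using assms(3) by metis
  obtain e :: "'c \<Rightarrow> nat" where e: "inj_on e (range c)"
    using finite_imp_inj_to_nat_seg[OF c(1)] by auto
  have "range (e \<circ> c) = e ` range c" by auto
  then have "finite (range (e \<circ> c))" using c(1) by simp
  moreover have "(e \<circ> c) s = (e \<circ> c) t \<longrightarrow> (\<integral>x. \<bar>f (T s x) - f (T t x)\<bar> \<partial>M) < \<epsilon>" for s t
    using c(2) e by (auto dest: inj_onD)
  ultimately show "\<exists>c :: 'g \<Rightarrow> nat. finite (range c) \<and>
        (\<forall>s t. c s = c t \<longrightarrow> (\<integral>x. \<bar>f (T s x) - f (T t x)\<bar> \<partial>M) < \<epsilon>)"
    by blast
qed (use assms in auto)

lemma almost_periodic_measurable: "almost_periodic f \<Longrightarrow> f \<in> borel_measurable M"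
  by (simp add: almost_periodic_def)

lemma almost_periodic_bounded:
  assumes "almost_periodic f" obtains B where "\<And>x. \<bar>f x\<bar> \<le> B"
  using assms unfolding almost_periodic_def by blast

lemma almost_periodic_integrable: "almost_periodic f \<Longrightarrow> integrable M f"
  using almost_periodic_measurable almost_periodic_bounded integrable_bounded by metis

lemma almost_periodic_orbit_integrable:
  "almost_periodic f \<Longrightarrow> integrable M (\<lambda>x. \<bar>f (T s x) - f (T t x)\<bar>)"
proof -
  assume f: "almost_periodic f"
  have [measurable]: "f \<in> borel_measurable M" by (rule almost_periodic_measurable[OF f])
  obtain B where B: "\<And>x. \<bar>f x\<bar> \<le> B" using almost_periodic_bounded[OF f] by blast
  have "\<bar>f y - f z\<bar> \<le> 2 * B" for y z using B[of y] B[of z] by linarith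
  then show ?thesis by (intro integrable_bounded[where B="2 * B"]) auto
qed

lemma almost_periodicD:
  assumes "almost_periodic f" "0 < \<epsilon>"
  obtains c :: "'g \<Rightarrow> nat" where "finite (range c)"
    "\<And>s t. c s = c t \<Longrightarrow> (\<integral>x. \<bar>f (T s x) - f (T t x)\<bar> \<partial>M) < \<epsilon>"
  using assms unfolding almost_periodic_def by metis

text \<open>
The one closure property from which sums, multiples, truncations and Boolean combinations follow.
\<close>
lemma almost_periodic_lipschitz2:
  assumes f: "almost_periodic f1" "almost_periodic f2" and [measurable]: "g \<in> borel_measurable M"
    and B: "\<And>x. \<bar>g x\<bar> \<le> B"
    and lip: "\<And>x y. \<bar>g x - g y\<bar> \<le> L * (\<bar>f1 x - f1 y\<bar> + \<bar>f2 x - f2 y\<bar>)" and "0 < L"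
  shows "almost_periodic g"
proof (rule almost_periodicI[OF _ B])
  fix \<epsilon> :: real assume "0 < \<epsilon>"
  then have e: "0 < \<epsilon> / (2 * L)" using \<open>0 < L\<close> by simp
  obtain c1 :: "'g \<Rightarrow> nat" where c1: "finite (range c1)"
    "\<And>s t. c1 s = c1 t \<Longrightarrow> (\<integral>x. \<bar>f1 (T s x) - f1 (T t x)\<bar> \<partial>M) < \<epsilon> / (2 * L)"
    by (rule almost_periodicD[OF f(1) e], rule that)
  obtain c2 :: "'g \<Rightarrow> nat" where c2: "finite (range c2)"
    "\<And>s t. c2 s = c2 t \<Longrightarrow> (\<integral>x. \<bar>f2 (T s x) - f2 (T t x)\<bar> \<partial>M) < \<epsilon> / (2 * L)"
    by (rule almost_periodicD[OF f(2) e], rule that)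
  let ?c = "\<lambda>s. (c1 s, c2 s)"
  have "finite (range ?c)"
    by (rule finite_subset[OF _ finite_cartesian_product[OF c1(1) c2(1)]]) auto
  moreover have "(\<integral>x. \<bar>g (T s x) - g (T t x)\<bar> \<partial>M) < \<epsilon>" if "?c s = ?c t" for s t
  proof -
    have bd: "\<bar>g y - g z\<bar> \<le> 2 * B" for y z using B[of y] B[of z] by linarith
    have "(\<integral>x. \<bar>g (T s x) - g (T t x)\<bar> \<partial>M)
        \<le> (\<integral>x. L * (\<bar>f1 (T s x) - f1 (T t x)\<bar> + \<bar>f2 (T s x) - f2 (T t x)\<bar>) \<partial>M)"
      using f bd by (intro integral_mono lip integrable_bounded[where B="2*B"]
          Bochner_Integration.integrable_mult_right Bochner_Integration.integrable_add
          almost_periodic_orbit_integrable) auto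
    also have "\<dots> = L * ((\<integral>x. \<bar>f1 (T s x) - f1 (T t x)\<bar> \<partial>M) + (\<integral>x. \<bar>f2 (T s x) - f2 (T t x)\<bar> \<partial>M))"
      using f by (simp add: almost_periodic_orbit_integrable)
    also have "\<dots> < L * (\<epsilon> / (2 * L) + \<epsilon> / (2 * L))"
      using that c1(2) c2(2) \<open>0 < L\<close> by (intro mult_strict_left_mono add_strict_mono) auto
    also have "\<dots> = \<epsilon>" using \<open>0 < L\<close> by simp
    finally show ?thesis .
  qed
  ultimately show "\<exists>c :: 'g \<Rightarrow> nat \<times> nat. finite (range c) \<and>
        (\<forall>s t. c s = c t \<longrightarrow> (\<integral>x. \<bar>g (T s x) - g (T t x)\<bar> \<partial>M) < \<epsilon>)" by blast
qed fact

lemma almost_periodic_const: "almost_periodic (\<lambda>_. c)"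
  by (rule almost_periodicI[where B="\<bar>c\<bar>" and 'c=unit]) auto

lemma almost_periodic_add:
  assumes f: "almost_periodic f" and g: "almost_periodic g"
  shows "almost_periodic (\<lambda>x. f x + g x)"
proof -
  obtain B B' where B: "\<And>x. \<bar>f x\<bar> \<le> B" "\<And>x. \<bar>g x\<bar> \<le> B'"
    using almost_periodic_bounded[OF f] almost_periodic_bounded[OF g] by metis
  have [measurable]: "f \<in> borel_measurable M" "g \<in> borel_measurable M"
    using f g by (auto intro: almost_periodic_measurable)
  have "\<bar>f x + g x\<bar> \<le> B + B'" for x using B(1)[of x] B(2)[of x] by linarith
  then show ?thesis
    by (rule almost_periodic_lipschitz2[OF f g, rotated, where L=1]) auto
qed

lemma almost_periodic_cmult:
  assumes f: "almost_periodic f"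
  shows "almost_periodic (\<lambda>x. c * f x)"
proof -
  obtain B where B: "\<And>x. \<bar>f x\<bar> \<le> B" using almost_periodic_bounded[OF f] by metis
  have [measurable]: "f \<in> borel_measurable M" using f by (auto intro: almost_periodic_measurable)
  show ?thesis
  proof (rule almost_periodic_lipschitz2[OF f f, where L="\<bar>c\<bar> + 1" and B="\<bar>c\<bar> * B"])
    show "\<bar>c * f x\<bar> \<le> \<bar>c\<bar> * B" for x using B[of x] by (simp add: abs_mult mult_left_mono)
    show "\<bar>c * f x - c * f y\<bar> \<le> (\<bar>c\<bar> + 1) * (\<bar>f x - f y\<bar> + \<bar>f x - f y\<bar>)" for x y
    proof -
      have "\<bar>c * f x - c * f y\<bar> = \<bar>c\<bar> * \<bar>f x - f y\<bar>" by (simp flip: abs_mult add: right_diff_distrib)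
      also have "\<dots> \<le> (\<bar>c\<bar> + 1) * (\<bar>f x - f y\<bar> + \<bar>f x - f y\<bar>)" by (intro mult_mono) auto
      finally show ?thesis .
    qed
  qed auto
qed

lemma almost_periodic_sum:
  assumes "\<And>i. i \<in> I \<Longrightarrow> almost_periodic (f i)"
  shows "almost_periodic (\<lambda>x. \<Sum>i\<in>I. f i x)"
  using assms
  by (induction I rule: infinite_finite_induct) (simp_all add: almost_periodic_const almost_periodic_add)

lemma almost_periodic_L1_limit:
  assumes [measurable]: "f \<in> borel_measurable M" and B: "\<And>x. \<bar>f x\<bar> \<le> B"
    and lim: "\<And>\<epsilon>. 0 < \<epsilon> \<Longrightarrow> \<exists>g. almost_periodic g \<and> (\<integral>x. \<bar>f x - g x\<bar> \<partial>M) < \<epsilon>"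
  shows "almost_periodic f"
proof (rule almost_periodicI[OF _ B])
  fix \<epsilon> :: real assume "0 < \<epsilon>"
  then obtain g where g: "almost_periodic g" and fg: "(\<integral>x. \<bar>f x - g x\<bar> \<partial>M) < \<epsilon> / 3"
    using lim[of "\<epsilon> / 3"] by auto
  have [measurable]: "g \<in> borel_measurable M" using g by (auto intro: almost_periodic_measurable)
  obtain B' where B': "\<And>x. \<bar>g x\<bar> \<le> B'" using almost_periodic_bounded[OF g] by metis
  obtain c :: "'g \<Rightarrow> nat" where c: "finite (range c)"
    "\<And>s t. c s = c t \<Longrightarrow> (\<integral>x. \<bar>g (T s x) - g (T t x)\<bar> \<partial>M) < \<epsilon> / 3"
    by (rule almost_periodicD[OF g, of "\<epsilon> / 3"]) (use \<open>0 < \<epsilon>\<close> that in auto)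
  have "(\<integral>x. \<bar>f (T s x) - f (T t x)\<bar> \<partial>M) < \<epsilon>" if "c s = c t" for s t
  proof -
    let ?D = "\<lambda>x. \<bar>f x - g x\<bar>"
    have bd: "?D y \<le> B + B'" "\<bar>f y - f z\<bar> \<le> 2 * B" for y z
      using B[of y] B[of z] B'[of y] by linarith+
    have iD: "integrable M (\<lambda>x. ?D (T r x))" for r
      using bd by (intro integrable_bounded[where B="B + B'"]) auto
    have iG: "integrable M (\<lambda>x. \<bar>g (T s x) - g (T t x)\<bar>)"
      by (rule almost_periodic_orbit_integrable[OF g])
    have "(\<integral>x. \<bar>f (T s x) - f (T t x)\<bar> \<partial>M)
        \<le> (\<integral>x. (?D (T s x) + ?D (T t x)) + \<bar>g (T s x) - g (T t x)\<bar> \<partial>M)"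
      using bd by (intro integral_mono iD iG Bochner_Integration.integrable_add
          integrable_bounded[where B="2*B"]) auto
    also have "\<dots> = (\<integral>x. ?D (T s x) \<partial>M) + (\<integral>x. ?D (T t x) \<partial>M) + (\<integral>x. \<bar>g (T s x) - g (T t x)\<bar> \<partial>M)"
      using iD iG by simp
    also have "\<dots> < \<epsilon> / 3 + \<epsilon> / 3 + \<epsilon> / 3"
      using fg c(2)[OF that] integral_T[of ?D s] integral_T[of ?D t] by simp
    finally show ?thesis by simp
  qed
  then show "\<exists>c :: 'g \<Rightarrow> nat. finite (range c) \<and>
        (\<forall>s t. c s = c t \<longrightarrow> (\<integral>x. \<bar>f (T s x) - f (T t x)\<bar> \<partial>M) < \<epsilon>)" using c(1) by blast
qed fact

lemma almost_periodic_pointwise_limit: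
  assumes g: "\<And>n. almost_periodic (g n)" and B: "\<And>n x. \<bar>g n x\<bar> \<le> B"
    and lim: "\<And>x. (\<lambda>n. g n x) \<longlonglongrightarrow> f x"
  shows "almost_periodic f"
proof -
  have gm [measurable]: "g n \<in> borel_measurable M" for n by (rule almost_periodic_measurable[OF g])
  have fm [measurable]: "f \<in> borel_measurable M" using lim gm by (rule borel_measurable_LIMSEQ_real)
  have fB: "\<bar>f x\<bar> \<le> B" for x
    by (rule tendsto_upperbound[OF tendsto_rabs[OF lim]]) (use B in auto)
  have "(\<lambda>n. \<integral>x. \<bar>f x - g n x\<bar> \<partial>M) \<longlonglongrightarrow> (\<integral>x. 0 \<partial>M)"
  proof (rule integral_dominated_convergence[where w="\<lambda>_. 2 * B"])
    show "AE x in M. (\<lambda>n. \<bar>f x - g n x\<bar>) \<longlonglongrightarrow> 0"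
      using tendsto_diff[OF tendsto_const lim, of "f x" x for x]
      by (intro always_eventually allI tendsto_rabs_zero) simp
    show "AE x in M. norm \<bar>f x - g n x\<bar> \<le> 2 * B" for n
      using fB B[of n] by (intro always_eventually allI) (smt (verit) real_norm_def)
  qed auto
  then have l: "(\<lambda>n. \<integral>x. \<bar>f x - g n x\<bar> \<partial>M) \<longlonglongrightarrow> 0" by simp
  show ?thesis
  proof (rule almost_periodic_L1_limit[OF fm fB])
    fix \<epsilon> :: real assume "0 < \<epsilon>"
    then obtain n where "(\<integral>x. \<bar>f x - g n x\<bar> \<partial>M) < \<epsilon>"
      using order_tendstoD(2)[OF l] eventually_happens'[OF sequentially_bot] by blast
    then show "\<exists>g. almost_periodic g \<and> (\<integral>x. \<bar>f x - g x\<bar> \<partial>M) < \<epsilon>" using g by blast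
  qed
qed

definition kronecker_sets :: "'a set set" where
  "kronecker_sets = {A \<in> sets M. almost_periodic (indicator A)}"

text \<open>
Phrased for an arbitrary Boolean combination, so that complements and finite unions are instances.
\<close>
lemma kronecker_combine:
  assumes A: "A \<in> kronecker_sets" and B: "B \<in> kronecker_sets" and C: "C \<in> sets M"
    and C_def: "\<And>x y. (x \<in> A \<longleftrightarrow> y \<in> A) \<Longrightarrow> (x \<in> B \<longleftrightarrow> y \<in> B) \<Longrightarrow> (x \<in> C \<longleftrightarrow> y \<in> C)"
  shows "C \<in> kronecker_sets"
  unfolding kronecker_sets_def
proof (intro CollectI conjI C)
  show "almost_periodic (indicator C)"
  proof (rule almost_periodic_lipschitz2[where L=1 and B=1])
    show "\<bar>indicator C x - indicator C y :: real\<bar>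
       \<le> 1 * (\<bar>indicator A x - indicator A y\<bar> + \<bar>indicator B x - indicator B y\<bar>)" for x y
      using C_def[of x y] by (auto simp: indicator_def)
    show "\<bar>indicator C x :: real\<bar> \<le> 1" for x by (simp add: indicator_def)
  qed (use A B C in \<open>simp_all add: kronecker_sets_def\<close>)
qed

lemma sigma_algebra_kronecker: "sigma_algebra UNIV kronecker_sets"
  unfolding sigma_algebra_iff2
proof (intro conjI ballI allI impI)
  show "kronecker_sets \<subseteq> Pow UNIV" by simp
  have "almost_periodic (indicator {})" using almost_periodic_const[of 0] by (simp add: indicator_def[abs_def])
  then show empty: "{} \<in> kronecker_sets" by (simp add: kronecker_sets_def)
  fix A assume A: "A \<in> kronecker_sets"
  then have "UNIV - A \<in> sets M" using sets.compl_sets[of A M] by (simp add: kronecker_sets_def space_UNIV)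
  then show "UNIV - A \<in> kronecker_sets" by (rule kronecker_combine[OF A A]) auto
next
  fix A :: "nat \<Rightarrow> 'a set" assume "range A \<subseteq> kronecker_sets"
  then have A: "A i \<in> kronecker_sets" for i by auto
  then have As [measurable]: "A i \<in> sets M" for i by (auto simp: kronecker_sets_def)
  have fin: "(\<Union>i<n. A i) \<in> kronecker_sets" for n
  proof (induction n)
    case 0
    have "almost_periodic (indicator {})" using almost_periodic_const[of 0] by (simp add: indicator_def[abs_def])
    then show ?case by (simp add: kronecker_sets_def)
  next
    case (Suc n)
    show ?case by (rule kronecker_combine[OF Suc A[of n]]) (auto simp: lessThan_Suc)
  qed
  have "almost_periodic (indicator (\<Union>i. A i))"
  proof (rule almost_periodic_pointwise_limit[where B=1])
    show "almost_periodic (indicator (\<Union>i<n. A i))" for n using fin by (simp add: kronecker_sets_def)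
    show "(\<lambda>n. indicator (\<Union>i<n. A i) x) \<longlonglongrightarrow> (indicator (\<Union>i. A i) x :: real)" for x
      by (rule LIMSEQ_indicator_UN)
  qed (auto simp: indicator_def)
  then show "(\<Union>i. A i) \<in> kronecker_sets" by (simp add: kronecker_sets_def)
qed

definition kronecker_algebra :: "'a measure" where
  "kronecker_algebra = sigma UNIV kronecker_sets"

lemma sets_kronecker_algebra: "sets kronecker_algebra = kronecker_sets"
  unfolding kronecker_algebra_def by (rule sigma_algebra.sets_measure_of_eq[OF sigma_algebra_kronecker])

lemma space_kronecker_algebra: "space kronecker_algebra = UNIV"
  unfolding kronecker_algebra_def by (rule space_measure_of) simp

lemma subalgebra_kronecker: "subalgebra M kronecker_algebra"
  unfolding subalgebra_def
  by (auto simp: sets_kronecker_algebra space_kronecker_algebra space_UNIV kronecker_sets_def)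

text \<open>
The indicator of \<open>{f > c}\<close> is the increasing limit of the functions \<open>min 1 (n \<cdot> max 0 (f - c))\<close>, which
are Lipschitz images of \<open>f\<close>.
\<close>
lemma almost_periodic_superlevel:
  assumes f: "almost_periodic f"
  shows "{x. c < f x} \<in> kronecker_sets"
proof -
  have [measurable]: "f \<in> borel_measurable M" using f by (auto intro: almost_periodic_measurable)
  define g where "g = (\<lambda>n x. min 1 (real n * max 0 (f x - c)))"
  have "almost_periodic (g n)" for n
  proof (rule almost_periodic_lipschitz2[OF f f, where L="real n + 1" and B=1])
    fix x y
    have "\<bar>g n x - g n y\<bar> \<le> \<bar>real n * max 0 (f x - c) - real n * max 0 (f y - c)\<bar>"
      unfolding g_def by linarith
    also have "\<dots> = real n * \<bar>max 0 (f x - c) - max 0 (f y - c)\<bar>"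
      by (simp flip: right_diff_distrib add: abs_mult)
    also have "\<dots> \<le> (real n + 1) * (\<bar>f x - f y\<bar> + \<bar>f x - f y\<bar>)"
    proof (intro mult_mono)
      show "\<bar>max 0 (f x - c) - max 0 (f y - c)\<bar> \<le> \<bar>f x - f y\<bar> + \<bar>f x - f y\<bar>" by linarith
    qed auto
    finally show "\<bar>g n x - g n y\<bar> \<le> (real n + 1) * (\<bar>f x - f y\<bar> + \<bar>f x - f y\<bar>)" .
  qed (auto simp: g_def)
  note g_ap = this
  have "(\<lambda>n. g n x) \<longlonglongrightarrow> indicator {x. c < f x} x" for x
  proof (cases "c < f x")
    case True
    obtain N where N: "1 / (f x - c) < real N" using reals_Archimedean2 by blast
    have "g n x = 1" if "n \<ge> N" for n
    proof -
      have "1 / (f x - c) \<le> real n" using N that by linarith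
      then have "1 \<le> real n * (f x - c)" using True by (simp add: pos_divide_le_eq)
      then show ?thesis using True by (simp add: g_def)
    qed
    then show ?thesis using True
      by (intro tendsto_eventually eventually_sequentiallyI[of N]) simp
  qed (simp add: g_def)
  then have "almost_periodic (indicator {x. c < f x})"
    by (rule almost_periodic_pointwise_limit[where B=1, OF g_ap, rotated]) (auto simp: g_def)
  moreover have "{x \<in> space M. c < f x} \<in> sets M" by measurable
  ultimately show ?thesis by (simp add: kronecker_sets_def space_UNIV)
qed

lemma almost_periodic_imp_kronecker_measurable:
  "almost_periodic f \<Longrightarrow> f \<in> borel_measurable kronecker_algebra"
  unfolding borel_measurable_iff_greater
  by (simp add: space_kronecker_algebra sets_kronecker_algebra almost_periodic_superlevel)

lemma kronecker_measurable_imp_almost_periodic: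
  assumes f: "f \<in> borel_measurable kronecker_algebra" and 01: "\<And>x. 0 \<le> f x" "\<And>x. f x \<le> (1::real)"
  shows "almost_periodic f"
proof (rule almost_periodic_pointwise_limit[where B=2])
  define g where "g = (\<lambda>n x. (1 / real (Suc n)) * (\<Sum>j\<in>{1..Suc n}. indicator {x. real j / real (Suc n) \<le> f x} x))"
  have level: "{x. c \<le> f x} \<in> kronecker_sets" for c
    using f unfolding borel_measurable_iff_ge by (simp add: space_kronecker_algebra sets_kronecker_algebra)
  show "almost_periodic (g n)" for n
    unfolding g_def using level
    by (intro almost_periodic_cmult almost_periodic_sum) (simp add: kronecker_sets_def)
  have floor: "g n x = real_of_int \<lfloor>real (Suc n) * f x\<rfloor> / real (Suc n)" for n x
  proof -
    let ?y = "real (Suc n) * f x"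
    have y: "0 \<le> ?y" "?y \<le> real (Suc n)" using 01[of x] by (simp_all add: mult_left_le)
    have "(\<Sum>j\<in>{1..Suc n}. indicator {x. real j / real (Suc n) \<le> f x} x :: real)
        = (\<Sum>j\<in>{1..Suc n}. if real j \<le> ?y then 1 else 0)"
      by (intro sum.cong refl) (simp add: indicator_def divide_le_eq mult.commute del: of_nat_Suc)
    also have "\<dots> = real (card {j \<in> {1..Suc n}. real j \<le> ?y})"
      by (subst sum.inter_filter[symmetric]) auto
    also have "{j \<in> {1..Suc n}. real j \<le> ?y} = {1..nat \<lfloor>?y\<rfloor>}"
      by (rule levels_below[OF y])
    finally show ?thesis using y unfolding g_def by (simp del: of_nat_Suc)
  qed
  have close: "\<bar>g n x - f x\<bar> \<le> 1 / real (Suc n)" for n x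
  proof -
    have "\<bar>real_of_int \<lfloor>real (Suc n) * f x\<rfloor> - real (Suc n) * f x\<bar> / real (Suc n) \<le> 1 / real (Suc n)"
      by (intro divide_right_mono) linarith+
    moreover have "g n x - f x = (real_of_int \<lfloor>real (Suc n) * f x\<rfloor> - real (Suc n) * f x) / real (Suc n)"
      unfolding floor by (simp add: field_simps)
    ultimately show ?thesis by simp
  qed
  show "\<bar>g n x\<bar> \<le> 2" for n x
  proof -
    have "1 / real (Suc n) \<le> 1" by simp
    then show ?thesis using close[of n x] 01[of x] by linarith
  qed
  show "(\<lambda>n. g n x) \<longlonglongrightarrow> f x" for x
  proof -
    have "(\<lambda>n. g n x - f x) \<longlonglongrightarrow> 0"
      by (rule Lim_null_comparison[OF _ LIMSEQ_Suc[OF lim_1_over_n]]) (use close in auto)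
    then show ?thesis by (simp add: LIM_zero_iff)
  qed
qed

text \<open>
The conditional expectation given the Kronecker algebra, truncated to \<open>[0, 1]\<close> so that it is bounded
at every point. It can be tested against almost periodic functions because these are measurable for
the Kronecker algebra.
\<close>
lemma kronecker_projection:
  assumes [measurable]: "f \<in> borel_measurable M" and f01: "\<And>x. 0 \<le> f x" "\<And>x. f x \<le> (1::real)"
  shows "\<exists>\<phi>. almost_periodic \<phi> \<and> (\<forall>x. 0 \<le> \<phi> x \<and> \<phi> x \<le> 1) \<and>
           (\<forall>g. almost_periodic g \<longrightarrow> (\<integral>x. g x * (f x - \<phi> x) \<partial>M) = 0)"
proof -
  interpret K: finite_measure_subalgebra M kronecker_algebra
    by (unfold_locales) (rule subalgebra_kronecker)
  have int: "integrable M f" using f01 by (intro integrable_bounded[where B=1]) auto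
  define \<phi> where "\<phi> = (\<lambda>x. max 0 (min 1 (real_cond_exp M kronecker_algebra f x)))"
  have m: "\<phi> \<in> borel_measurable kronecker_algebra" unfolding \<phi>_def by measurable
  have ap: "almost_periodic \<phi>"
    by (rule kronecker_measurable_imp_almost_periodic[OF m]) (auto simp: \<phi>_def)
  have [measurable]: "\<phi> \<in> borel_measurable M" by (rule almost_periodic_measurable[OF ap])
  have "AE x in M. real_cond_exp M kronecker_algebra f x \<ge> 0"
    using f01 by (intro K.real_cond_exp_pos) auto
  moreover have "AE x in M. real_cond_exp M kronecker_algebra f x \<le> 1"
    using f01 int by (intro K.real_cond_exp_le_c) auto
  ultimately have eq: "AE x in M. real_cond_exp M kronecker_algebra f x = \<phi> x"
    by eventually_elim (simp add: \<phi>_def)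
  have "(\<integral>x. g x * (f x - \<phi> x) \<partial>M) = 0" if g: "almost_periodic g" for g
  proof -
    have [measurable]: "g \<in> borel_measurable M" by (rule almost_periodic_measurable[OF g])
    obtain B where B: "\<And>x. \<bar>g x\<bar> \<le> B" using almost_periodic_bounded[OF g] by metis
    have i: "integrable M (\<lambda>x. g x * h x)" if [measurable]: "h \<in> borel_measurable M" and "\<And>x. 0 \<le> h x" "\<And>x. h x \<le> 1" for h
    proof (rule integrable_bounded[where B=B])
      show "\<bar>g x * h x\<bar> \<le> B" for x
        using mult_mono[OF B[of x], of "h x" 1] that(2,3)[of x] B[of x] by (simp add: abs_mult)
    qed simp
    have "(\<integral>x. g x * \<phi> x \<partial>M) = (\<integral>x. g x * real_cond_exp M kronecker_algebra f x \<partial>M)"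
      using eq by (intro integral_cong_AE) (auto elim: AE_mp)
    also have "\<dots> = (\<integral>x. g x * f x \<partial>M)"
      using almost_periodic_imp_kronecker_measurable[OF g] i f01
      by (intro K.real_cond_exp_intg) auto
    finally show ?thesis
      using i[of f] i[of \<phi>] f01 by (simp add: right_diff_distrib \<phi>_def)
  qed
  then show ?thesis using ap by (intro exI[of _ \<phi>]) (auto simp: \<phi>_def)
qed

end

section \<open>Weak mixing relative to the Kronecker algebra\<close>

lemma floor_in_bounds: "\<bar>z\<bar> \<le> y \<Longrightarrow> \<lfloor>z\<rfloor> \<in> {- \<lceil>y\<rceil> - 1..\<lceil>y::real\<rceil>}"
  unfolding atLeastAtMost_iff by linarith

context measure_action
begin

lemma const_measurable [measurable]: "(\<lambda>_. x) \<in> measurable N M"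
  by (simp add: space_UNIV)

lemma product_action: "measure_action (M \<Otimes>\<^sub>M M) (\<lambda>s p. (T s (fst p), T s (snd p)))"
proof -
  interpret P: pair_prob_space M M ..
  show ?thesis
  proof (unfold_locales)
    show "space (M \<Otimes>\<^sub>M M) = UNIV" by (simp add: space_pair_measure space_UNIV)
    show "(\<lambda>p. (T s (fst p), T s (snd p))) \<in> measurable (M \<Otimes>\<^sub>M M) (M \<Otimes>\<^sub>M M)" for s
      by measurable
    show "distr (M \<Otimes>\<^sub>M M) (M \<Otimes>\<^sub>M M) (\<lambda>p. (T s (fst p), T s (snd p))) = M \<Otimes>\<^sub>M M" for s
    proof -
      have "sigma_finite_measure (distr M M (T s))" by (subst distr_T) (rule sigma_finite_measure_axioms)
      then have "distr M M (T s) \<Otimes>\<^sub>M distr M M (T s) = distr (M \<Otimes>\<^sub>M M) (M \<Otimes>\<^sub>M M) (\<lambda>(x, y). (T s x, T s y))"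
        by (intro pair_measure_distr) auto
      then show ?thesis by (simp add: distr_T case_prod_unfold)
    qed
  qed (auto simp: T_zero T_add)
qed

text \<open>
The squared correlation with \<open>w\<close> is the integral against \<open>w \<otimes> w\<close> of \<open>u \<otimes> u\<close>, moved by the diagonal
action on the product space, so the averages converge to an integral against an invariant kernel
\<open>k\<close>. The integral operator with kernel \<open>k\<close> is compact and commutes with the action; hence it maps
\<open>u\<close> to an almost periodic function \<open>f\<close>, to which \<open>u\<close> is orthogonal. This says that \<open>k\<close> is orthogonal to
\<open>u \<otimes> u\<close>, by invariance also to its translates, and in the limit to itself, so \<open>k = 0\<close>.
\<close>
theorem weakly_mixing:
  assumes F: "folner_seq F"
    and um [measurable]: "u \<in> borel_measurable M" and uB: "\<And>x. \<bar>u x\<bar> \<le> B"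
    and wm [measurable]: "w \<in> borel_measurable M" and wB: "\<And>x. \<bar>w x\<bar> \<le> B'"
    and orth: "\<And>g. almost_periodic g \<Longrightarrow> (\<integral>x. g x * u x \<partial>M) = 0"
  shows "(\<lambda>n. avg (F n) (\<lambda>s. (\<integral>x. u (T s x) * w x \<partial>M)\<^sup>2)) \<longlonglongrightarrow> 0"
proof -
  let ?N = "M \<Otimes>\<^sub>M M"
  interpret N: measure_action ?N "\<lambda>s p. (T s (fst p), T s (snd p))" by (rule product_action)
  interpret P: pair_prob_space M M ..
  have fin: "finite (F n)" "F n \<noteq> {}" for n
    using F by (auto simp: folner_seq_finite folner_seq_nonempty)
  have B0: "0 \<le> B" "0 \<le> B'" using uB[of undefined] wB[of undefined] by linarith+
  define h where "h = (\<lambda>p. u (fst p) * u (snd p))"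
  have hm [measurable]: "h \<in> borel_measurable ?N" unfolding h_def by measurable
  have hB: "\<bar>h p\<bar> \<le> B * B" for p
    unfolding h_def abs_mult using uB B0 by (intro mult_mono) auto
  define kn where "kn = (\<lambda>n. N.erg_avg (F n) h)"
  have knm [measurable]: "kn n \<in> borel_measurable ?N" for n unfolding kn_def by measurable
  have knB: "\<bar>kn n p\<bar> \<le> B * B" for n p unfolding kn_def by (rule N.erg_avg_bounded[OF fin hB])
  obtain k where km [measurable]: "k \<in> borel_measurable ?N" and kB: "\<And>p. \<bar>k p\<bar> \<le> B * B"
    and kinv: "\<And>s. AE p in ?N. k (T s (fst p), T s (snd p)) = k p"
    and lim: "(\<lambda>n. \<integral>p. \<bar>kn n p - k p\<bar> \<partial>?N) \<longlonglongrightarrow> 0"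
    using N.mean_ergodic[OF F hm hB] unfolding kn_def by blast
  have knk: "\<bar>kn n p - k p\<bar> \<le> 2 * (B * B)" for n p
    using knB[of n p] kB[of p] by linarith
  have int_knk: "integrable ?N (\<lambda>p. \<bar>kn n p - k p\<bar>)" for n
    using knk by (intro N.integrable_bounded[where B="2 * (B * B)"]) auto
  define f where "f = (\<lambda>x. \<integral>y. k (x, y) * u y \<partial>M)"
  have fm [measurable]: "f \<in> borel_measurable M" unfolding f_def by measurable
  have kuB: "\<bar>k (x, y) * u z\<bar> \<le> B * B * B" for x y z
    unfolding abs_mult using uB kB B0 by (intro mult_mono) auto
  have knuB: "\<bar>kn n (x, y) * u z\<bar> \<le> B * B * B" for n x y z
    unfolding abs_mult using uB knB B0 by (intro mult_mono) auto
  have fB: "\<bar>f x\<bar> \<le> B * B * B" for x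
  proof -
    have "\<bar>f x\<bar> \<le> (\<integral>y. \<bar>k (x, y) * u y\<bar> \<partial>M)" unfolding f_def by (rule integral_abs_bound)
    also have "\<dots> \<le> B * B * B" using kuB by (intro integral_le_bound[where B="B * B * B"]) auto
    finally show ?thesis .
  qed
  \<comment> \<open>Invariance of the kernel: translating the image of \<open>u\<close> is the same as translating \<open>u\<close>.\<close>
  have f_shift: "AE x in M. f (T s x) = (\<integral>y. k (x, y) * u (T s y) \<partial>M)" for s
    using P.AE_pair[OF kinv[of s]]
  proof eventually_elim
    case (elim x)
    have "f (T s x) = (\<integral>y. k (T s x, T s y) * u (T s y) \<partial>M)"
      unfolding f_def by (rule integral_T[symmetric]) measurable
    also have "\<dots> = (\<integral>y. k (x, y) * u (T s y) \<partial>M)"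
      using elim by (intro integral_cong_AE) auto
    finally show ?case .
  qed
  have "almost_periodic f"
  proof (rule almost_periodicI[OF fm fB])
    fix \<epsilon> :: real assume "0 < \<epsilon>"
    define \<delta> where "\<delta> = \<epsilon> / (4 * (B + 1))"
    have "0 < \<delta>" using \<open>0 < \<epsilon>\<close> B0 unfolding \<delta>_def by simp
    obtain n where n: "(\<integral>p. \<bar>kn n p - k p\<bar> \<partial>?N) < \<delta>"
      using order_tendstoD(2)[OF lim \<open>0 < \<delta>\<close>] eventually_happens'[OF sequentially_bot] by blast
    \<comment> \<open>Up to a small error the kernel is the finite sum \<open>kn n\<close>, so a translate of \<open>f\<close> is determined by
      the finitely many correlations \<open>ip t s\<close>; rounding these gives the colouring.\<close>
    define ip where "ip = (\<lambda>t s. \<integral>y. u (T t y) * u (T s y) \<partial>M)"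
    have uuB: "\<bar>u y * u z\<bar> \<le> B * B" for y z
      unfolding abs_mult using uB B0 by (intro mult_mono) auto
    have ipB: "\<bar>ip t s\<bar> \<le> B * B" for t s
    proof -
      have "\<bar>ip t s\<bar> \<le> (\<integral>y. \<bar>u (T t y) * u (T s y)\<bar> \<partial>M)" unfolding ip_def by (rule integral_abs_bound)
      also have "\<dots> \<le> B * B" using uuB by (intro integral_le_bound[where B="B * B"]) auto
      finally show ?thesis .
    qed
    define c where "c = (\<lambda>s. restrict (\<lambda>t. \<lfloor>ip t s / \<delta>\<rfloor>) (F n))"
    define fn where "fn = (\<lambda>s x. \<integral>y. kn n (x, y) * u (T s y) \<partial>M)"
    have fnm [measurable]: "fn s \<in> borel_measurable M" for s unfolding fn_def by measurable
    have fn_eq: "fn s x = avg (F n) (\<lambda>t. u (T t x) * ip t s)" for s x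
    proof -
      have "fn s x = (\<integral>y. (\<Sum>t\<in>F n. u (T t x) * (u (T t y) * u (T s y))) / real (card (F n)) \<partial>M)"
        unfolding fn_def kn_def N.erg_avg_def avg_def h_def by (simp add: sum_distrib_right mult.assoc)
      also have "\<dots> = (\<Sum>t\<in>F n. u (T t x) * ip t s) / real (card (F n))"
        unfolding ip_def using uuB
        by (simp add: Bochner_Integration.integral_sum integrable_bounded[where B="B * B"])
      finally show ?thesis by (simp add: avg_def)
    qed
    have near: "(\<integral>x. \<bar>f (T s x) - fn s x\<bar> \<partial>M) \<le> B * \<delta>" for s
    proof -
      let ?D = "\<lambda>x y. (k (x, y) - kn n (x, y)) * u (T s y)"
      have DB: "\<bar>?D x y\<bar> \<le> 2 * (B * B) * B" for x y
        unfolding abs_mult using uB knk[of n "(x, y)"] B0 by (intro mult_mono) (auto simp: abs_minus_commute)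
      have "(\<integral>x. \<bar>f (T s x) - fn s x\<bar> \<partial>M) = (\<integral>x. \<bar>\<integral>y. ?D x y \<partial>M\<bar> \<partial>M)"
      proof (rule integral_cong_AE)
        show "AE x in M. \<bar>f (T s x) - fn s x\<bar> = \<bar>\<integral>y. ?D x y \<partial>M\<bar>"
          using f_shift[of s]
        proof eventually_elim
          case (elim x)
          have "integrable M (\<lambda>y. k (x, y) * u (T s y))" "integrable M (\<lambda>y. kn n (x, y) * u (T s y))"
            using kuB knuB by (auto intro!: integrable_bounded[where B="B * B * B"])
          then show ?case unfolding elim fn_def by (simp add: left_diff_distrib)
        qed
      qed measurable
      also have "\<dots> \<le> (\<integral>x. (\<integral>y. \<bar>?D x y\<bar> \<partial>M) \<partial>M)"
      proof (rule integral_mono)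
        have b1: "\<bar>\<integral>y. \<bar>?D x y\<bar> \<partial>M\<bar> \<le> 2 * (B * B) * B" for x
        proof -
          have "0 \<le> (\<integral>y. \<bar>?D x y\<bar> \<partial>M)" by simp
          moreover have "(\<integral>y. \<bar>?D x y\<bar> \<partial>M) \<le> 2 * (B * B) * B"
            using DB by (intro integral_le_bound[where B="2 * (B * B) * B"]) auto
          ultimately show ?thesis by simp
        qed
        have b2: "\<bar>\<bar>\<integral>y. ?D x y \<partial>M\<bar>\<bar> \<le> 2 * (B * B) * B" for x
          using integral_abs_bound[of M "?D x"] b1[of x] by linarith
        show "integrable M (\<lambda>x. \<bar>\<integral>y. ?D x y \<partial>M\<bar>)"
          by (rule integrable_bounded[OF _ b2]) measurable
        show "integrable M (\<lambda>x. \<integral>y. \<bar>?D x y\<bar> \<partial>M)"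
          by (rule integrable_bounded[OF _ b1]) measurable
      qed (rule integral_abs_bound)
      also have "\<dots> = (\<integral>p. \<bar>(k p - kn n p) * u (T s (snd p))\<bar> \<partial>?N)"
      proof -
        have "integrable ?N (\<lambda>p. \<bar>(k p - kn n p) * u (T s (snd p))\<bar>)"
          using DB by (intro N.integrable_bounded[where B="2 * (B * B) * B"]) (auto simp: split_paired_all)
        from P.integral_fst'[OF this] show ?thesis by simp
      qed
      also have "\<dots> \<le> (\<integral>p. B * \<bar>kn n p - k p\<bar> \<partial>?N)"
      proof (rule integral_mono)
        show "integrable ?N (\<lambda>p. \<bar>(k p - kn n p) * u (T s (snd p))\<bar>)"
          using DB by (intro N.integrable_bounded[where B="2 * (B * B) * B"]) (auto simp: split_paired_all)
        show "\<bar>(k p - kn n p) * u (T s (snd p))\<bar> \<le> B * \<bar>kn n p - k p\<bar>" for p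
          using mult_left_mono[OF uB[of "T s (snd p)"], of "\<bar>kn n p - k p\<bar>"]
          by (simp add: abs_mult abs_minus_commute mult.commute)
      qed (use int_knk in auto)
      also have "\<dots> \<le> B * \<delta>"
        using n B0 int_knk by (simp add: mult_left_mono)
      finally show ?thesis .
    qed
    have "c s \<in> F n \<rightarrow>\<^sub>E {- \<lceil>B * B / \<delta>\<rceil> - 1..\<lceil>B * B / \<delta>\<rceil>}" for s
    proof -
      have "\<lfloor>ip t s / \<delta>\<rfloor> \<in> {- \<lceil>B * B / \<delta>\<rceil> - 1..\<lceil>B * B / \<delta>\<rceil>}" for t
      proof -
        have "\<bar>ip t s / \<delta>\<bar> \<le> B * B / \<delta>"
          using ipB[of t s] \<open>0 < \<delta>\<close> by (simp add: divide_right_mono)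
        then show ?thesis by (rule floor_in_bounds)
      qed
      then show ?thesis unfolding c_def by auto
    qed
    then have "range c \<subseteq> (F n \<rightarrow>\<^sub>E {- \<lceil>B * B / \<delta>\<rceil> - 1..\<lceil>B * B / \<delta>\<rceil>})" by blast
    then have fin_c: "finite (range c)"
      by (rule finite_subset) (intro finite_PiE fin, simp)
    have "(\<integral>x. \<bar>f (T s x) - f (T t x)\<bar> \<partial>M) < \<epsilon>" if eq: "c s = c t" for s t
    proof -
      have step: "\<bar>fn s x - fn t x\<bar> \<le> B * \<delta>" for x
      proof -
        have diff: "fn s x - fn t x = avg (F n) (\<lambda>r. u (T r x) * (ip r s - ip r t))"
          unfolding fn_eq by (simp add: avg_diff[symmetric] right_diff_distrib)
        have "\<bar>u (T r x) * (ip r s - ip r t)\<bar> \<le> B * \<delta>" if "r \<in> F n" for r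
        proof -
          have "\<lfloor>ip r s / \<delta>\<rfloor> = \<lfloor>ip r t / \<delta>\<rfloor>"
            using fun_cong[OF eq, of r] that unfolding c_def by simp
          then have "\<bar>ip r s / \<delta> - ip r t / \<delta>\<bar> \<le> 1" by linarith
          then have "\<bar>ip r s - ip r t\<bar> \<le> \<delta>"
            using \<open>0 < \<delta>\<close> by (simp add: diff_divide_distrib[symmetric] divide_le_eq)
          then show ?thesis unfolding abs_mult using uB B0 by (intro mult_mono) auto
        qed
        then show ?thesis unfolding diff by (rule avg_abs_le[OF fin])
      qed
      have fnB: "\<bar>fn r x\<bar> \<le> B * (B * B)" for r x
        unfolding fn_eq by (rule avg_abs_le[OF fin]) (use uB ipB B0 in \<open>auto simp: abs_mult intro!: mult_mono\<close>)
      have dB: "\<bar>\<bar>f y - fn r z\<bar>\<bar> \<le> 2 * (B * (B * B))" "\<bar>\<bar>f y - f z\<bar>\<bar> \<le> 2 * (B * (B * B))" for y z r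
        using fB[of y] fB[of z] fnB[of r z] by (simp_all add: mult.assoc)
      have i1: "integrable M (\<lambda>x. \<bar>f (T r x) - fn r x\<bar>)" for r
        by (rule integrable_bounded[OF _ dB(1)]) measurable
      have "(\<integral>x. \<bar>f (T s x) - f (T t x)\<bar> \<partial>M)
          \<le> (\<integral>x. (\<bar>f (T s x) - fn s x\<bar> + \<bar>f (T t x) - fn t x\<bar>) + B * \<delta> \<partial>M)"
      proof (rule integral_mono)
        show "integrable M (\<lambda>x. \<bar>f (T s x) - f (T t x)\<bar>)" by (rule integrable_bounded[OF _ dB(2)]) measurable
        show "integrable M (\<lambda>x. (\<bar>f (T s x) - fn s x\<bar> + \<bar>f (T t x) - fn t x\<bar>) + B * \<delta>)"
          using i1 by simp
        show "\<bar>f (T s x) - f (T t x)\<bar> \<le> (\<bar>f (T s x) - fn s x\<bar> + \<bar>f (T t x) - fn t x\<bar>) + B * \<delta>" for x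
          using step[of x] by linarith
      qed
      also have "\<dots> = (\<integral>x. \<bar>f (T s x) - fn s x\<bar> \<partial>M) + (\<integral>x. \<bar>f (T t x) - fn t x\<bar> \<partial>M) + B * \<delta>"
        using i1 by (simp add: prob_space)
      also have "\<dots> \<le> 3 * (B * \<delta>)" using near[of s] near[of t] by linarith
      also have "\<dots> < 4 * (B + 1) * \<delta>" using B0 \<open>0 < \<delta>\<close> by (simp add: algebra_simps add_strict_increasing2)
      also have "\<dots> = \<epsilon>" unfolding \<delta>_def using B0 by simp
      finally show ?thesis .
    qed
    then show "\<exists>c :: 'g \<Rightarrow> 'g \<Rightarrow> int. finite (range c) \<and>
        (\<forall>s t. c s = c t \<longrightarrow> (\<integral>x. \<bar>f (T s x) - f (T t x)\<bar> \<partial>M) < \<epsilon>)" using fin_c by blast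
  qed
  then have "(\<integral>x. f x * u x \<partial>M) = 0" by (rule orth)
  note fu = this
  have hkB: "\<bar>k p * h q\<bar> \<le> B * B * (B * B)" for p q
    unfolding abs_mult using kB hB B0 by (intro mult_mono) auto
  have "(\<integral>p. k p * h p \<partial>?N) = (\<integral>x. (\<integral>y. k (x, y) * h (x, y) \<partial>M) \<partial>M)"
    by (rule P.integral_fst'[symmetric])
      (rule N.integrable_bounded[OF _ hkB], measurable)
  also have "\<dots> = (\<integral>x. f x * u x \<partial>M)"
    unfolding f_def h_def by (simp add: mult.assoc mult.left_commute mult.commute)
  also have "\<dots> = 0" by (rule fu)
  finally have kh: "(\<integral>p. k p * h p \<partial>?N) = 0" .
  have kh_s: "(\<integral>p. k p * h (T s (fst p), T s (snd p)) \<partial>?N) = 0" for s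
  proof -
    have "(\<integral>p. k p * h (T s (fst p), T s (snd p)) \<partial>?N)
        = (\<integral>p. k (T s (fst p), T s (snd p)) * h (T s (fst p), T s (snd p)) \<partial>?N)"
      using kinv[of s] by (intro integral_cong_AE) auto
    also have "\<dots> = (\<integral>p. k p * h p \<partial>?N)"
      by (rule N.integral_T[of "\<lambda>p. k p * h p"]) measurable
    finally show ?thesis using kh by simp
  qed
  have kkn: "(\<integral>p. k p * kn n p \<partial>?N) = 0" for n
  proof -
    have "(\<integral>p. k p * kn n p \<partial>?N) = (\<Sum>s\<in>F n. \<integral>p. k p * h (T s (fst p), T s (snd p)) \<partial>?N) / real (card (F n))"
      unfolding kn_def N.erg_avg_def avg_def using hkB
      by (simp add: sum_distrib_left Bochner_Integration.integral_sum N.integrable_bounded[where B="B * B * (B * B)"])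
    then show ?thesis by (simp add: kh_s)
  qed
  have kkB: "\<bar>k p * k q\<bar> \<le> B * B * (B * B)" for p q
    unfolding abs_mult using kB B0 by (intro mult_mono) auto
  have kknB: "\<bar>k p * kn n q\<bar> \<le> B * B * (B * B)" for n p q
    unfolding abs_mult using kB knB B0 by (intro mult_mono) auto
  have "(\<integral>p. k p * k p \<partial>?N) \<le> B * B * (\<integral>p. \<bar>kn n p - k p\<bar> \<partial>?N)" for n
  proof -
    have "(\<integral>p. k p * k p \<partial>?N) = (\<integral>p. k p * (k p - kn n p) \<partial>?N)"
      using kkn[of n] by (simp add: right_diff_distrib N.integrable_bounded[OF _ kkB] N.integrable_bounded[OF _ kknB])
    also have "\<dots> \<le> (\<integral>p. B * B * \<bar>kn n p - k p\<bar> \<partial>?N)"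
    proof (rule integral_mono)
      show "integrable ?N (\<lambda>p. k p * (k p - kn n p))"
        by (simp add: right_diff_distrib N.integrable_bounded[OF _ kkB] N.integrable_bounded[OF _ kknB])
      show "k p * (k p - kn n p) \<le> B * B * \<bar>kn n p - k p\<bar>" for p
        using mult_right_mono[OF kB[of p], of "\<bar>kn n p - k p\<bar>"]
        by (metis abs_ge_self abs_minus_commute abs_mult abs_ge_zero order_trans)
    qed (use int_knk in auto)
    finally show ?thesis using int_knk by simp
  qed
  moreover have "(\<lambda>n. B * B * (\<integral>p. \<bar>kn n p - k p\<bar> \<partial>?N)) \<longlonglongrightarrow> 0"
    using tendsto_mult_left[OF lim, of "B * B"] by simp
  ultimately have "(\<integral>p. k p * k p \<partial>?N) \<le> 0"
    by (intro tendsto_lowerbound[where f="\<lambda>n. B * B * (\<integral>p. \<bar>kn n p - k p\<bar> \<partial>?N)"]) auto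
  then have "(\<integral>p. k p * k p \<partial>?N) = 0" by (intro antisym) auto
  then have "AE p in ?N. k p * k p = 0"
    by (subst (asm) integral_nonneg_eq_0_iff_AE) (auto intro!: N.integrable_bounded[OF _ kkB])
  then have k0: "AE p in ?N. k p = 0" by simp
  have bound: "avg (F n) (\<lambda>s. (\<integral>x. u (T s x) * w x \<partial>M)\<^sup>2) \<le> B' * B' * (\<integral>p. \<bar>kn n p - k p\<bar> \<partial>?N)" for n
  proof -
    let ?w = "\<lambda>p. w (fst p) * w (snd p)"
    have w2: "\<bar>?w p\<bar> \<le> B' * B'" for p
      unfolding abs_mult using wB B0 by (intro mult_mono) auto
    have hwB: "\<bar>h q * ?w p\<bar> \<le> B * B * (B' * B')" for p q
      unfolding abs_mult[of "h q"] using hB[of q] w2[of p] B0 by (intro mult_mono) auto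
    have sq: "(\<integral>x. u (T s x) * w x \<partial>M)\<^sup>2 = (\<integral>p. h (T s (fst p), T s (snd p)) * ?w p \<partial>?N)" for s
    proof -
      have "(\<integral>p. h (T s (fst p), T s (snd p)) * ?w p \<partial>?N)
          = (\<integral>x. (\<integral>y. h (T s x, T s y) * ?w (x, y) \<partial>M) \<partial>M)"
      proof -
        have "integrable ?N (\<lambda>p. h (T s (fst p), T s (snd p)) * ?w p)"
          by (rule N.integrable_bounded[OF _ hwB]) measurable
        from P.integral_fst'[OF this] show ?thesis by simp
      qed
      also have "\<dots> = (\<integral>x. u (T s x) * w x * (\<integral>y. u (T s y) * w y \<partial>M) \<partial>M)"
        unfolding h_def by (simp flip: integral_mult_right_zero add: mult.assoc mult.left_commute mult.commute)
      also have "\<dots> = (\<integral>x. u (T s x) * w x \<partial>M)\<^sup>2" by (simp add: power2_eq_square)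
      finally show ?thesis by simp
    qed
    define H where "H = (\<lambda>s p. h (T s (fst p), T s (snd p)) * ?w p)"
    have iH: "integrable ?N (H s)" for s
      unfolding H_def by (rule N.integrable_bounded[OF _ hwB]) measurable
    have "kn n p * ?w p = (\<Sum>s\<in>F n. H s p) / real (card (F n))" for p
      unfolding kn_def N.erg_avg_def avg_def H_def by (simp only: sum_distrib_right times_divide_eq_left)
    then have "(\<integral>p. kn n p * ?w p \<partial>?N) = (\<Sum>s\<in>F n. \<integral>p. H s p \<partial>?N) / real (card (F n))"
      using iH by (simp only: integral_divide_zero Bochner_Integration.integral_sum)
    also have "\<dots> = avg (F n) (\<lambda>s. (\<integral>x. u (T s x) * w x \<partial>M)\<^sup>2)"
      unfolding avg_def H_def by (simp only: sq)
    finally have "avg (F n) (\<lambda>s. (\<integral>x. u (T s x) * w x \<partial>M)\<^sup>2) = (\<integral>p. kn n p * ?w p \<partial>?N)" ..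
    also have "\<dots> \<le> (\<integral>p. B' * B' * \<bar>kn n p - k p\<bar> \<partial>?N)"
    proof (rule integral_mono_AE)
      have "\<bar>kn n p * ?w p\<bar> \<le> B * B * (B' * B')" for p
        unfolding abs_mult[of "kn n p"] using knB[of n p] w2[of p] B0 by (intro mult_mono) auto
      then show "integrable ?N (\<lambda>p. kn n p * ?w p)" by (rule N.integrable_bounded[rotated]) measurable
      show "AE p in ?N. kn n p * ?w p \<le> B' * B' * \<bar>kn n p - k p\<bar>"
        using k0
      proof eventually_elim
        case (elim p)
        have "kn n p * ?w p \<le> \<bar>?w p\<bar> * \<bar>kn n p\<bar>"
          by (metis abs_ge_self abs_mult mult.commute)
        also have "\<dots> \<le> B' * B' * \<bar>kn n p\<bar>" by (rule mult_right_mono[OF w2]) simp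
        finally show ?case using elim by simp
      qed
    qed (use int_knk in auto)
    finally show ?thesis using int_knk by simp
  qed
  have upper: "(\<lambda>n. B' * B' * (\<integral>p. \<bar>kn n p - k p\<bar> \<partial>?N)) \<longlonglongrightarrow> 0"
    using tendsto_mult_left[OF lim, of "B' * B'"] by simp
  have lower: "\<forall>\<^sub>F n in sequentially. 0 \<le> avg (F n) (\<lambda>s. (\<integral>x. u (T s x) * w x \<partial>M)\<^sup>2)"
    by (intro always_eventually allI avg_nonneg) simp
  show ?thesis
    by (rule tendsto_sandwich[OF lower always_eventually tendsto_const upper]) (rule allI, rule bound)
qed

end

section \<open>Ergodic averages and uniform approximation\<close>

lemma finite_representatives:
  assumes "finite (range c)"
  obtains R where "finite R" "\<And>s. \<exists>r\<in>R. c s = c r"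
proof
  let ?R = "(\<lambda>i. SOME s. c s = i) ` range c"
  show "finite ?R" using assms by simp
  show "\<exists>r\<in>?R. c s = c r" for s
    by (rule bexI[of _ "SOME t. c t = c s"]) (auto intro: someI2[of _ s])
qed

context measure_action
begin

lemma invariant_AE_const:
  fixes k :: "'a \<Rightarrow> real"
  assumes cnt: "countable (UNIV :: 'g set)"
    and erg: "\<And>A. A \<in> sets M \<Longrightarrow> (\<And>s. T s ` A = A) \<Longrightarrow> prob A = 0 \<or> prob A = 1"
    and km [measurable]: "k \<in> borel_measurable M" and kB: "\<And>x. \<bar>k x\<bar> \<le> B"
    and inv: "\<And>s. AE x in M. k (T s x) = k x"
  shows "AE x in M. k x = (\<integral>y. k y \<partial>M)"
proof -
  define m where "m = (\<integral>y. k y \<partial>M)"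
  \<comment> \<open>Ergodicity speaks of strictly invariant sets, so the exceptional null sets are removed.\<close>
  define X where "X = {x. (\<forall>s. k (T s x) = k x) \<and> m < k x}"
  have Xm: "X \<in> sets M"
  proof -
    have "{x \<in> space M. k (T s x) = k x} \<in> sets M" for s by measurable
    then have "(\<Inter>s. {x \<in> space M. k (T s x) = k x}) \<in> sets M"
      by (intro sets.countable_INT' cnt) auto
    moreover have "{x \<in> space M. m < k x} \<in> sets M" by measurable
    moreover have "X = (\<Inter>s. {x \<in> space M. k (T s x) = k x}) \<inter> {x \<in> space M. m < k x}"
      by (auto simp: X_def space_UNIV)
    ultimately show ?thesis by simp
  qed
  have sub: "T s x \<in> X" if "x \<in> X" for s x
    using that unfolding X_def by (simp add: T_add[symmetric])
  have "T s ` X = X" for s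
  proof
    show "T s ` X \<subseteq> X" using sub by blast
    show "X \<subseteq> T s ` X"
    proof
      fix x assume "x \<in> X"
      then have "T (- s) x \<in> X" by (rule sub)
      moreover have "x = T s (T (- s) x)" by (simp add: T_add[symmetric] T_zero)
      ultimately show "x \<in> T s ` X" by blast
    qed
  qed
  then have X01: "prob X = 0 \<or> prob X = 1" by (rule erg[OF Xm])
  have invAE: "AE x in M. \<forall>s. k (T s x) = k x"
  proof -
    have "AE x in M. \<forall>s\<in>UNIV. k (T s x) = k x"
      by (subst AE_ball_countable[OF cnt]) (use inv in blast)
    then show ?thesis by simp
  qed
  have int: "integrable M k" by (rule integrable_bounded[OF km kB])
  from X01 have "(AE x in M. k x \<le> m) \<or> (AE x in M. m \<le> k x)"
  proof
    assume "prob X = 0"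
    then have "AE x in M. x \<notin> X" using Xm AE_iff_measurable[of X M "\<lambda>x. x \<notin> X"]
      by (simp add: emeasure_eq_measure space_UNIV)
    then have "AE x in M. k x \<le> m"
      using invAE by eventually_elim (auto simp: X_def)
    then show ?thesis ..
  next
    assume "prob X = 1"
    then have "AE x in M. x \<in> X" using Xm by (simp add: prob_eq_1)
    then have "AE x in M. m \<le> k x" by eventually_elim (auto simp: X_def)
    then show ?thesis ..
  qed
  then show ?thesis
  proof
    assume le: "AE x in M. k x \<le> m"
    have "(\<integral>x. m - k x \<partial>M) = 0" using int by (simp add: prob_space m_def)
    then have "AE x in M. m - k x = 0"
      using le int by (subst (asm) integral_nonneg_eq_0_iff_AE) auto
    then show ?thesis by eventually_elim (simp add: m_def)
  next
    assume le: "AE x in M. m \<le> k x"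
    have "(\<integral>x. k x - m \<partial>M) = 0" using int by (simp add: prob_space m_def)
    then have "AE x in M. k x - m = 0"
      using le int by (subst (asm) integral_nonneg_eq_0_iff_AE) auto
    then show ?thesis by eventually_elim (simp add: m_def)
  qed
qed

text \<open>
The limit in the mean ergodic theorem is invariant, hence constant, and integration identifies the
constant.
\<close>
theorem ergodic_averages_L1:
  assumes cnt: "countable (UNIV :: 'g set)"
    and erg: "\<And>A. A \<in> sets M \<Longrightarrow> (\<And>s. T s ` A = A) \<Longrightarrow> prob A = 0 \<or> prob A = 1"
    and F: "folner_seq F"
    and hm [measurable]: "h \<in> borel_measurable M" and hB: "\<And>x. \<bar>h x\<bar> \<le> B"
  shows "(\<lambda>n. \<integral>x. \<bar>erg_avg (F n) h x - (\<integral>y. h y \<partial>M)\<bar> \<partial>M) \<longlonglongrightarrow> 0"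
proof -
  have fin: "finite (F n)" "F n \<noteq> {}" for n
    using F by (auto simp: folner_seq_finite folner_seq_nonempty)
  obtain k where km [measurable]: "k \<in> borel_measurable M" and kB: "\<And>x. \<bar>k x\<bar> \<le> B"
    and inv: "\<And>s. AE x in M. k (T s x) = k x"
    and lim: "(\<lambda>n. \<integral>x. \<bar>erg_avg (F n) h x - k x\<bar> \<partial>M) \<longlonglongrightarrow> 0"
    using mean_ergodic[OF F hm hB] by blast
  have const: "AE x in M. k x = (\<integral>y. k y \<partial>M)"
    by (rule invariant_AE_const[OF cnt erg km kB inv])
  have ik: "integrable M k" by (rule integrable_bounded[OF km kB])
  have ie: "integrable M (erg_avg (F n) h)" for n
    by (rule integrable_bounded[OF _ erg_avg_bounded[OF fin hB]]) measurable
  have "\<bar>(\<integral>y. h y \<partial>M) - (\<integral>y. k y \<partial>M)\<bar> \<le> (\<integral>x. \<bar>erg_avg (F n) h x - k x\<bar> \<partial>M)" for n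
  proof -
    have "(\<integral>y. h y \<partial>M) - (\<integral>y. k y \<partial>M) = (\<integral>x. erg_avg (F n) h x - k x \<partial>M)"
      using ik ie by (simp add: integral_erg_avg[OF fin hm hB])
    then show ?thesis by (simp add: integral_abs_bound)
  qed
  then have "\<bar>(\<integral>y. h y \<partial>M) - (\<integral>y. k y \<partial>M)\<bar> \<le> 0"
    by (intro tendsto_lowerbound[OF lim]) auto
  then have "AE x in M. k x = (\<integral>y. h y \<partial>M)" using const by simp
  then have "(\<integral>x. \<bar>erg_avg (F n) h x - (\<integral>y. h y \<partial>M)\<bar> \<partial>M) = (\<integral>x. \<bar>erg_avg (F n) h x - k x\<bar> \<partial>M)" for n
    by (intro integral_cong_AE) (auto elim: AE_mp)
  then show ?thesis using lim by simp
qed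

text \<open>
Existence of the Bohr mean. Among finitely many representatives of the colours, a large \<open>F m\<close> gives
almost the same average of \<open>\<Theta>\<close> after any translation, and by the colouring the same is true for all
translations at once. The mean over a much later \<open>F n\<close> hardly changes if it is first averaged over
\<open>F m\<close>, so it is close to the mean over \<open>F m\<close>.
\<close>
lemma bohr_mean_L1_Cauchy:
  fixes F :: "nat \<Rightarrow> 'g set" and \<Theta> :: "'g \<Rightarrow> 'a \<Rightarrow> real"
  assumes F: "folner_seq F"
    and m [measurable]: "\<And>t. \<Theta> t \<in> borel_measurable M" and B: "\<And>t x. \<bar>\<Theta> t x\<bar> \<le> 1"
    and ap: "\<And>\<epsilon>. 0 < \<epsilon> \<Longrightarrow> \<exists>c :: 'g \<Rightarrow> nat. finite (range c) \<and>
        (\<forall>s s' t. c s = c s' \<longrightarrow> (\<integral>x. \<bar>\<Theta> (t + s) x - \<Theta> (t + s') x\<bar> \<partial>M) \<le> \<epsilon>)"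
    and "0 < \<epsilon>"
  shows "\<exists>N. \<forall>i\<ge>N. \<forall>j\<ge>N. (\<integral>x. \<bar>avg (F i) (\<lambda>t. \<Theta> t x) - avg (F j) (\<lambda>t. \<Theta> t x)\<bar> \<partial>M) < \<epsilon>"
proof -
  have fin: "finite (F n)" "F n \<noteq> {}" for n
    using F by (auto simp: folner_seq_finite folner_seq_nonempty)
  define \<delta> where "\<delta> = \<epsilon> / 7"
  have "0 < \<delta>" using \<open>0 < \<epsilon>\<close> by (simp add: \<delta>_def)
  obtain c :: "'g \<Rightarrow> nat" where c: "finite (range c)"
    "\<And>s s' t. c s = c s' \<Longrightarrow> (\<integral>x. \<bar>\<Theta> (t + s) x - \<Theta> (t + s') x\<bar> \<partial>M) \<le> \<delta>"
    using ap[OF \<open>0 < \<delta>\<close>] by meson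
  obtain R where R: "finite R" "\<And>s. \<exists>r\<in>R. c s = c r"
    using finite_representatives[OF c(1)] by metis
  define A where "A = (\<lambda>n x. avg (F n) (\<lambda>t. \<Theta> t x))"
  define S where "S = (\<lambda>n t x. avg (F n) (\<lambda>s. \<Theta> (t + s) x))"
  have Am [measurable]: "A n \<in> borel_measurable M" for n unfolding A_def avg_def by measurable
  have Sm [measurable]: "S n t \<in> borel_measurable M" for n t unfolding S_def avg_def by measurable
  have AB: "\<bar>A n x\<bar> \<le> 1" for n x unfolding A_def by (rule avg_abs_le[OF fin B])
  have SB: "\<bar>S n t x\<bar> \<le> 1" for n t x unfolding S_def by (rule avg_abs_le[OF fin B])
  have int2: "integrable M (\<lambda>x. \<bar>f x - g x\<bar>)"
    if "f \<in> borel_measurable M" "g \<in> borel_measurable M" "\<And>x. \<bar>f x\<bar> \<le> 1" "\<And>x. \<bar>g x\<bar> \<le> 1" for f g :: "'a \<Rightarrow> real"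
  proof (rule integrable_bounded[where B=2])
    show "\<bar>\<bar>f x - g x\<bar>\<bar> \<le> 2" for x using that(3)[of x] that(4)[of x] by linarith
  qed (use that in measurable)
  have "\<forall>\<^sub>F m in sequentially. \<forall>r\<in>R. \<forall>x. \<bar>S m r x - A m x\<bar> \<le> \<delta>"
  proof (intro eventually_ball_finite[OF R(1)] ballI)
    fix r assume "r \<in> R"
    show "\<forall>\<^sub>F m in sequentially. \<forall>x. \<bar>S m r x - A m x\<bar> \<le> \<delta>"
      using folner_avg_translate[OF F \<open>0 < \<delta>\<close>, of 1 r]
    proof eventually_elim
      case (elim m)
      show ?case
      proof
        fix x show "\<bar>S m r x - A m x\<bar> \<le> \<delta>"
          unfolding S_def A_def using B by (intro elim[rule_format]) simp
      qed
    qed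
  qed
  then obtain m where m: "\<And>r x. r \<in> R \<Longrightarrow> \<bar>S m r x - A m x\<bar> \<le> \<delta>"
    unfolding eventually_sequentially by blast
  have uniform: "(\<integral>x. \<bar>S m t x - A m x\<bar> \<partial>M) \<le> 2 * \<delta>" for t
  proof -
    obtain r where r: "r \<in> R" "c t = c r" using R(2) by blast
    have i: "integrable M (\<lambda>x. \<bar>\<Theta> (s + t) x - \<Theta> (s + r) x\<bar>)" for s by (rule int2[OF _ _ B B]) auto
    have "(\<integral>x. \<bar>S m t x - A m x\<bar> \<partial>M) \<le> (\<integral>x. avg (F m) (\<lambda>s. \<bar>\<Theta> (s + t) x - \<Theta> (s + r) x\<bar>) + \<delta> \<partial>M)"
    proof (rule integral_mono)
      show "integrable M (\<lambda>x. \<bar>S m t x - A m x\<bar>)" by (rule int2[OF _ _ SB AB]) auto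
      show "integrable M (\<lambda>x. avg (F m) (\<lambda>s. \<bar>\<Theta> (s + t) x - \<Theta> (s + r) x\<bar>) + \<delta>)"
        unfolding avg_def using i by simp
      fix x
      have "S m t x - S m r x = avg (F m) (\<lambda>s. \<Theta> (s + t) x - \<Theta> (s + r) x)"
        unfolding S_def by (simp add: avg_diff add.commute)
      then have "\<bar>S m t x - S m r x\<bar> \<le> avg (F m) (\<lambda>s. \<bar>\<Theta> (s + t) x - \<Theta> (s + r) x\<bar>)"
        by (simp add: avg_abs)
      then show "\<bar>S m t x - A m x\<bar> \<le> avg (F m) (\<lambda>s. \<bar>\<Theta> (s + t) x - \<Theta> (s + r) x\<bar>) + \<delta>"
        using m[OF r(1), of x] by linarith
    qed
    also have "\<dots> = avg (F m) (\<lambda>s. \<integral>x. \<bar>\<Theta> (s + t) x - \<Theta> (s + r) x\<bar> \<partial>M) + \<delta>"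
      unfolding avg_def using i by (simp add: Bochner_Integration.integral_sum prob_space)
    also have "\<dots> \<le> \<delta> + \<delta>" using c(2)[OF r(2)] by (intro add_right_mono avg_le[OF fin]) auto
    finally show ?thesis by simp
  qed
  have "\<forall>\<^sub>F n in sequentially. \<forall>s\<in>F m. \<forall>x. \<bar>S n s x - A n x\<bar> \<le> \<delta>"
  proof (intro eventually_ball_finite[OF fin(1)] ballI)
    fix s
    show "\<forall>\<^sub>F n in sequentially. \<forall>x. \<bar>S n s x - A n x\<bar> \<le> \<delta>"
      using folner_avg_translate[OF F \<open>0 < \<delta>\<close>, of 1 s]
    proof eventually_elim
      case (elim n)
      show ?case
      proof
        fix x show "\<bar>S n s x - A n x\<bar> \<le> \<delta>"
          unfolding S_def A_def using B by (intro elim[rule_format]) simp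
      qed
    qed
  qed
  then obtain N where N: "\<And>n s x. n \<ge> N \<Longrightarrow> s \<in> F m \<Longrightarrow> \<bar>S n s x - A n x\<bar> \<le> \<delta>"
    unfolding eventually_sequentially by blast
  have near: "(\<integral>x. \<bar>A n x - A m x\<bar> \<partial>M) \<le> 3 * \<delta>" if "n \<ge> N" for n
  proof -
    have i: "integrable M (\<lambda>x. \<bar>S m t x - A m x\<bar>)" for t by (rule int2[OF _ _ SB AB]) auto
    have "(\<integral>x. \<bar>A n x - A m x\<bar> \<partial>M) \<le> (\<integral>x. \<delta> + avg (F n) (\<lambda>t. \<bar>S m t x - A m x\<bar>) \<partial>M)"
    proof (rule integral_mono)
      show "integrable M (\<lambda>x. \<bar>A n x - A m x\<bar>)" by (rule int2[OF _ _ AB AB]) auto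
      show "integrable M (\<lambda>x. \<delta> + avg (F n) (\<lambda>t. \<bar>S m t x - A m x\<bar>))"
        unfolding avg_def using i by simp
      fix x
      have "avg (F m) (\<lambda>s. S n s x) = avg (F n) (\<lambda>t. S m t x)"
        unfolding S_def by (subst avg_avg) (simp add: add.commute)
      moreover have "\<bar>avg (F m) (\<lambda>s. S n s x - A n x)\<bar> \<le> \<delta>"
        by (rule avg_abs_le[OF fin N[OF that]])
      then have "\<bar>avg (F m) (\<lambda>s. S n s x) - A n x\<bar> \<le> \<delta>" using fin by (simp add: avg_diff)
      moreover have "\<bar>avg (F n) (\<lambda>t. S m t x - A m x)\<bar> \<le> avg (F n) (\<lambda>t. \<bar>S m t x - A m x\<bar>)"
        by (rule avg_abs)
      then have "\<bar>avg (F n) (\<lambda>t. S m t x) - A m x\<bar> \<le> avg (F n) (\<lambda>t. \<bar>S m t x - A m x\<bar>)"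
        using fin by (simp add: avg_diff)
      ultimately show "\<bar>A n x - A m x\<bar> \<le> \<delta> + avg (F n) (\<lambda>t. \<bar>S m t x - A m x\<bar>)" by linarith
    qed
    also have "\<dots> = \<delta> + avg (F n) (\<lambda>t. \<integral>x. \<bar>S m t x - A m x\<bar> \<partial>M)"
      unfolding avg_def using i by (simp add: Bochner_Integration.integral_sum prob_space)
    also have "\<dots> \<le> \<delta> + 2 * \<delta>" by (intro add_left_mono avg_le[OF fin] uniform)
    finally show ?thesis by simp
  qed
  have "(\<integral>x. \<bar>A i x - A j x\<bar> \<partial>M) < \<epsilon>" if "i \<ge> N" "j \<ge> N" for i j
  proof -
    have i: "integrable M (\<lambda>x. \<bar>A n x - A m x\<bar>)" for n by (rule int2[OF _ _ AB AB]) auto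
    have "(\<integral>x. \<bar>A i x - A j x\<bar> \<partial>M) \<le> (\<integral>x. \<bar>A i x - A m x\<bar> + \<bar>A j x - A m x\<bar> \<partial>M)"
    proof (rule integral_mono)
      show "integrable M (\<lambda>x. \<bar>A i x - A j x\<bar>)" by (rule int2[OF _ _ AB AB]) auto
    qed (use i in auto)
    also have "\<dots> = (\<integral>x. \<bar>A i x - A m x\<bar> \<partial>M) + (\<integral>x. \<bar>A j x - A m x\<bar> \<partial>M)" using i by simp
    also have "\<dots> \<le> 6 * \<delta>" using near[OF that(1)] near[OF that(2)] by linarith
    also have "\<dots> < \<epsilon>" using \<open>0 < \<epsilon>\<close> by (simp add: \<delta>_def)
    finally show ?thesis .
  qed
  then show ?thesis unfolding A_def by blast
qed

text \<open>
Total boundedness in \<open>L\<^sup>1\<close> is improved to total boundedness in the supremum norm, for a function close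
to \<open>f\<close>. Let \<open>d s t\<close> be the \<open>L\<^sup>1\<close> distance of the translates of \<open>f\<close>, and let \<open>\<kappa>\<close> be a Lipschitz bump on
the group supported where \<open>d t 0 < \<delta>\<close>. The weighted mean \<open>g x\<close> of \<open>f (T t x)\<close> with weights \<open>\<kappa> t\<close>
differs from \<open>f\<close> by at most \<open>\<delta>\<close> in \<open>L\<^sup>1\<close>. Translating \<open>g\<close> amounts to translating \<open>\<kappa>\<close>, and the translates
of \<open>\<kappa>\<close> are uniformly close when \<open>d\<close> is small, whatever the point \<open>x\<close>.
\<close>
theorem almost_periodic_uniform_approximation:
  fixes F :: "nat \<Rightarrow> 'g set"
  assumes cnt: "countable (UNIV :: 'g set)" and F: "folner_seq F"
    and f: "almost_periodic f" and fB: "\<And>x. \<bar>f x\<bar> \<le> 1" and "0 < \<delta>"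
  shows "\<exists>g\<in>borel_measurable M. (\<forall>x. \<bar>g x\<bar> \<le> 1) \<and> (\<integral>x. \<bar>f x - g x\<bar> \<partial>M) \<le> \<delta> \<and>
           (\<forall>\<eta>>0. \<exists>c :: 'g \<Rightarrow> nat. finite (range c) \<and>
              (\<forall>s t x. c s = c t \<longrightarrow> \<bar>g (T s x) - g (T t x)\<bar> \<le> \<eta>))"
proof -
  have fin: "finite (F n)" "F n \<noteq> {}" for n
    using F by (auto simp: folner_seq_finite folner_seq_nonempty)
  have fm [measurable]: "f \<in> borel_measurable M" by (rule almost_periodic_measurable[OF f])
  define d where "d = (\<lambda>s t. \<integral>x. \<bar>f (T s x) - f (T t x)\<bar> \<partial>M)"
  have id: "integrable M (\<lambda>x. \<bar>f (T s x) - f (T t x)\<bar>)" for s t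
    by (rule almost_periodic_orbit_integrable[OF f])
  have d_shift: "d (s + r) (t + r) = d s t" for s t r
    unfolding d_def using integral_T[of "\<lambda>x. \<bar>f (T s x) - f (T t x)\<bar>" r] by (simp add: T_add)
  have d_sym: "d s t = d t s" for s t unfolding d_def by (simp add: abs_minus_commute)
  have d_nonneg: "0 \<le> d s t" for s t unfolding d_def by simp
  have d_tri: "d s t \<le> d s r + d r t" for s r t
  proof -
    have "d s t \<le> (\<integral>x. \<bar>f (T s x) - f (T r x)\<bar> + \<bar>f (T r x) - f (T t x)\<bar> \<partial>M)"
      unfolding d_def using id by (intro integral_mono) auto
    then show ?thesis using id by (simp add: d_def)
  qed
  define \<kappa> where "\<kappa> = (\<lambda>t. max 0 (1 - d t 0 / \<delta>))"
  have \<kappa>01: "0 \<le> \<kappa> t" "\<kappa> t \<le> 1" for t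
    using d_nonneg[of t 0] \<open>0 < \<delta>\<close> unfolding \<kappa>_def by auto
  have \<kappa>_lip: "\<bar>\<kappa> s - \<kappa> t\<bar> \<le> d s t / \<delta>" for s t
  proof -
    have "\<bar>d s 0 - d t 0\<bar> \<le> d s t"
      using d_tri[of s 0 t] d_tri[of t 0 s] d_sym[of s t] by linarith
    then have "\<bar>d s 0 / \<delta> - d t 0 / \<delta>\<bar> \<le> d s t / \<delta>"
      using \<open>0 < \<delta>\<close> by (simp add: diff_divide_distrib[symmetric] divide_right_mono)
    then show ?thesis unfolding \<kappa>_def by linarith
  qed
  have colour: "\<exists>c :: 'g \<Rightarrow> nat. finite (range c) \<and> (\<forall>s t. c s = c t \<longrightarrow> d s t < \<epsilon>)" if "0 < \<epsilon>" for \<epsilon>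
    using f that unfolding almost_periodic_def d_def by blast
  define \<alpha> where "\<alpha> = (\<lambda>n. avg (F n) \<kappa>)"
  have \<alpha>01: "0 \<le> \<alpha> n" "\<alpha> n \<le> 1" for n
    unfolding \<alpha>_def using \<kappa>01 by (auto intro: avg_nonneg avg_le[OF fin])
  define A where "A = (\<lambda>n x. avg (F n) (\<lambda>t. \<kappa> t * f (T t x)))"
  have Am [measurable]: "A n \<in> borel_measurable M" for n unfolding A_def avg_def by measurable
  have \<kappa>f: "\<bar>\<kappa> t * f y\<bar> \<le> \<kappa> t" for t y
    using mult_left_mono[OF fB[of y] \<kappa>01(1)[of t]] \<kappa>01(1)[of t] by (simp add: abs_mult)
  have A\<alpha>: "\<bar>A n x\<bar> \<le> \<alpha> n" for n x
    unfolding A_def \<alpha>_def by (rule order_trans[OF avg_abs avg_mono]) (rule \<kappa>f)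
  have AB: "\<bar>A n x\<bar> \<le> 1" for n x using A\<alpha>[of n x] \<alpha>01(2)[of n] by linarith
  \<comment> \<open>Finitely many translates of the set where \<open>\<kappa> \<ge> 1 / 2\<close> cover the group.\<close>
  obtain c\<^sub>0 where "0 < c\<^sub>0" and \<alpha>_low: "\<forall>\<^sub>F n in sequentially. c\<^sub>0 \<le> \<alpha> n"
  proof -
    obtain c :: "'g \<Rightarrow> nat" where c: "finite (range c)" "\<And>s t. c s = c t \<Longrightarrow> d s t < \<delta> / 2"
      using colour[of "\<delta> / 2"] \<open>0 < \<delta>\<close> by auto
    obtain R where R: "finite R" "\<And>s. \<exists>r\<in>R. c s = c r"
      using finite_representatives[OF c(1)] by metis
    have "R \<noteq> {}" using R(2) by blast
    then have cR: "0 < real (card R)" using R(1) by (simp add: card_gt_0_iff)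
    have half: "1 / 2 \<le> (\<Sum>r\<in>R. \<kappa> (- r + s))" for s
    proof -
      obtain r where r: "r \<in> R" "c s = c r" using R(2) by blast
      have "d (- r + s) 0 = d s r" using d_shift[of s "- r" r] by (simp add: add.commute)
      then have "d (- r + s) 0 / \<delta> < 1 / 2"
        using c(2)[OF r(2)] \<open>0 < \<delta>\<close> by (simp add: divide_less_eq)
      then have "1 / 2 \<le> \<kappa> (- r + s)" unfolding \<kappa>_def by linarith
      also have "\<dots> \<le> (\<Sum>r\<in>R. \<kappa> (- r + s))" using R(1) r(1) \<kappa>01 by (intro member_le_sum) auto
      finally show ?thesis .
    qed
    define e where "e = 1 / (4 * real (card R))"
    have "0 < e" using cR by (simp add: e_def)
    have "\<forall>\<^sub>F n in sequentially. \<forall>r\<in>R. \<bar>avg (F n) (\<lambda>s. \<kappa> (- r + s)) - \<alpha> n\<bar> \<le> e"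
    proof (intro eventually_ball_finite[OF R(1)] ballI)
      fix r
      show "\<forall>\<^sub>F n in sequentially. \<bar>avg (F n) (\<lambda>s. \<kappa> (- r + s)) - \<alpha> n\<bar> \<le> e"
        using folner_avg_translate[OF F \<open>0 < e\<close>, of 1 "- r"]
      proof eventually_elim
        case (elim n)
        show ?case unfolding \<alpha>_def by (rule elim[rule_format]) (use \<kappa>01 in auto)
      qed
    qed
    then have "\<forall>\<^sub>F n in sequentially. e \<le> \<alpha> n"
    proof eventually_elim
      case (elim n)
      have "1 / 2 = avg (F n) (\<lambda>s. 1 / 2)" using fin by simp
      also have "\<dots> \<le> avg (F n) (\<lambda>s. \<Sum>r\<in>R. \<kappa> (- r + s))" by (intro avg_mono half)
      also have "\<dots> = (\<Sum>r\<in>R. avg (F n) (\<lambda>s. \<kappa> (- r + s)))" by (rule avg_sum)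
      also have "\<dots> \<le> (\<Sum>r\<in>R. \<alpha> n + e)" by (intro sum_mono) (use elim in \<open>force simp: abs_le_iff\<close>)
      also have "\<dots> = real (card R) * \<alpha> n + 1 / 4" using cR by (simp add: e_def algebra_simps)
      finally have "1 / 4 \<le> real (card R) * \<alpha> n" by simp
      then show ?case using cR by (simp add: e_def divide_le_eq mult.commute mult.left_commute)
    qed
    with \<open>0 < e\<close> that show thesis by blast
  qed
  have Cauchy\<kappa>: "Cauchy \<alpha>"
  proof (rule CauchyI')
    fix e :: real assume "0 < e"
    have "\<exists>N. \<forall>i\<ge>N. \<forall>j\<ge>N. (\<integral>x. \<bar>avg (F i) (\<lambda>t. \<kappa> t) - avg (F j) (\<lambda>t. \<kappa> t)\<bar> \<partial>M) < e"
    proof (rule bohr_mean_L1_Cauchy[OF F])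
      fix \<epsilon> :: real assume "0 < \<epsilon>"
      then obtain c :: "'g \<Rightarrow> nat" where c: "finite (range c)" "\<And>s t. c s = c t \<Longrightarrow> d s t < \<epsilon> * \<delta>"
        using colour[of "\<epsilon> * \<delta>"] \<open>0 < \<delta>\<close> by auto
      have "\<bar>\<kappa> (t + s) - \<kappa> (t + s')\<bar> \<le> \<epsilon>" if "c s = c s'" for s s' t
      proof -
        have "d (t + s) (t + s') \<le> \<epsilon> * \<delta>" using d_shift[of s t s'] c(2)[OF that] by (simp add: add.commute)
        then have "d (t + s) (t + s') / \<delta> \<le> \<epsilon>" using \<open>0 < \<delta>\<close> by (simp add: divide_le_eq)
        then show ?thesis using \<kappa>_lip[of "t + s" "t + s'"] by linarith
      qed
      then show "\<exists>c :: 'g \<Rightarrow> nat. finite (range c) \<and>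
         (\<forall>s s' t. c s = c s' \<longrightarrow> (\<integral>x. \<bar>\<kappa> (t + s) - \<kappa> (t + s')\<bar> \<partial>M) \<le> \<epsilon>)"
        using c(1) by (intro exI[of _ c]) (simp add: prob_space)
    qed (use \<kappa>01 \<open>0 < e\<close> in auto)
    then show "\<exists>N. \<forall>i\<ge>N. \<forall>j>i. dist (\<alpha> i) (\<alpha> j) < e"
      unfolding \<alpha>_def dist_real_def by (auto simp: prob_space) (meson less_imp_le order_trans)
  qed
  have CauchyA: "\<exists>N. \<forall>i\<ge>N. \<forall>j\<ge>N. (\<integral>x. \<bar>A i x - A j x\<bar> \<partial>M) < e" if "0 < e" for e
    unfolding A_def
  proof (rule bohr_mean_L1_Cauchy[OF F _ _ _ that])
    show "(\<lambda>x. \<kappa> t * f (T t x)) \<in> borel_measurable M" for t by measurable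
    show "\<bar>\<kappa> t * f (T t x)\<bar> \<le> 1" for t x using \<kappa>f[of t "T t x"] \<kappa>01(2)[of t] by linarith
    fix \<epsilon> :: real assume "0 < \<epsilon>"
    define e' where "e' = \<epsilon> / (1 / \<delta> + 1)"
    have "0 < e'" using \<open>0 < \<epsilon>\<close> \<open>0 < \<delta>\<close> by (simp add: e'_def add_pos_pos)
    obtain c :: "'g \<Rightarrow> nat" where c: "finite (range c)" "\<And>s t. c s = c t \<Longrightarrow> d s t < e'"
      using colour[OF \<open>0 < e'\<close>] by auto
    have "(\<integral>x. \<bar>\<kappa> (t + s) * f (T (t + s) x) - \<kappa> (t + s') * f (T (t + s') x)\<bar> \<partial>M) \<le> \<epsilon>"
      if "c s = c s'" for s s' t
    proof -
      let ?a = "t + s" and ?b = "t + s'"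
      have dab: "d ?a ?b < e'" using d_shift[of s t s'] c(2)[OF that] by (simp add: add.commute)
      have pt: "\<bar>\<kappa> ?a * f (T ?a x) - \<kappa> ?b * f (T ?b x)\<bar> \<le> \<bar>\<kappa> ?a - \<kappa> ?b\<bar> + \<bar>f (T ?a x) - f (T ?b x)\<bar>" for x
      proof -
        have "\<kappa> ?a * f (T ?a x) - \<kappa> ?b * f (T ?b x) = (\<kappa> ?a - \<kappa> ?b) * f (T ?a x) + \<kappa> ?b * (f (T ?a x) - f (T ?b x))"
          by (simp add: algebra_simps)
        also have "\<bar>\<dots>\<bar> \<le> \<bar>\<kappa> ?a - \<kappa> ?b\<bar> * \<bar>f (T ?a x)\<bar> + \<bar>\<kappa> ?b\<bar> * \<bar>f (T ?a x) - f (T ?b x)\<bar>"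
          by (metis abs_mult abs_triangle_ineq)
        also have "\<dots> \<le> \<bar>\<kappa> ?a - \<kappa> ?b\<bar> * 1 + 1 * \<bar>f (T ?a x) - f (T ?b x)\<bar>"
          using fB \<kappa>01 by (intro add_mono mult_left_mono mult_right_mono) auto
        finally show ?thesis by simp
      qed
      have bd: "\<bar>\<bar>\<kappa> ?a * f y - \<kappa> ?b * f z\<bar>\<bar> \<le> 2" for y z
        using \<kappa>f[of ?a y] \<kappa>f[of ?b z] \<kappa>01(2)[of ?a] \<kappa>01(2)[of ?b] by linarith
      have "(\<integral>x. \<bar>\<kappa> ?a * f (T ?a x) - \<kappa> ?b * f (T ?b x)\<bar> \<partial>M)
          \<le> (\<integral>x. \<bar>\<kappa> ?a - \<kappa> ?b\<bar> + \<bar>f (T ?a x) - f (T ?b x)\<bar> \<partial>M)"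
      proof (rule integral_mono[OF _ _ pt])
        show "integrable M (\<lambda>x. \<bar>\<kappa> ?a * f (T ?a x) - \<kappa> ?b * f (T ?b x)\<bar>)"
          by (rule integrable_bounded[OF _ bd]) measurable
      qed (use id in auto)
      also have "\<dots> = \<bar>\<kappa> ?a - \<kappa> ?b\<bar> + d ?a ?b" using id by (simp add: prob_space d_def)
      also have "\<dots> \<le> d ?a ?b / \<delta> + d ?a ?b" using \<kappa>_lip by (intro add_right_mono)
      also have "\<dots> = d ?a ?b * (1 / \<delta> + 1)" by (simp add: algebra_simps)
      also have "\<dots> \<le> e' * (1 / \<delta> + 1)" using dab \<open>0 < \<delta>\<close> by (intro mult_right_mono) auto
      also have "\<dots> = \<epsilon>" using \<open>0 < \<delta>\<close> by (simp add: e'_def add_pos_pos less_imp_neq[symmetric])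
      finally show ?thesis .
    qed
    then show "\<exists>c :: 'g \<Rightarrow> nat. finite (range c) \<and>
        (\<forall>s s' t. c s = c s' \<longrightarrow> (\<integral>x. \<bar>\<kappa> (t + s) * f (T (t + s) x) - \<kappa> (t + s') * f (T (t + s') x)\<bar> \<partial>M) \<le> \<epsilon>)"
      using c(1) by (intro exI[of _ c]) auto
  qed
  obtain a where \<alpha>_lim: "\<alpha> \<longlonglongrightarrow> a" using Cauchy\<kappa> by (auto simp: Cauchy_convergent_iff convergent_def)
  have "c\<^sub>0 \<le> a" by (rule tendsto_lowerbound[OF \<alpha>_lim \<alpha>_low]) simp
  then have "0 < a" using \<open>0 < c\<^sub>0\<close> by linarith
  have "a \<le> 1" by (rule tendsto_upperbound[OF \<alpha>_lim]) (use \<alpha>01 in auto)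
  have iA: "integrable M (A n)" for n by (rule integrable_bounded[OF Am AB])
  obtain r where r: "strict_mono r" and aeC: "AE x in M. Cauchy (\<lambda>j. A (r j) x)"
    using cauchy_L1_AE_cauchy_subseq[of M A] iA CauchyA by auto
  \<comment> \<open>The limit is taken on an invariant set, so that the Lipschitz bound below holds at all points.\<close>
  define X where "X = {x. \<forall>s. Cauchy (\<lambda>j. A (r j) (T s x))}"
  have Xm [measurable]: "X \<in> sets M"
  proof -
    have "{x \<in> space M. Cauchy (\<lambda>j. A (r j) (T s x))} \<in> sets M" for s by measurable
    then have "(\<Inter>s. {x \<in> space M. Cauchy (\<lambda>j. A (r j) (T s x))}) \<in> sets M"
      by (intro sets.countable_INT' cnt) auto
    moreover have "X = (\<Inter>s. {x \<in> space M. Cauchy (\<lambda>j. A (r j) (T s x))})"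
      by (auto simp: X_def space_UNIV)
    ultimately show ?thesis by simp
  qed
  have aeX: "AE x in M. x \<in> X"
  proof -
    have "AE x in M. \<forall>s\<in>UNIV. Cauchy (\<lambda>j. A (r j) (T s x))"
      by (subst AE_ball_countable[OF cnt]) (use AE_T[OF aeC] in blast)
    then show ?thesis by (simp add: X_def)
  qed
  have X_inv: "T s x \<in> X \<longleftrightarrow> x \<in> X" for s x
  proof
    assume "x \<in> X" then show "T s x \<in> X" unfolding X_def by (simp add: T_add[symmetric])
  next
    assume *: "T s x \<in> X"
    have "Cauchy (\<lambda>j. A (r j) (T t x))" for t
    proof -
      have "T t x = T (t - s) (T s x)" by (simp add: T_add[symmetric])
      then show ?thesis using * unfolding X_def by simp
    qed
    then show "x \<in> X" unfolding X_def by simp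
  qed
  define L where "L = (\<lambda>x. if x \<in> X then lim (\<lambda>j. A (r j) x) else 0)"
  have Lm [measurable]: "L \<in> borel_measurable M" unfolding L_def by measurable
  have L_lim: "(\<lambda>j. A (r j) x) \<longlonglongrightarrow> L x" if "x \<in> X" for x
  proof -
    have "Cauchy (\<lambda>j. A (r j) (T 0 x))" using that unfolding X_def by blast
    then show ?thesis using that unfolding L_def by (simp add: T_zero convergent_LIMSEQ_iff Cauchy_convergent_iff)
  qed
  have La: "\<bar>L x\<bar> \<le> a" for x
  proof (cases "x \<in> X")
    case True
    have "(\<lambda>j. \<alpha> (r j)) \<longlonglongrightarrow> a" using LIMSEQ_subseq_LIMSEQ[OF \<alpha>_lim r] by (simp add: o_def)
    then show ?thesis using A\<alpha> by (intro tendsto_le[OF _ _ tendsto_rabs[OF L_lim[OF True]]]) auto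
  next
    case False then show ?thesis using \<open>0 < a\<close> by (simp add: L_def)
  qed
  then have LB: "\<bar>L x\<bar> \<le> 1" for x using \<open>a \<le> 1\<close> order_trans by blast
  have A_L: "(\<lambda>n. \<integral>x. \<bar>A n x - L x\<bar> \<partial>M) \<longlonglongrightarrow> 0"
  proof (rule L1_Cauchy_AE_subseq_tendsto[where B=1 and r=r])
    show "AE x in M. (\<lambda>j. A (r j) x) \<longlonglongrightarrow> L x" using aeX by eventually_elim (rule L_lim)
  qed (use AB LB CauchyA r in auto)
  have L_lip: "\<bar>L (T s x) - L (T t x)\<bar> \<le> d s t / \<delta>" for s t x
  proof (cases "x \<in> X")
    case False then show ?thesis using X_inv d_nonneg \<open>0 < \<delta>\<close> by (simp add: L_def)
  next
    case True
    have ev: "\<forall>\<^sub>F n in sequentially. \<bar>A n (T s x) - A n (T t x)\<bar> \<le> d s t / \<delta> + 2 * e" if "0 < e" for e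
    proof -
      have sh: "\<forall>\<^sub>F n in sequentially. \<bar>A n (T q x) - avg (F n) (\<lambda>t. \<kappa> (t - q) * f (T t x))\<bar> \<le> e" for q
        using folner_avg_translate[OF F \<open>0 < e\<close>, of 1 q]
      proof eventually_elim
        case (elim n)
        have b: "\<bar>\<kappa> (t - q) * f (T t x)\<bar> \<le> 1" for t
          using \<kappa>f[of "t - q" "T t x"] \<kappa>01(2)[of "t - q"] by linarith
        have "A n (T q x) = avg (F n) (\<lambda>t. \<kappa> (q + t - q) * f (T (q + t) x))"
          unfolding A_def by (simp add: T_add[symmetric] add.commute)
        then show ?case using elim[rule_format, of "\<lambda>t. \<kappa> (t - q) * f (T t x)"] b by simp
      qed
      show ?thesis
        using sh[of s] sh[of t]
      proof eventually_elim
        case (elim n)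
        let ?W = "\<lambda>q r. \<kappa> (r - q) * f (T r x)"
        have "\<bar>avg (F n) (\<lambda>r. ?W s r - ?W t r)\<bar> \<le> d s t / \<delta>"
        proof (rule avg_abs_le[OF fin])
          fix r
          have "\<bar>?W s r - ?W t r\<bar> = \<bar>\<kappa> (r - s) - \<kappa> (r - t)\<bar> * \<bar>f (T r x)\<bar>"
            by (simp flip: abs_mult add: left_diff_distrib)
          also have "\<dots> \<le> \<bar>\<kappa> (r - s) - \<kappa> (r - t)\<bar>" using mult_left_mono[OF fB, of "\<bar>\<kappa> (r - s) - \<kappa> (r - t)\<bar>"] by simp
          also have "\<dots> \<le> d (r - s) (r - t) / \<delta>" by (rule \<kappa>_lip)
          also have "d (r - s) (r - t) = d s t"
            using d_shift[of "r - s" "s + t - r" "r - t"] d_sym[of t s] by (simp add: algebra_simps)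
          finally show "\<bar>?W s r - ?W t r\<bar> \<le> d s t / \<delta>" .
        qed
        then show ?case using elim unfolding avg_diff by linarith
      qed
    qed
    have lim2: "(\<lambda>j. \<bar>A (r j) (T s x) - A (r j) (T t x)\<bar>) \<longlonglongrightarrow> \<bar>L (T s x) - L (T t x)\<bar>"
      using True X_inv by (intro tendsto_intros L_lim) auto
    show ?thesis
    proof (rule field_le_epsilon)
      fix e :: real assume "0 < e"
      then have "\<forall>\<^sub>F n in sequentially. \<bar>A n (T s x) - A n (T t x)\<bar> \<le> d s t / \<delta> + 2 * (e / 2)"
        by (intro ev) simp
      then have "\<forall>\<^sub>F j in sequentially. \<bar>A (r j) (T s x) - A (r j) (T t x)\<bar> \<le> d s t / \<delta> + 2 * (e / 2)"
        by (rule eventually_subseq[OF r])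
      from tendsto_upperbound[OF lim2 this] show "\<bar>L (T s x) - L (T t x)\<bar> \<le> d s t / \<delta> + e" by simp
    qed
  qed
  have Lf: "(\<integral>x. \<bar>a * f x - L x\<bar> \<partial>M) \<le> \<delta> * a"
  proof -
    have "(\<integral>x. \<bar>a * f x - L x\<bar> \<partial>M) \<le> \<bar>a - \<alpha> n\<bar> + \<delta> * \<alpha> n + (\<integral>x. \<bar>A n x - L x\<bar> \<partial>M)" for n
    proof -
      have i1: "integrable M (\<lambda>x. \<bar>A n x - L x\<bar>)"
      proof (rule integrable_bounded[where B=2])
        show "\<bar>\<bar>A n x - L x\<bar>\<bar> \<le> 2" for x using AB[of n x] LB[of x] by linarith
      qed measurable
      have i2: "integrable M (\<lambda>x. \<bar>f (T t x) - f x\<bar>)" for t using id[of t 0] by (simp add: T_zero)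
      have "(\<integral>x. \<bar>a * f x - L x\<bar> \<partial>M)
          \<le> (\<integral>x. \<bar>a - \<alpha> n\<bar> + avg (F n) (\<lambda>t. \<kappa> t * \<bar>f (T t x) - f x\<bar>) + \<bar>A n x - L x\<bar> \<partial>M)"
      proof (rule integral_mono)
        show "integrable M (\<lambda>x. \<bar>a * f x - L x\<bar>)"
        proof (rule integrable_bounded[where B=2])
          show "\<bar>\<bar>a * f x - L x\<bar>\<bar> \<le> 2" for x
          proof -
            have "\<bar>a * f x\<bar> \<le> 1 * 1" unfolding abs_mult
              using \<open>0 < a\<close> \<open>a \<le> 1\<close> fB[of x] by (intro mult_mono) auto
            then show ?thesis using LB[of x] by linarith
          qed
        qed measurable
        show "integrable M (\<lambda>x. \<bar>a - \<alpha> n\<bar> + avg (F n) (\<lambda>t. \<kappa> t * \<bar>f (T t x) - f x\<bar>) + \<bar>A n x - L x\<bar>)"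
          unfolding avg_def using i1 i2 by simp
        fix x
        have "\<bar>a * f x - \<alpha> n * f x\<bar> \<le> \<bar>a - \<alpha> n\<bar>"
          using mult_left_mono[OF fB[of x], of "\<bar>a - \<alpha> n\<bar>"] by (simp flip: abs_mult add: left_diff_distrib)
        moreover have "A n x - \<alpha> n * f x = avg (F n) (\<lambda>t. \<kappa> t * (f (T t x) - f x))"
          unfolding A_def \<alpha>_def by (simp add: avg_diff right_diff_distrib avg_mult_right)
        then have "\<bar>A n x - \<alpha> n * f x\<bar> \<le> avg (F n) (\<lambda>t. \<kappa> t * \<bar>f (T t x) - f x\<bar>)"
          using avg_abs[of "F n" "\<lambda>t. \<kappa> t * (f (T t x) - f x)"] \<kappa>01(1) by (simp add: abs_mult)
        ultimately show "\<bar>a * f x - L x\<bar> \<le> \<bar>a - \<alpha> n\<bar> + avg (F n) (\<lambda>t. \<kappa> t * \<bar>f (T t x) - f x\<bar>) + \<bar>A n x - L x\<bar>"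
          by linarith
      qed
      also have "\<dots> = \<bar>a - \<alpha> n\<bar> + avg (F n) (\<lambda>t. \<kappa> t * d t 0) + (\<integral>x. \<bar>A n x - L x\<bar> \<partial>M)"
        unfolding avg_def d_def T_zero using i1 i2 by (simp add: Bochner_Integration.integral_sum prob_space)
      also have "avg (F n) (\<lambda>t. \<kappa> t * d t 0) \<le> avg (F n) (\<lambda>t. \<delta> * \<kappa> t)"
      proof (rule avg_mono)
        fix t
        show "\<kappa> t * d t 0 \<le> \<delta> * \<kappa> t"
        proof (cases "d t 0 \<le> \<delta>")
          case True then show ?thesis using mult_left_mono[OF True \<kappa>01(1)[of t]] by (simp add: mult.commute)
        next
          case False then show ?thesis using \<open>0 < \<delta>\<close> by (simp add: \<kappa>_def max_def divide_simps)
        qed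
      qed
      also have "avg (F n) (\<lambda>t. \<delta> * \<kappa> t) = \<delta> * \<alpha> n" by (simp add: avg_cmult \<alpha>_def)
      finally show ?thesis by simp
    qed
    moreover have "(\<lambda>n. \<bar>a - \<alpha> n\<bar> + \<delta> * \<alpha> n + (\<integral>x. \<bar>A n x - L x\<bar> \<partial>M)) \<longlonglongrightarrow> \<bar>a - a\<bar> + \<delta> * a + 0"
      by (intro tendsto_intros \<alpha>_lim A_L)
    ultimately show ?thesis by (intro tendsto_lowerbound[of _ "\<delta> * a"]) auto
  qed
  define g where "g = (\<lambda>x. L x / a)"
  have "g \<in> borel_measurable M" unfolding g_def by measurable
  moreover have "\<bar>g x\<bar> \<le> 1" for x using La[of x] \<open>0 < a\<close> by (simp add: g_def)
  moreover have "(\<integral>x. \<bar>f x - g x\<bar> \<partial>M) \<le> \<delta>"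
  proof -
    have "\<bar>f x - g x\<bar> = \<bar>a * f x - L x\<bar> / a" for x
      using \<open>0 < a\<close> by (simp add: g_def abs_div_pos[symmetric] field_simps)
    then show ?thesis using Lf \<open>0 < a\<close> by (simp add: divide_le_eq)
  qed
  moreover have "\<exists>c :: 'g \<Rightarrow> nat. finite (range c) \<and> (\<forall>s t x. c s = c t \<longrightarrow> \<bar>g (T s x) - g (T t x)\<bar> \<le> \<eta>)"
    if "0 < \<eta>" for \<eta>
  proof -
    have p: "0 < \<eta> * a * \<delta>" using that \<open>0 < a\<close> \<open>0 < \<delta>\<close> by simp
    obtain c :: "'g \<Rightarrow> nat" where c: "finite (range c)" "\<And>s t. c s = c t \<Longrightarrow> d s t < \<eta> * a * \<delta>"
      using colour[OF p] by auto
    have "\<bar>g (T s x) - g (T t x)\<bar> \<le> \<eta>" if "c s = c t" for s t x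
    proof -
      have "\<bar>g (T s x) - g (T t x)\<bar> = \<bar>L (T s x) - L (T t x)\<bar> / a"
        using \<open>0 < a\<close> by (simp add: g_def diff_divide_distrib[symmetric])
      also have "\<dots> \<le> d s t / \<delta> / a" using L_lip \<open>0 < a\<close> by (intro divide_right_mono) auto
      also have "\<dots> \<le> \<eta>" using c(2)[OF that] \<open>0 < a\<close> \<open>0 < \<delta>\<close> by (simp add: divide_le_eq mult.assoc mult.left_commute mult.commute)
      finally show ?thesis .
    qed
    then show ?thesis using c(1) by blast
  qed
  ultimately show ?thesis by (intro bexI[of _ g]) auto
qed

end

section \<open>Sequence entropy and the Kronecker algebra\<close>

definition block :: "'x set set \<Rightarrow> 'x \<Rightarrow> 'x set" where
  "block P x = (THE A. A \<in> P \<and> x \<in> A)"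

lemma block_eq: "partition_on UNIV P \<Longrightarrow> A \<in> P \<Longrightarrow> x \<in> A \<Longrightarrow> block P x = A"
  unfolding block_def partition_on_def disjoint_def by (intro the_equality) auto

lemma block_in: "partition_on UNIV P \<Longrightarrow> block P x \<in> P \<and> x \<in> block P x"
proof -
  assume P: "partition_on UNIV P"
  then obtain A where "A \<in> P" "x \<in> A" unfolding partition_on_def by blast
  with block_eq[OF P this] show ?thesis by simp
qed

lemma block_eq_iff: "partition_on UNIV P \<Longrightarrow> block P x = block P y \<longleftrightarrow> y \<in> block P x"
  using block_in block_eq by metis

text \<open>
The block of the common refinement of \<open>S\<close> that contains \<open>x\<close>. Describing a partition by the map that
sends a point to its block turns entropies of refinements into entropies of random variables.
\<close>
definition cell :: "'x set set set \<Rightarrow> 'x \<Rightarrow> 'x set" where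
  "cell S x = (\<Inter>P\<in>S. block P x)"

lemma cell_insert: "cell (insert P S) x = block P x \<inter> cell S x"
  by (simp add: cell_def)

context
  fixes S :: "'x set set set"
  assumes S: "\<And>P. P \<in> S \<Longrightarrow> partition_on UNIV P"
begin

lemma cell_self: "x \<in> cell S x"
  using block_in[OF S] by (simp add: cell_def)

lemma cell_eq_iff: "cell S x = cell S y \<longleftrightarrow> y \<in> cell S x"
proof
  assume "cell S x = cell S y" then show "y \<in> cell S x" using cell_self by simp
next
  assume "y \<in> cell S x"
  then have "block P x = block P y" if "P \<in> S" for P
    using that S by (simp add: cell_def block_eq_iff)
  then show "cell S x = cell S y" by (simp add: cell_def)
qed

lemma cell_vimage: "cell S -` {cell S y} = cell S y"
proof (rule set_eqI)
  fix x
  show "x \<in> cell S -` {cell S y} \<longleftrightarrow> x \<in> cell S y"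
    using cell_eq_iff[of y x] by auto
qed

lemma common_refinement_eq_range_cell: "common_refinement S = range (cell S)"
proof
  show "common_refinement S \<subseteq> range (cell S)"
  proof
    fix D assume "D \<in> common_refinement S"
    then obtain f where f: "f \<in> (\<Pi>\<^sub>E P\<in>S. P)" "D = \<Inter> (f ` S)" "D \<noteq> {}"
      unfolding common_refinement_def by auto
    then obtain x where x: "x \<in> D" by blast
    have "block P x = f P" if "P \<in> S" for P
      using that f x S by (intro block_eq) auto
    then have "cell S x = D" unfolding cell_def f(2) by simp
    then show "D \<in> range (cell S)" by blast
  qed
  show "range (cell S) \<subseteq> common_refinement S"
  proof safe
    fix x
    have "(\<lambda>P\<in>S. block P x) \<in> (\<Pi>\<^sub>E P\<in>S. P)" using block_in S by fastforce
    moreover have "cell S x = \<Inter> ((\<lambda>P\<in>S. block P x) ` S)" unfolding cell_def by (simp cong: image_cong)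
    moreover have "cell S x \<noteq> {}" using cell_self by blast
    ultimately show "cell S x \<in> common_refinement S"
      unfolding common_refinement_def by blast
  qed
qed

lemma finite_range_cell:
  assumes "finite S" and "\<And>P. P \<in> S \<Longrightarrow> finite P"
  shows "finite (range (cell S))"
proof -
  have "range (cell S) \<subseteq> (\<lambda>f. \<Inter> (f ` S)) ` (\<Pi>\<^sub>E P\<in>S. P)"
  proof safe
    fix x
    have "(\<lambda>P\<in>S. block P x) \<in> (\<Pi>\<^sub>E P\<in>S. P)" using block_in S by fastforce
    moreover have "cell S x = \<Inter> ((\<lambda>P\<in>S. block P x) ` S)" unfolding cell_def by (simp cong: image_cong)
    ultimately show "cell S x \<in> (\<lambda>f. \<Inter> (f ` S)) ` (\<Pi>\<^sub>E P\<in>S. P)" by blast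
  qed
  then show ?thesis
    by (rule finite_subset) (intro finite_imageI finite_PiE assms)
qed

end

lemma pullback_partition_on:
  assumes "surj f" "partition_on UNIV P"
  shows "partition_on UNIV (pullback_partition f P)"
proof (rule partition_onI)
  show "\<Union> (pullback_partition f P) = UNIV"
    using block_in[OF assms(2)] by (auto simp: pullback_partition_def)
  show "disjnt A B" if AB: "A \<in> pullback_partition f P" "B \<in> pullback_partition f P" and "A \<noteq> B" for A B
  proof -
    obtain A' B' where "A' \<in> P" "B' \<in> P" "A = f -` A'" "B = f -` B'"
      using AB by (auto simp: pullback_partition_def)
    then show ?thesis using \<open>A \<noteq> B\<close> partition_onD2[OF assms(2)] by (auto simp: disjnt_def disjoint_def)
  qed
  show "{} \<notin> pullback_partition f P"
  proof
    assume "{} \<in> pullback_partition f P"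
    then obtain A where "A \<in> P" "f -` A = {}" by (auto simp: pullback_partition_def)
    moreover have "A \<noteq> {}" using \<open>A \<in> P\<close> partition_onD3[OF assms(2)] by blast
    ultimately show False using assms(1) by (metis surj_vimage_empty)
  qed
qed

lemma block_pullback:
  assumes "surj f" "partition_on UNIV P"
  shows "block (pullback_partition f P) x = f -` block P (f x)"
  using block_in[OF assms(2), of "f x"]
  by (intro block_eq[OF pullback_partition_on[OF assms]]) (auto simp: pullback_partition_def)

text \<open>
From \<open>ln z \<le> z - 1\<close> at \<open>1 / sqrt p\<close> and at \<open>1 / (1 - p)\<close>.
\<close>
lemma binary_entropy_le_sqrt:
  fixes p :: real
  assumes "0 \<le> p" "p < 1"
  shows "- (p * ln p) - (1 - p) * ln (1 - p) \<le> 3 * sqrt p"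
proof (cases "p = 0")
  case False
  then have p: "0 < p" "p < 1" using assms by auto
  have s: "0 < sqrt p" using p by simp
  have "- ln p = 2 * ln (1 / sqrt p)" using p by (simp add: ln_div ln_sqrt)
  also have "\<dots> \<le> 2 * (1 / sqrt p - 1)" using s by (intro mult_left_mono ln_le_minus_one) auto
  also have "\<dots> \<le> 2 / sqrt p" using s by simp
  finally have "p * - ln p \<le> p * (2 / sqrt p)" using p by (intro mult_left_mono) auto
  also have "\<dots> = 2 * sqrt p" using p by (simp add: field_simps real_sqrt_mult_self)
  finally have 1: "- (p * ln p) \<le> 2 * sqrt p" by simp
  have "- ln (1 - p) = ln (1 / (1 - p))" using p by (simp add: ln_div)
  also have "\<dots> \<le> 1 / (1 - p) - 1" using p by (intro ln_le_minus_one) auto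
  finally have "(1 - p) * - ln (1 - p) \<le> (1 - p) * (1 / (1 - p) - 1)" using p by (intro mult_left_mono) auto
  also have "\<dots> = p" using p by (simp add: field_simps)
  also have "\<dots> \<le> sqrt p"
    using p by (intro real_le_rsqrt) (simp add: power2_eq_square mult_left_le)
  finally show ?thesis using 1 by simp
qed simp

context measure_action
begin

interpretation info: information_space M "exp 1"
  by unfold_locales simp

definition rv_entropy :: "('a \<Rightarrow> 'v) \<Rightarrow> real" where
  "rv_entropy X = - (\<Sum>v\<in>range X. prob (X -` {v}) * ln (prob (X -` {v})))"

lemma log_exp_1: "log (exp 1) x = ln x"
  by (simp add: log_def)

lemma rv_entropy_eq: "simple_function M X \<Longrightarrow> info.entropy_Pow X = rv_entropy X"
  by (subst info.entropy_simple_distributed[OF simple_distributedI[OF _ measure_nonneg refl]])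
    (simp_all add: rv_entropy_def space_UNIV log_exp_1)

lemma rv_entropy_data_processing:
  assumes X: "simple_function M X" and XY: "\<And>x y. X x = X y \<Longrightarrow> Y x = Y y"
  shows "rv_entropy Y \<le> rv_entropy X"
proof -
  define f where "f = (\<lambda>v. Y (inv X v))"
  have Y: "Y = f \<circ> X"
  proof
    fix x
    have "X (inv X (X x)) = X x" by (rule f_inv_into_f) simp
    from XY[OF this] show "Y x = (f \<circ> X) x" by (simp add: f_def)
  qed
  have "simple_function M (f \<circ> X)" using X by (rule simple_function_compose)
  then show ?thesis
    using info.entropy_data_processing[OF X, of f] rv_entropy_eq[OF X] rv_entropy_eq[of "f \<circ> X"]
    unfolding Y by simp
qed

lemma rv_entropy_pair_le:
  assumes X: "simple_function M X" and Y: "simple_function M Y"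
  shows "rv_entropy (\<lambda>x. (X x, Y x)) \<le> rv_entropy X + rv_entropy Y"
  using info.entropy_chain_rule[OF X Y] info.conditional_entropy_less_eq_entropy[OF Y X]
  by (simp add: rv_entropy_eq[symmetric] X Y simple_function_Pair)

text \<open>
The gain in entropy is the conditional entropy of \<open>Z\<close> given \<open>Y\<close>. Only the contribution of a single value
\<open>v\<close> is kept, and \<open>- ln r \<ge> 1 - r\<close> is used in it. What remains is the mean conditional variance of the
event \<open>Z = v\<close> given \<open>Y\<close>.
\<close>
lemma rv_entropy_pair_ge:
  assumes Y: "simple_function M Y" and Z: "simple_function M Z"
  shows "rv_entropy Y + (\<Sum>d\<in>range Y. prob (Y -` {d} \<inter> Z -` {v}) * (1 - prob (Y -` {d} \<inter> Z -` {v}) / prob (Y -` {d})))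
           \<le> rv_entropy (\<lambda>x. (Y x, Z x))"
proof -
  define pj where "pj = (\<lambda>z d. prob (Y -` {d} \<inter> Z -` {z}))"
  define pY where "pY = (\<lambda>d. prob (Y -` {d}))"
  have Ys: "Y -` {d} \<in> sets M" for d using simple_functionD(2)[OF Y, of "{d}"] by (simp add: space_UNIV)
  have le: "pj z d \<le> pY d" for z d unfolding pj_def pY_def by (intro finite_measure_mono Ys) auto
  have nn: "0 \<le> pj z d" "0 \<le> pY d" for z d by (auto simp: pj_def pY_def)
  define t where "t = (\<lambda>(z, d). pj z d * (1 - pj z d / pY d))"
  have t_le: "t (z, d) \<le> - (pj z d * log (exp 1) (pj z d / pY d))" for z d
  proof (cases "pj z d = 0")
    case False
    then have "0 < pj z d" using nn(1)[of z d] by linarith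
    moreover then have "0 < pY d" using le[of z d] by linarith
    ultimately have "ln (pj z d / pY d) \<le> pj z d / pY d - 1" by (intro ln_le_minus_one) simp
    then have "pj z d * (1 - pj z d / pY d) \<le> pj z d * - ln (pj z d / pY d)"
      using nn by (intro mult_left_mono) auto
    then show ?thesis by (simp add: t_def log_exp_1)
  qed (simp add: t_def)
  have t0: "0 \<le> t (z, d)" for z d
    using le[of z d] nn(1)[of z d] nn(2)[of d] by (auto simp: t_def divide_le_eq intro!: mult_nonneg_nonneg)
  let ?R = "range (\<lambda>x. (Z x, Y x))"
  have sY: "simple_distributed M Y pY"
    by (rule simple_distributedI[OF Y]) (auto simp: pY_def space_UNIV)
  have eqv: "(\<lambda>x. (Z x, Y x)) -` {(z, d)} = Y -` {d} \<inter> Z -` {z}" for z d by auto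
  have sZY: "simple_distributed M (\<lambda>x. (Z x, Y x)) (\<lambda>(z, d). pj z d)"
    by (rule simple_distributedI[OF simple_function_Pair[OF Z Y]]) (auto simp: pj_def space_UNIV eqv)
  have finR: "finite ?R"
    using simple_functionD(1)[OF simple_function_Pair[OF Z Y]] by (simp add: space_UNIV)
  have finY: "finite (range Y)" using simple_functionD(1)[OF Y] by (simp add: space_UNIV)
  have "(\<Sum>d\<in>range Y. t (v, d)) = (\<Sum>p\<in>Pair v ` range Y. t p)"
    by (subst sum.reindex) (auto simp: inj_on_def)
  also have "\<dots> = (\<Sum>p\<in>Pair v ` range Y \<inter> ?R. t p)"
  proof (rule sum.mono_neutral_right)
    show "\<forall>p\<in>Pair v ` range Y - Pair v ` range Y \<inter> ?R. t p = 0"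
    proof
      fix p assume p: "p \<in> Pair v ` range Y - Pair v ` range Y \<inter> ?R"
      then obtain d where d: "p = (v, d)" "(v, d) \<notin> ?R" by auto
      then have "Y -` {d} \<inter> Z -` {v} = {}" by auto
      then show "t p = 0" by (simp add: d t_def pj_def)
    qed
  qed (use finY in auto)
  also have "\<dots> \<le> (\<Sum>p\<in>?R. t p)"
    using t0 finR by (intro sum_mono2) auto
  also have "\<dots> \<le> (\<Sum>p\<in>?R. case p of (z, d) \<Rightarrow> - (pj z d * log (exp 1) (pj z d / pY d)))"
    using t_le by (intro sum_mono) (auto simp del: minus_mult_right)
  also have "\<dots> = info.conditional_entropy_Pow Z Y"
    by (subst info.conditional_entropy_eq[OF sY sZY])
      (simp add: space_UNIV sum_negf[symmetric] case_prod_unfold)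
  finally have "(\<Sum>d\<in>range Y. t (v, d)) \<le> info.conditional_entropy_Pow Z Y" .
  then show ?thesis
    using info.entropy_chain_rule[OF Y Z]
    by (simp add: rv_entropy_eq[symmetric] Y Z simple_function_Pair t_def pj_def pY_def)
qed

lemma surj_T: "surj (T s)"
proof (rule surjI)
  show "T s (T (- s) x) = x" for x by (simp add: T_add[symmetric] T_zero)
qed

lemma partition_entropy_range_cell:
  assumes S: "\<And>P. P \<in> S \<Longrightarrow> partition_on UNIV P"
  shows "partition_entropy M (common_refinement S) = rv_entropy (cell S)"
proof -
  have "cell S -` {D} = D" if "D \<in> range (cell S)" for D
    using that cell_vimage[OF S] by auto
  moreover have "common_refinement S = range (cell S)"
    by (rule common_refinement_eq_range_cell) (rule S)
  ultimately show ?thesis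
    by (simp add: partition_entropy_def rv_entropy_def)
qed

lemma simple_function_cell:
  assumes S: "\<And>P. P \<in> S \<Longrightarrow> partition_on UNIV P" and "finite S"
    and fin: "\<And>P. P \<in> S \<Longrightarrow> finite P" and m: "\<And>P. P \<in> S \<Longrightarrow> P \<subseteq> sets M"
  shows "simple_function M (cell S)"
  unfolding simple_function_def
proof (intro conjI ballI)
  show "finite (cell S ` space M)"
    using finite_range_cell[OF S assms(2) fin] by (simp add: space_UNIV)
  fix D assume "D \<in> cell S ` space M"
  then obtain y where D: "D = cell S y" by auto
  have "cell S -` {D} = cell S y" unfolding D by (rule cell_vimage[OF S])
  moreover have "cell S y \<in> sets M"
  proof (cases "S = {}")
    case True then show ?thesis using sets.top[of M] by (simp add: cell_def space_UNIV)
  next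
    case False
    have "block P y \<in> sets M" if "P \<in> S" for P using block_in[OF S[OF that], of y] m[OF that] by blast
    then show ?thesis unfolding cell_def using False \<open>finite S\<close> by (intro sets.finite_INT) auto
  qed
  ultimately show "cell S -` {D} \<inter> space M \<in> sets M" by (simp add: space_UNIV)
qed

lemma pullback_partition_measurable:
  assumes "P \<subseteq> sets M" shows "pullback_partition (T s) P \<subseteq> sets M"
proof -
  have "T s -` A \<in> sets M" if "A \<in> P" for A
    using measurable_sets[OF T_measurable, of A s] that assms by (auto simp: space_UNIV)
  then show ?thesis by (auto simp: pullback_partition_def)
qed

definition pullbacks :: "'a set set \<Rightarrow> 'g set \<Rightarrow> 'a set set set" where
  "pullbacks P K = (\<lambda>s. pullback_partition (T s) P) ` K"

lemma sequence_entropy_eq: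
  assumes "partition_on UNIV P"
  shows "sequence_entropy T M s P = limsup (\<lambda>n. ereal (1 / real n * rv_entropy (cell (pullbacks P (s ` {..<n})))))"
  unfolding sequence_entropy_def pullbacks_def image_image
  by (subst partition_entropy_range_cell) (auto intro: pullback_partition_on[OF surj_T assms])

lemma rv_entropy_bool_le:
  assumes D: "D \<in> sets M" and "prob D < 1"
  shows "simple_function M (\<lambda>x. x \<in> D)" "rv_entropy (\<lambda>x. x \<in> D) \<le> 3 * sqrt (prob D)"
proof -
  have v: "(\<lambda>x. x \<in> D) -` {True} = D" "(\<lambda>x. x \<in> D) -` {False} = UNIV - D" by auto
  have c: "prob (UNIV - D) = 1 - prob D" using prob_compl[OF D] by (simp add: space_UNIV)
  have Dc: "UNIV - D \<in> sets M" using sets.compl_sets[OF D] by (simp add: space_UNIV)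
  show sf: "simple_function M (\<lambda>x. x \<in> D)"
    unfolding simple_function_def
  proof (intro conjI ballI)
    fix b :: bool
    show "(\<lambda>x. x \<in> D) -` {b} \<inter> space M \<in> sets M"
      using D Dc by (cases b) (simp_all add: v space_UNIV)
  qed (rule finite_subset[of _ UNIV], auto)
  have "(\<Sum>b\<in>range (\<lambda>x. x \<in> D). prob ((\<lambda>x. x \<in> D) -` {b}) * ln (prob ((\<lambda>x. x \<in> D) -` {b})))
      = (\<Sum>b\<in>UNIV. prob ((\<lambda>x. x \<in> D) -` {b}) * ln (prob ((\<lambda>x. x \<in> D) -` {b})))"
  proof (rule sum.mono_neutral_left)
    show "\<forall>b\<in>UNIV - range (\<lambda>x. x \<in> D). prob ((\<lambda>x. x \<in> D) -` {b}) * ln (prob ((\<lambda>x. x \<in> D) -` {b})) = 0"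
    proof
      fix b assume "b \<in> UNIV - range (\<lambda>x. x \<in> D)"
      then have "(\<lambda>x. x \<in> D) -` {b} = {}" by auto
      then show "prob ((\<lambda>x. x \<in> D) -` {b}) * ln (prob ((\<lambda>x. x \<in> D) -` {b})) = 0" by simp
    qed
  qed auto
  then have "rv_entropy (\<lambda>x. x \<in> D) = - (prob D * ln (prob D)) - (1 - prob D) * ln (1 - prob D)"
    by (simp add: rv_entropy_def UNIV_bool v c)
  also have "\<dots> \<le> 3 * sqrt (prob D)" by (rule binary_entropy_le_sqrt[OF measure_nonneg assms(2)])
  finally show "rv_entropy (\<lambda>x. x \<in> D) \<le> 3 * sqrt (prob D)" .
qed

text \<open>
Let \<open>\<rho>\<close> send a group element to the representative of its colour. The refinement of the first \<open>n\<close>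
translates is determined by the finitely many translates under representatives together with the
error sets \<open>D i\<close> on which the translates under \<open>s i\<close> and \<open>\<rho> (s i)\<close> differ. The former have bounded
entropy, and each of the latter contributes little since its measure is small.
\<close>
theorem almost_periodic_imp_zero_sequence_entropy:
  assumes W: "W \<in> kronecker_sets" and P: "partition_on UNIV {W, UNIV - W}"
  shows "sequence_entropy T M s {W, UNIV - W} \<le> 0"
proof -
  let ?P = "{W, UNIV - W}"
  have Wm [measurable]: "W \<in> sets M" and ap: "almost_periodic (indicator W)"
    using W by (auto simp: kronecker_sets_def)
  have TW: "T t -` W \<in> sets M" for t
    using measurable_sets[OF T_measurable Wm, of t] by (simp add: space_UNIV)
  have "limsup (\<lambda>n. ereal (1 / real n * rv_entropy (cell (pullbacks ?P (s ` {..<n}))))) \<le> ereal e" if "0 < e" for e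
  proof -
    define \<delta> where "\<delta> = min (1 / 2) ((e / 6)\<^sup>2)"
    have "0 < \<delta>" using that by (simp add: \<delta>_def)
    obtain c :: "'g \<Rightarrow> nat" where c: "finite (range c)"
      "\<And>s t. c s = c t \<Longrightarrow> (\<integral>x. \<bar>indicator W (T s x) - indicator W (T t x)\<bar> \<partial>M) < \<delta>"
      by (rule almost_periodicD[OF ap \<open>0 < \<delta>\<close>], rule that)
    obtain R where R: "finite R" "\<And>s. \<exists>r\<in>R. c s = c r"
      using finite_representatives[OF c(1)] by metis
    then obtain \<rho> where \<rho>: "\<And>t. \<rho> t \<in> R" "\<And>t. c t = c (\<rho> t)" by metis
    define D where "D = (\<lambda>i. {x. (T (s i) x \<in> W) \<noteq> (T (\<rho> (s i)) x \<in> W)})"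
    have D_eq: "D i = (T (s i) -` W - T (\<rho> (s i)) -` W) \<union> (T (\<rho> (s i)) -` W - T (s i) -` W)" for i
      by (auto simp: D_def)
    have Dm [measurable]: "D i \<in> sets M" for i unfolding D_eq using TW by auto
    have probD: "prob (D i) < \<delta>" for i
    proof -
      have "prob (D i) = (\<integral>x. indicator (D i) x \<partial>M)" by simp
      also have "\<dots> = (\<integral>x. \<bar>indicator W (T (s i) x) - indicator W (T (\<rho> (s i)) x)\<bar> \<partial>M)"
        by (intro Bochner_Integration.integral_cong) (auto simp: D_def indicator_def)
      also have "\<dots> < \<delta>" by (rule c(2)) (rule \<rho>(2))
      finally show ?thesis .
    qed
    have sfD: "simple_function M (\<lambda>x. x \<in> D i)" and entD: "rv_entropy (\<lambda>x. x \<in> D i) \<le> e / 2" for i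
    proof -
      have "prob (D i) < 1" using probD[of i] by (simp add: \<delta>_def)
      from rv_entropy_bool_le[OF Dm this]
      have 1: "simple_function M (\<lambda>x. x \<in> D i)" and 2: "rv_entropy (\<lambda>x. x \<in> D i) \<le> 3 * sqrt (prob (D i))" by auto
      show "simple_function M (\<lambda>x. x \<in> D i)" by (rule 1)
      have "prob (D i) \<le> (e / 6)\<^sup>2" using probD[of i] by (simp add: \<delta>_def)
      then have "sqrt (prob (D i)) \<le> sqrt ((e / 6)\<^sup>2)" by (rule real_sqrt_le_mono)
      also have "\<dots> = e / 6" using that by simp
      finally show "rv_entropy (\<lambda>x. x \<in> D i) \<le> e / 2" using 2 by simp
    qed
    define q where "q = (\<lambda>x. {r \<in> R. T r x \<in> W})"
    have sfq: "simple_function M q"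
      unfolding simple_function_def
    proof (intro conjI ballI)
      show "finite (q ` space M)"
        by (rule finite_subset[of _ "Pow R"]) (use R(1) in \<open>auto simp: q_def\<close>)
      fix B assume B: "B \<in> q ` space M"
      then have BR: "B \<subseteq> R" by (auto simp: q_def)
      define G where "G = (\<lambda>r. if r \<in> B then T r -` W else UNIV - T r -` W)"
      have G: "x \<in> G r \<longleftrightarrow> (T r x \<in> W \<longleftrightarrow> r \<in> B)" for x r by (simp add: G_def)
      have "q x = B \<longleftrightarrow> (\<forall>r\<in>R. T r x \<in> W \<longleftrightarrow> r \<in> B)" for x
        using BR unfolding q_def by blast
      then have "q -` {B} = (\<Inter>r\<in>R. G r)"
        by (intro set_eqI) (simp only: vimage_singleton_eq INT_iff G)
      moreover have "(\<Inter>r\<in>R. G r) \<in> sets M"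
      proof (cases "R = {}")
        case True then show ?thesis using sets.top[of M] by (simp add: space_UNIV)
      next
        case False
        have "UNIV - T r -` W \<in> sets M" for r using sets.compl_sets[OF TW] by (simp add: space_UNIV)
        then have "G r \<in> sets M" for r using TW by (simp add: G_def)
        then show ?thesis using R(1) False by (intro sets.finite_INT) auto
      qed
      ultimately show "q -` {B} \<inter> space M \<in> sets M" by (simp add: space_UNIV)
    qed
    \<comment> \<open>\<open>Z n\<close> records the translates under representatives and the first \<open>n\<close> error sets.\<close>
    define Z where "Z = (\<lambda>n x. (q x, map (\<lambda>i. x \<in> D i) [0..<n]))"
    have Z_Suc: "Z (Suc n) = (\<lambda>(p, b). (fst p, snd p @ [b])) \<circ> (\<lambda>x. (Z n x, x \<in> D n))" for n
      by (auto simp: Z_def)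
    have Z: "simple_function M (Z n) \<and> rv_entropy (Z n) \<le> rv_entropy q + real n * (e / 2)" for n
    proof (induction n)
      case 0
      have "Z 0 = (\<lambda>b. (b, [])) \<circ> q" by (auto simp: Z_def)
      then have "simple_function M (Z 0)" using simple_function_compose[OF sfq] by metis
      moreover have "rv_entropy (Z 0) \<le> rv_entropy q"
        by (rule rv_entropy_data_processing[OF sfq]) (simp add: Z_def)
      ultimately show ?case by simp
    next
      case (Suc n)
      have sfp: "simple_function M (\<lambda>x. (Z n x, x \<in> D n))"
        using Suc sfD by (intro simple_function_Pair) auto
      have "simple_function M (Z (Suc n))" unfolding Z_Suc by (rule simple_function_compose[OF sfp])
      moreover have "rv_entropy (Z (Suc n)) \<le> rv_entropy (\<lambda>x. (Z n x, x \<in> D n))"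
        by (rule rv_entropy_data_processing[OF sfp]) (simp add: Z_def)
      moreover have "rv_entropy (\<lambda>x. (Z n x, x \<in> D n)) \<le> rv_entropy (Z n) + rv_entropy (\<lambda>x. x \<in> D n)"
        using Suc sfD by (intro rv_entropy_pair_le) auto
      moreover have "real (Suc n) * (e / 2) = real n * (e / 2) + e / 2" by (simp add: field_simps)
      ultimately show ?case using Suc entD[of n] by linarith
    qed
    have "rv_entropy (cell (pullbacks ?P (s ` {..<n}))) \<le> rv_entropy (Z n)" for n
    proof (rule rv_entropy_data_processing)
      show "simple_function M (Z n)" using Z by blast
      fix x y assume eq: "Z n x = Z n y"
      have "block (pullback_partition (T (s i)) ?P) x = block (pullback_partition (T (s i)) ?P) y" if "i < n" for i
      proof -
        have "(x \<in> D i) = (y \<in> D i)" using eq that by (simp add: Z_def)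
        moreover have "T (\<rho> (s i)) x \<in> W \<longleftrightarrow> T (\<rho> (s i)) y \<in> W"
          using eq \<rho>(1)[of "s i"] by (auto simp: Z_def q_def set_eq_iff)
        ultimately have "T (s i) x \<in> W \<longleftrightarrow> T (s i) y \<in> W" by (auto simp: D_def)
        then have "block ?P (T (s i) x) = block ?P (T (s i) y)"
          using block_eq[OF P, of W] block_eq[OF P, of "UNIV - W"] by (metis Diff_iff UNIV_I insert_iff)
        then show ?thesis by (simp add: block_pullback[OF surj_T P])
      qed
      then show "cell (pullbacks ?P (s ` {..<n})) x = cell (pullbacks ?P (s ` {..<n})) y"
        by (auto simp: cell_def pullbacks_def)
    qed
    then have bound: "rv_entropy (cell (pullbacks ?P (s ` {..<n}))) \<le> rv_entropy q + real n * (e / 2)" for n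
      using Z order_trans by blast
    obtain N where N: "2 * \<bar>rv_entropy q\<bar> / e < real N" using reals_Archimedean2 by blast
    have "\<forall>\<^sub>F n in sequentially. ereal (1 / real n * rv_entropy (cell (pullbacks ?P (s ` {..<n})))) \<le> ereal e"
    proof (rule eventually_sequentiallyI[of "Suc N"])
      fix n assume "Suc N \<le> n"
      then have n: "0 < real n" "real N \<le> real n" by auto
      have "2 * \<bar>rv_entropy q\<bar> / e \<le> real n" using N n by linarith
      then have "2 * \<bar>rv_entropy q\<bar> \<le> real n * e" using that by (simp add: divide_le_eq)
      then have "rv_entropy (cell (pullbacks ?P (s ` {..<n}))) \<le> e * real n"
        using bound[of n] by (simp add: algebra_simps)
      then show "ereal (1 / real n * rv_entropy (cell (pullbacks ?P (s ` {..<n})))) \<le> ereal e"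
        using n by (simp add: divide_le_eq)
    qed
    then show ?thesis by (rule Limsup_bounded)
  qed
  note bound = this
  show ?thesis
    unfolding sequence_entropy_eq[OF P]
  proof (rule ereal_le_epsilon2)
    fix e :: real assume "0 < e"
    from bound[OF this]
    show "limsup (\<lambda>n. ereal (1 / real n * rv_entropy (cell (pullbacks ?P (s ` {..<n}))))) \<le> 0 + ereal e"
      by (simp only: add_0)
  qed
qed

text \<open>
Let \<open>v\<close> be the part of the indicator of \<open>A\<close> orthogonal to the almost periodic functions. Given the
partition produced so far, weak mixing provides \<open>s\<close> for which the translate of \<open>v\<close> is almost orthogonal
to the indicators of all cells. The translate of \<open>A\<close> then stays away in \<open>L\<^sup>1\<close> from every function
constant on cells, because its correlation with the translate of \<open>v\<close> is the constant
\<open>c = \<integral> v\<^sup>2\<close>. So its conditional variance, and with it the entropy gained, is at least \<open>c / 4\<close>.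
\<close>
theorem positive_sequence_entropy:
  fixes F :: "nat \<Rightarrow> 'g set"
  assumes F: "folner_seq F" and finP: "finite P" and Pm: "P \<subseteq> sets M" and P: "partition_on UNIV P"
    and "A \<in> P" and A: "A \<notin> kronecker_sets"
  shows "\<exists>s. sequence_entropy T M s P > 0"
proof -
  have fin: "finite (F n)" "F n \<noteq> {}" for n
    using F by (auto simp: folner_seq_finite folner_seq_nonempty)
  have Am [measurable]: "A \<in> sets M" using Pm \<open>A \<in> P\<close> by blast
  define f :: "'a \<Rightarrow> real" where "f = indicator A"
  have fm [measurable]: "f \<in> borel_measurable M" unfolding f_def by measurable
  obtain \<phi> where \<phi>: "almost_periodic \<phi>" "\<And>x. 0 \<le> \<phi> x \<and> \<phi> x \<le> 1"
    and orth: "\<And>g. almost_periodic g \<Longrightarrow> (\<integral>x. g x * (f x - \<phi> x) \<partial>M) = 0"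
    using kronecker_projection[OF fm] by (auto simp: f_def indicator_def)
  have \<phi>m [measurable]: "\<phi> \<in> borel_measurable M" by (rule almost_periodic_measurable[OF \<phi>(1)])
  define v where "v = (\<lambda>x. f x - \<phi> x)"
  have vm [measurable]: "v \<in> borel_measurable M" unfolding v_def by measurable
  have vB: "\<bar>v x\<bar> \<le> 1" for x using \<phi>(2)[of x] by (auto simp: v_def f_def indicator_def)
  have orth_v: "(\<integral>x. g x * v x \<partial>M) = 0" if "almost_periodic g" for g
    unfolding v_def by (rule orth[OF that])
  have prodB: "\<bar>a * v x\<bar> \<le> 1" if "\<bar>a\<bar> \<le> 1" for a x
    using mult_mono[OF that vB[of x]] by (simp add: abs_mult)
  define c where "c = (\<integral>x. v x * v x \<partial>M)"
  have c_f: "c = (\<integral>x. f x * v x \<partial>M)"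
  proof -
    have "\<bar>f x * v x\<bar> \<le> 1" for x by (rule prodB) (simp add: f_def indicator_def)
    then have "integrable M (\<lambda>x. f x * v x)" by (intro integrable_bounded[where B=1]) auto
    moreover have "integrable M (\<lambda>x. \<phi> x * v x)" using \<phi>(2) by (intro integrable_bounded[where B=1] prodB) auto
    moreover have "v x * v x = f x * v x - \<phi> x * v x" for x by (simp add: v_def algebra_simps)
    ultimately show ?thesis using orth_v[OF \<phi>(1)] by (simp add: c_def)
  qed
  have "0 < c"
  proof (rule ccontr)
    assume "\<not> 0 < c"
    moreover have "0 \<le> c" unfolding c_def by simp
    ultimately have "c = 0" by simp
    then have "AE x in M. v x * v x = 0"
      unfolding c_def using prodB vB
      by (subst (asm) integral_nonneg_eq_0_iff_AE) (auto intro!: integrable_bounded[where B=1])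
    then have "(\<integral>x. \<bar>f x - \<phi> x\<bar> \<partial>M) = (\<integral>x. 0 \<partial>M)"
      by (intro integral_cong_AE) (auto simp: v_def elim: AE_mp)
    then have "almost_periodic f"
      using \<phi>(1) by (intro almost_periodic_L1_limit[where B=1]) (auto simp: f_def indicator_def)
    then show False using A Am by (simp add: kronecker_sets_def f_def)
  qed
  have surj: "surj (T s)" for s by (rule surj_T)
  have step: "\<exists>s. rv_entropy (cell (pullbacks P K)) + c / 4 \<le> rv_entropy (cell (pullbacks P (insert s K)))"
    if K: "finite K" for K
  proof -
    define S where "S = pullbacks P K"
    have SP: "partition_on UNIV Q" "finite Q" "Q \<subseteq> sets M" if "Q \<in> S" for Q
      using that finP pullback_partition_on[OF surj P] pullback_partition_measurable[OF Pm]
      by (auto simp: S_def pullbacks_def) (auto simp: pullback_partition_def)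
    have finS: "finite S" unfolding S_def pullbacks_def using K by simp
    define Y where "Y = cell S"
    have sfY: "simple_function M Y" unfolding Y_def by (rule simple_function_cell) (use SP finS in auto)
    define DD where "DD = range Y"
    have finD: "finite DD" using simple_functionD(1)[OF sfY] by (simp add: DD_def space_UNIV)
    have cD: "0 < real (card DD)" using finD by (simp add: DD_def card_gt_0_iff)
    have Yv: "Y -` {D} = D" if "D \<in> DD" for D
      using that cell_vimage[of S, OF SP(1)] by (auto simp: DD_def Y_def)
    have Dm [measurable]: "D \<in> sets M" if "D \<in> DD" for D
      using simple_functionD(2)[OF sfY, of "{D}"] Yv[OF that] by (simp add: space_UNIV)
    have mem: "x \<in> D \<longleftrightarrow> Y x = D" if "D \<in> DD" for x D using Yv[OF that] by blast
    define \<eta> where "\<eta> = c / (2 * real (card DD))"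
    have "0 < \<eta>" using \<open>0 < c\<close> cD by (simp add: \<eta>_def)
    define I where "I = (\<lambda>s D. \<integral>x. v (T s x) * indicator D x \<partial>M)"
    have "(\<lambda>n. \<Sum>D\<in>DD. avg (F n) (\<lambda>s. (I s D)\<^sup>2)) \<longlonglongrightarrow> (\<Sum>D\<in>DD. 0)"
    proof (rule tendsto_sum)
      fix D assume "D \<in> DD"
      then have [measurable]: "D \<in> sets M" by (rule Dm)
      show "(\<lambda>n. avg (F n) (\<lambda>s. (I s D)\<^sup>2)) \<longlonglongrightarrow> 0"
        unfolding I_def by (rule weakly_mixing[OF F vm vB _ _ orth_v, where B'=1]) (auto simp: indicator_def)
    qed
    then have "(\<lambda>n. avg (F n) (\<lambda>s. \<Sum>D\<in>DD. (I s D)\<^sup>2)) \<longlonglongrightarrow> 0" by (simp add: avg_sum)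
    moreover have "0 < \<eta>\<^sup>2" using \<open>0 < \<eta>\<close> by simp
    ultimately obtain n where n: "avg (F n) (\<lambda>s. \<Sum>D\<in>DD. (I s D)\<^sup>2) < \<eta>\<^sup>2"
      using order_tendstoD(2) eventually_happens'[OF sequentially_bot] by blast
    have "\<exists>s\<in>F n. (\<Sum>D\<in>DD. (I s D)\<^sup>2) < \<eta>\<^sup>2"
    proof (rule ccontr)
      assume "\<not> ?thesis"
      then have "avg (F n) (\<lambda>s. \<eta>\<^sup>2) \<le> avg (F n) (\<lambda>s. \<Sum>D\<in>DD. (I s D)\<^sup>2)" by (intro avg_mono) auto
      then show False using n fin by simp
    qed
    then obtain s where s: "(\<Sum>D\<in>DD. (I s D)\<^sup>2) < \<eta>\<^sup>2" by blast
    have I_small: "\<bar>I s D\<bar> \<le> \<eta>" if "D \<in> DD" for D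
    proof -
      have "(I s D)\<^sup>2 \<le> (\<Sum>D\<in>DD. (I s D)\<^sup>2)" using finD that by (intro member_le_sum) auto
      then have "(I s D)\<^sup>2 \<le> \<eta>\<^sup>2" using s by linarith
      then show ?thesis using \<open>0 < \<eta>\<close> by (simp add: abs_le_square_iff[symmetric])
    qed
    define Q where "Q = pullback_partition (T s) P"
    define B where "B = T s -` A"
    have QP: "partition_on UNIV Q" "finite Q" "Q \<subseteq> sets M"
      using pullback_partition_on[OF surj P] finP pullback_partition_measurable[OF Pm]
      by (auto simp: Q_def pullback_partition_def)
    have BQ: "B \<in> Q" using \<open>A \<in> P\<close> by (auto simp: B_def Q_def pullback_partition_def)
    then have Bm [measurable]: "B \<in> sets M" using QP by blast
    define Z where "Z = cell {Q}"
    have sfZ: "simple_function M Z" unfolding Z_def by (rule simple_function_cell) (use QP in auto)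
    have Zv: "Z -` {B} = B"
    proof -
      have "B \<noteq> {}" using partition_onD3[OF QP(1)] BQ by blast
      then obtain y where "y \<in> B" by blast
      then have "B = cell {Q} y" using block_eq[OF QP(1) BQ] by (simp add: cell_def)
      then show ?thesis unfolding Z_def using cell_vimage[of "{Q}" y] QP(1) by simp
    qed
    have SQ: "partition_on UNIV R \<and> finite R \<and> R \<subseteq> sets M" if "R \<in> insert Q S" for R
      using that SP QP by blast
    have "rv_entropy (\<lambda>x. (Y x, Z x)) \<le> rv_entropy (cell (insert Q S))"
    proof (rule rv_entropy_data_processing)
      show "simple_function M (cell (insert Q S))" by (rule simple_function_cell) (use SQ finS in auto)
      fix x y assume "cell (insert Q S) x = cell (insert Q S) y"
      then have "y \<in> cell (insert Q S) x" using cell_eq_iff[of "insert Q S"] SQ by blast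
      then have "y \<in> block Q x" "y \<in> cell S x" by (auto simp: cell_insert)
      then have "block Q x = block Q y" "cell S x = cell S y"
        using block_eq_iff[OF QP(1)] cell_eq_iff[of S] SP(1) by blast+
      then show "(Y x, Z x) = (Y y, Z y)" by (simp add: Y_def Z_def cell_def)
    qed
    moreover have "insert Q S = pullbacks P (insert s K)" by (simp add: Q_def S_def pullbacks_def)
    moreover have "rv_entropy Y + (\<Sum>D\<in>range Y. prob (Y -` {D} \<inter> Z -` {B}) * (1 - prob (Y -` {D} \<inter> Z -` {B}) / prob (Y -` {D})))
        \<le> rv_entropy (\<lambda>x. (Y x, Z x))"
      by (rule rv_entropy_pair_ge[OF sfY sfZ])
    moreover have "c / 4 \<le> (\<Sum>D\<in>range Y. prob (Y -` {D} \<inter> Z -` {B}) * (1 - prob (Y -` {D} \<inter> Z -` {B}) / prob (Y -` {D})))"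
    proof -
      define p where "p = (\<lambda>D. prob (D \<inter> B) / prob D)"
      have le: "prob (D \<inter> B) \<le> prob D" if "D \<in> DD" for D
        using Dm[OF that] by (intro finite_measure_mono) auto
      have p01: "0 \<le> p D" "p D \<le> 1" if "D \<in> DD" for D
        using le[OF that] by (auto simp: p_def divide_le_eq_1 order_less_le)
      have pD: "prob D * p D = prob (D \<inter> B)" if "D \<in> DD" for D
      proof (cases "prob D = 0")
        case True then show ?thesis using le[OF that] by (simp add: measure_le_0_iff)
      qed (simp add: p_def)
      have iv: "integrable M (\<lambda>x. v (T s x) * indicator E x)" if "E \<in> sets M" for E
      proof (rule integrable_bounded[where B=1])
        show "\<bar>v (T s x) * indicator E x\<bar> \<le> 1" for x using vB by (simp add: indicator_def)
      qed (use that in measurable)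
      have DB: "D \<inter> B \<in> sets M" if "D \<in> DD" for D using Dm[OF that] Bm by auto
      have each: "I s (D \<inter> B) - p D * I s D \<le> 2 * (prob (D \<inter> B) * (1 - p D))" if D: "D \<in> DD" for D
      proof -
        have [measurable]: "D \<in> sets M" by (rule Dm[OF D])
        have "I s (D \<inter> B) - p D * I s D
            = (\<integral>x. v (T s x) * indicator (D \<inter> B) x - p D * (v (T s x) * indicator D x) \<partial>M)"
          unfolding I_def using iv[OF DB[OF D]] iv[OF Dm[OF D]] by simp
        also have "\<dots> \<le> (\<integral>x. (1 - p D) * indicator (D \<inter> B) x + p D * (indicator D x - indicator (D \<inter> B) x) \<partial>M)"
        proof (rule integral_mono)
          fix x
          show "v (T s x) * indicator (D \<inter> B) x - p D * (v (T s x) * indicator D x)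
              \<le> (1 - p D) * indicator (D \<inter> B) x + p D * (indicator D x - indicator (D \<inter> B) x)"
          proof (cases "x \<in> D")
            case True
            show ?thesis
            proof (cases "x \<in> B")
              case True
              have "(1 - p D) * v (T s x) \<le> (1 - p D) * 1"
                using p01[OF D] vB[of "T s x"] by (intro mult_left_mono) auto
              then show ?thesis using \<open>x \<in> D\<close> True by (simp add: algebra_simps)
            next
              case False
              have "p D * (- v (T s x)) \<le> p D * 1"
                using p01[OF D] vB[of "T s x"] by (intro mult_left_mono) auto
              then show ?thesis using \<open>x \<in> D\<close> False by simp
            qed
          qed simp
        next
          show "integrable M (\<lambda>x. v (T s x) * indicator (D \<inter> B) x - p D * (v (T s x) * indicator D x))"
            using iv[OF DB[OF D]] iv[OF Dm[OF D]] by simp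
          show "integrable M (\<lambda>x. (1 - p D) * indicator (D \<inter> B) x + p D * (indicator D x - indicator (D \<inter> B) x))"
            using DB[OF D] Dm[OF D]
            by (intro Bochner_Integration.integrable_add Bochner_Integration.integrable_diff
                Bochner_Integration.integrable_mult_right integrable_real_indicator) (auto simp: emeasure_eq_measure)
        qed
        also have "\<dots> = (1 - p D) * prob (D \<inter> B) + p D * (prob D - prob (D \<inter> B))"
          using DB[OF D] Dm[OF D] by (simp add: emeasure_eq_measure)
        also have "\<dots> = 2 * (prob (D \<inter> B) * (1 - p D))" using pD[OF D] by (simp add: algebra_simps)
        finally show ?thesis .
      qed
      have "(\<Sum>D\<in>DD. I s (D \<inter> B)) = (\<integral>x. (\<Sum>D\<in>DD. v (T s x) * indicator (D \<inter> B) x) \<partial>M)"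
        unfolding I_def using iv[OF DB] by (simp add: Bochner_Integration.integral_sum)
      also have "\<dots> = (\<integral>x. f (T s x) * v (T s x) \<partial>M)"
      proof (rule Bochner_Integration.integral_cong[OF refl])
        fix x
        have "(\<Sum>D\<in>DD. v (T s x) * indicator (D \<inter> B) x) = (\<Sum>D\<in>DD. if D = Y x then v (T s x) * indicator B x else 0)"
          using mem by (intro sum.cong refl) (auto simp: indicator_def)
        also have "\<dots> = v (T s x) * indicator B x" using finD by (simp add: DD_def)
        finally show "(\<Sum>D\<in>DD. v (T s x) * indicator (D \<inter> B) x) = f (T s x) * v (T s x)"
          by (simp add: f_def B_def indicator_def)
      qed
      also have "\<dots> = c" unfolding c_f by (rule integral_T[of "\<lambda>x. f x * v x"]) measurable
      finally have sumI: "(\<Sum>D\<in>DD. I s (D \<inter> B)) = c" .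
      have "(\<Sum>D\<in>DD. p D * I s D) \<le> (\<Sum>D\<in>DD. \<eta>)"
      proof (rule sum_mono)
        fix D assume D: "D \<in> DD"
        have "p D * I s D \<le> \<bar>p D * I s D\<bar>" by simp
        also have "\<dots> \<le> 1 * \<eta>" unfolding abs_mult using p01[OF D] I_small[OF D] by (intro mult_mono) auto
        finally show "p D * I s D \<le> \<eta>" by simp
      qed
      also have "\<dots> = c / 2" using cD by (simp add: \<eta>_def)
      finally have "c / 2 \<le> (\<Sum>D\<in>DD. I s (D \<inter> B) - p D * I s D)" using sumI by (simp add: sum_subtractf)
      also have "\<dots> \<le> (\<Sum>D\<in>DD. 2 * (prob (D \<inter> B) * (1 - p D)))" by (intro sum_mono each)
      also have "\<dots> = 2 * (\<Sum>D\<in>DD. prob (D \<inter> B) * (1 - p D))" by (simp add: sum_distrib_left)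
      finally have "c / 4 \<le> (\<Sum>D\<in>DD. prob (D \<inter> B) * (1 - p D))" by simp
      then show ?thesis using Yv by (simp add: Zv p_def flip: DD_def)
    qed
    ultimately have "rv_entropy (cell (pullbacks P K)) + c / 4 \<le> rv_entropy (cell (pullbacks P (insert s K)))"
      unfolding Y_def S_def by simp
    then show ?thesis by blast
  qed
  then obtain nxt where nxt: "\<And>K. finite K \<Longrightarrow>
      rv_entropy (cell (pullbacks P K)) + c / 4 \<le> rv_entropy (cell (pullbacks P (insert (nxt K) K)))" by metis
  define K where "K = rec_nat {} (\<lambda>_ K. insert (nxt K) K)"
  define s where "s = (\<lambda>n. nxt (K n))"
  have K_simps: "K 0 = {}" "K (Suc n) = insert (s n) (K n)" for n by (simp_all add: K_def s_def)
  have K_eq: "K n = s ` {..<n}" for n by (induction n) (auto simp: K_simps lessThan_Suc)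
  have grow: "real n * (c / 4) \<le> rv_entropy (cell (pullbacks P (K n)))" for n
  proof (induction n)
    case 0
    have c: "cell ({} :: 'a set set set) = (\<lambda>_. UNIV)" by (simp add: cell_def fun_eq_iff)
    have "prob UNIV = 1" using prob_space unfolding space_UNIV .
    then have "rv_entropy (cell ({} :: 'a set set set)) = 0" unfolding rv_entropy_def c by simp
    then show ?case by (simp add: K_simps pullbacks_def)
  next
    case (Suc n)
    have "finite (K n)" by (simp add: K_eq)
    from nxt[OF this] Suc show ?case by (simp add: K_simps s_def algebra_simps)
  qed
  have "ereal (c / 4) \<le> limsup (\<lambda>n. ereal (1 / real n * rv_entropy (cell (pullbacks P (s ` {..<n})))))"
  proof (rule le_Limsup)
    show "\<forall>\<^sub>F n in sequentially. ereal (c / 4) \<le> ereal (1 / real n * rv_entropy (cell (pullbacks P (s ` {..<n}))))"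
    proof (rule eventually_sequentiallyI[of 1])
      fix n :: nat assume "1 \<le> n"
      then show "ereal (c / 4) \<le> ereal (1 / real n * rv_entropy (cell (pullbacks P (s ` {..<n}))))"
        using grow[of n] by (simp add: K_eq le_divide_eq mult.commute)
    qed
  qed simp
  moreover have "0 < ereal (c / 4)" using \<open>0 < c\<close> by simp
  ultimately have "sequence_entropy T M s P > 0"
    unfolding sequence_entropy_eq[OF P] by (rule less_le_trans[rotated])
  then show ?thesis by blast
qed

end

section \<open>Mean sensitivity and the Kronecker algebra\<close>

lemma avg_indicator:
  "avg F (indicator S) = real (card (S \<inter> F)) / real (card F)" if "finite F"
proof -
  have "(\<Sum>s\<in>F. indicator S s :: real) = real (card (F \<inter> S))"
    using that by (simp add: indicator_def sum.If_cases)
  then show ?thesis by (simp add: avg_def Int_commute)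
qed

lemma upper_density_le:
  assumes F: "folner_seq F" and le: "\<And>n. n \<ge> 1 \<Longrightarrow> avg (F n) (indicator S) \<le> e"
  shows "upper_density F S \<le> ereal e"
  unfolding upper_density_def
proof (rule Limsup_bounded, rule eventually_sequentiallyI[of 1])
  fix n :: nat assume "1 \<le> n"
  from le[OF this] show "ereal (real (card (S \<inter> F n)) / real (card (F n))) \<le> ereal e"
    using avg_indicator[OF folner_seq_finite[OF F], of n S] by simp
qed

lemma upper_density_mono:
  assumes F: "folner_seq F" and "S \<subseteq> S'"
  shows "upper_density F S \<le> upper_density F S'"
  unfolding upper_density_def
proof (intro Limsup_mono always_eventually allI)
  fix n
  have "card (S \<inter> F n) \<le> card (S' \<inter> F n)"
    using assms(2) folner_seq_finite[OF F, of n] by (intro card_mono) auto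
  then show "ereal (real (card (S \<inter> F n)) / real (card (F n))) \<le> ereal (real (card (S' \<inter> F n)) / real (card (F n)))"
    by (simp add: divide_right_mono)
qed

context measure_action
begin

text \<open>
The colouring reduces the control of \<open>g\<close> along the whole orbit to its values at finitely many
representatives; these are rounded to multiples of \<open>\<eta>\<close>, and one of the finitely many resulting
pieces of \<open>Z\<close> has positive measure.
\<close>
lemma small_oscillation_subset:
  fixes g :: "'a \<Rightarrow> real" and c :: "'g \<Rightarrow> nat"
  assumes gm [measurable]: "g \<in> borel_measurable M" and gB: "\<And>x. \<bar>g x\<bar> \<le> 1" and "0 < \<eta>"
    and c: "finite (range c)" "\<And>s t x. c s = c t \<Longrightarrow> \<bar>g (T s x) - g (T t x)\<bar> \<le> \<eta>"
    and Z: "Z \<in> sets M" "prob Z > 0"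
  shows "\<exists>C\<in>sets M. C \<subseteq> Z \<and> prob C > 0 \<and> (\<forall>p\<in>C. \<forall>q\<in>C. \<forall>s. \<bar>g (T s p) - g (T s q)\<bar> \<le> 3 * \<eta>)"
proof -
  obtain R where R: "finite R" "\<And>s. \<exists>r\<in>R. c s = c r"
    using finite_representatives[OF c(1)] by metis
  define \<Phi> where "\<Phi> = (\<lambda>x. restrict (\<lambda>r. \<lfloor>g (T r x) / \<eta>\<rfloor>) R)"
  let ?I = "{- \<lceil>1 / \<eta>\<rceil> - 1..\<lceil>1 / \<eta>\<rceil>}"
  define V where "V = (R \<rightarrow>\<^sub>E ?I)"
  have "\<Phi> x \<in> V" for x
  proof -
    have "\<lfloor>g (T r x) / \<eta>\<rfloor> \<in> ?I" for r
      using gB[of "T r x"] \<open>0 < \<eta>\<close> by (intro floor_in_bounds) (simp add: divide_right_mono)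
    then show ?thesis unfolding \<Phi>_def V_def by auto
  qed
  have finV: "finite V" unfolding V_def by (intro finite_PiE R(1)) simp
  define cel where "cel = (\<lambda>v. Z \<inter> (\<Inter>r\<in>R. {x. \<lfloor>g (T r x) / \<eta>\<rfloor> = v r}))"
  have cel_m: "cel v \<in> sets M" for v
  proof -
    have "{x \<in> space M. \<lfloor>g (T r x) / \<eta>\<rfloor> = v r} \<in> sets M" for r by measurable
    then have "{x. \<lfloor>g (T r x) / \<eta>\<rfloor> = v r} \<in> sets M" for r by (simp add: space_UNIV)
    then show ?thesis
      unfolding cel_def using Z(1) R(1) by (cases "R = {}") (auto intro!: sets.Int sets.finite_INT)
  qed
  have cover: "Z \<subseteq> (\<Union>v\<in>V. cel v)"
  proof
    fix x assume "x \<in> Z"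
    then have "x \<in> cel (\<Phi> x)" unfolding cel_def \<Phi>_def by simp
    then show "x \<in> (\<Union>v\<in>V. cel v)" using \<open>\<Phi> x \<in> V\<close> by blast
  qed
  have "prob Z \<le> prob (\<Union>v\<in>V. cel v)"
    using cover cel_m finV by (intro finite_measure_mono sets.finite_UN) auto
  also have "\<dots> \<le> (\<Sum>v\<in>V. prob (cel v))"
    using cel_m finV by (intro finite_measure_subadditive_finite) auto
  finally have "0 < (\<Sum>v\<in>V. prob (cel v))" using Z(2) by linarith
  then obtain v where v: "0 < prob (cel v)" by (meson not_le sum_nonpos)
  have "\<bar>g (T s p) - g (T s q)\<bar> \<le> 3 * \<eta>" if "p \<in> cel v" "q \<in> cel v" for p q s
  proof -
    obtain r where r: "r \<in> R" "c s = c r" using R(2) by blast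
    then have "\<lfloor>g (T r p) / \<eta>\<rfloor> = \<lfloor>g (T r q) / \<eta>\<rfloor>" using that by (simp add: cel_def)
    then have "\<bar>g (T r p) / \<eta> - g (T r q) / \<eta>\<bar> \<le> 1" by linarith
    then have "\<bar>g (T r p) - g (T r q)\<bar> \<le> \<eta>"
      using \<open>0 < \<eta>\<close> by (simp add: diff_divide_distrib[symmetric] divide_le_eq)
    then show ?thesis using c(2)[OF r(2), of p] c(2)[OF r(2), of q] by linarith
  qed
  then show ?thesis using cel_m v by (intro bexI[of _ "cel v"]) (auto simp: cel_def)
qed

theorem kronecker_separation_imp_not_mean_sensitive:
  fixes F :: "nat \<Rightarrow> 'g set"
  assumes cnt: "countable (UNIV :: 'g set)" and F: "folner_seq F" and "tempered F"
    and W: "W \<in> kronecker_sets" and UV: "U \<subseteq> W" "V \<inter> W = {}" and "0 < \<epsilon>"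
  shows "\<exists>A\<in>sets M. prob A > 0 \<and>
           (\<forall>p\<in>A. \<forall>q\<in>A. upper_density F {s. T s p \<in> U \<and> T s q \<in> V} \<le> ereal \<epsilon>)"
proof -
  have fin: "finite (F n)" "F n \<noteq> {}" for n
    using F by (auto simp: folner_seq_finite folner_seq_nonempty)
  have Wm [measurable]: "W \<in> sets M" and ap: "almost_periodic (indicator W)"
    using W by (auto simp: kronecker_sets_def)
  obtain L where "0 < L" and L: "\<And>h B \<eta>. h \<in> borel_measurable M \<Longrightarrow> (\<And>x. 0 \<le> h x \<and> h x \<le> B) \<Longrightarrow> 0 < \<eta> \<Longrightarrow>
       prob {x. \<exists>n\<ge>1. erg_avg (F n) h x > \<eta>} \<le> L / \<eta> * (\<integral>x. h x \<partial>M)"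
    using maximal_inequality[OF F \<open>tempered F\<close>] by meson
  define \<theta> \<eta> \<delta> where "\<theta> = \<epsilon> / 4" and "\<eta> = \<epsilon> / 8" and "\<delta> = \<theta> / (2 * L)"
  have pos: "0 < \<theta>" "0 < \<eta>" "0 < \<delta>"
    using \<open>0 < \<epsilon>\<close> \<open>0 < L\<close> by (simp_all add: \<theta>_def \<eta>_def \<delta>_def)
  obtain g where gm [measurable]: "g \<in> borel_measurable M" and gB: "\<And>x. \<bar>g x\<bar> \<le> 1"
    and close: "(\<integral>x. \<bar>indicator W x - g x\<bar> \<partial>M) \<le> \<delta>"
    and colour: "\<And>\<eta>. 0 < \<eta> \<Longrightarrow> \<exists>c :: 'g \<Rightarrow> nat. finite (range c) \<and>
              (\<forall>s t x. c s = c t \<longrightarrow> \<bar>g (T s x) - g (T t x)\<bar> \<le> \<eta>)"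
    using almost_periodic_uniform_approximation[OF cnt F ap _ pos(3)] by (auto simp: indicator_def)
  obtain c :: "'g \<Rightarrow> nat" where c: "finite (range c)" "\<And>s t x. c s = c t \<Longrightarrow> \<bar>g (T s x) - g (T t x)\<bar> \<le> \<eta>"
    using colour[OF pos(2)] by auto
  define h where "h = (\<lambda>x. \<bar>indicator W x - g x\<bar>)"
  have hm [measurable]: "h \<in> borel_measurable M" unfolding h_def by measurable
  have hB: "0 \<le> h x \<and> h x \<le> 2" for x using gB[of x] by (auto simp: h_def indicator_def)
  define bad where "bad = {x. \<exists>n\<ge>1. erg_avg (F n) h x > \<theta>}"
  have bad_m: "bad \<in> sets M"
  proof -
    have "{x \<in> space M. \<exists>n\<in>{1..}. erg_avg (F n) h x > \<theta>} \<in> sets M" by measurable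
    then show ?thesis by (simp add: bad_def space_UNIV Bex_def)
  qed
  have "prob bad \<le> L / \<theta> * (\<integral>x. h x \<partial>M)" unfolding bad_def by (rule L[OF hm hB pos(1)])
  also have "\<dots> \<le> L / \<theta> * \<delta>" using close \<open>0 < L\<close> pos unfolding h_def by (intro mult_left_mono) auto
  also have "\<dots> = 1 / 2" using \<open>0 < L\<close> pos by (simp add: \<delta>_def)
  finally have "prob bad \<le> 1 / 2" .
  then have "0 < prob (UNIV - bad)" using prob_compl[OF bad_m] by (simp add: space_UNIV)
  moreover have "UNIV - bad \<in> sets M" using sets.compl_sets[OF bad_m] by (simp add: space_UNIV)
  ultimately have "\<exists>A\<in>sets M. A \<subseteq> UNIV - bad \<and> prob A > 0 \<and>
      (\<forall>p\<in>A. \<forall>q\<in>A. \<forall>s. \<bar>g (T s p) - g (T s q)\<bar> \<le> 3 * \<eta>)"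
    by (intro small_oscillation_subset[OF gm gB pos(2) c])
  then obtain A where A: "A \<in> sets M" "A \<subseteq> UNIV - bad" "prob A > 0"
    and osc': "\<forall>p\<in>A. \<forall>q\<in>A. \<forall>s. \<bar>g (T s p) - g (T s q)\<bar> \<le> 3 * \<eta>"
    by (elim bexE conjE) (rule that)
  have osc: "\<bar>g (T s p) - g (T s q)\<bar> \<le> 3 * \<eta>" if "p \<in> A" "q \<in> A" for p q s
    by (rule osc'[rule_format, OF that])
  have "upper_density F {s. T s p \<in> U \<and> T s q \<in> V} \<le> ereal \<epsilon>" if pq: "p \<in> A" "q \<in> A" for p q
  proof (rule upper_density_le[OF F])
    fix n :: nat assume n: "1 \<le> n"
    have "avg (F n) (indicator {s. T s p \<in> U \<and> T s q \<in> V}) \<le> avg (F n) (\<lambda>s. h (T s p) + h (T s q) + 3 * \<eta>)"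
    proof (rule avg_mono)
      fix s
      show "indicator {s. T s p \<in> U \<and> T s q \<in> V} s \<le> h (T s p) + h (T s q) + 3 * \<eta>"
      proof (cases "T s p \<in> U \<and> T s q \<in> V")
        case True
        then have "T s p \<in> W" "T s q \<notin> W" using UV by auto
        then show ?thesis using osc[OF pq, of s] True by (simp add: h_def)
      next
        case False
        then show ?thesis using hB[of "T s p"] hB[of "T s q"] pos by simp
      qed
    qed
    also have "\<dots> = erg_avg (F n) h p + erg_avg (F n) h q + 3 * \<eta>"
      using fin by (simp add: avg_add erg_avg_def)
    also have "\<dots> \<le> \<theta> + \<theta> + 3 * \<eta>"
    proof -
      have "erg_avg (F n) h x \<le> \<theta>" if "x \<in> A" for x
      proof -
        have "x \<notin> bad" using A(2) that by blast
        then show ?thesis using n by (simp add: bad_def not_less)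
      qed
      then show ?thesis using pq by (intro add_right_mono add_mono)
    qed
    also have "\<dots> \<le> \<epsilon>" using \<open>0 < \<epsilon>\<close> by (simp add: \<theta>_def \<eta>_def)
    finally show "avg (F n) (indicator {s. T s p \<in> U \<and> T s q \<in> V}) \<le> \<epsilon>" .
  qed
  then show ?thesis using A by blast
qed

lemma null_set_kronecker:
  assumes N: "N \<in> sets M" "prob N = 0" shows "N \<in> kronecker_sets"
proof -
  have "almost_periodic (indicator N)"
  proof (rule almost_periodic_L1_limit[where B=1])
    fix \<epsilon> :: real assume "0 < \<epsilon>"
    then show "\<exists>g. almost_periodic g \<and> (\<integral>x. \<bar>indicator N x - g x\<bar> \<partial>M) < \<epsilon>"
      using N by (intro exI[of _ "\<lambda>_. 0"]) (simp add: almost_periodic_const)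
  qed (use N in \<open>auto simp: indicator_def\<close>)
  then show ?thesis using N by (simp add: kronecker_sets_def)
qed

text \<open>
The set \<open>{\<phi> > 0}\<close> contains \<open>U\<close> and misses \<open>V\<close> up to null sets, and null sets belong to the Kronecker
algebra.
\<close>
lemma kronecker_disjoint_projections_separate:
  assumes Um [measurable]: "U \<in> sets M" and Vm [measurable]: "V \<in> sets M" and "U \<inter> V = {}"
    and \<phi>: "almost_periodic \<phi>" "\<And>x. 0 \<le> \<phi> x"
    and \<phi>U: "\<And>g. almost_periodic g \<Longrightarrow> (\<integral>x. g x * (indicator U x - \<phi> x) \<partial>M) = 0"
    and \<psi>: "almost_periodic \<psi>" "\<And>x. 0 \<le> \<psi> x"
    and \<psi>V: "\<And>g. almost_periodic g \<Longrightarrow> (\<integral>x. g x * (indicator V x - \<psi> x) \<partial>M) = 0"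
    and zero: "AE x in M. \<phi> x * \<psi> x = 0"
  shows "\<exists>W\<in>kronecker_sets. U \<subseteq> W \<and> V \<inter> W = {}"
proof -
  interpret K: sigma_algebra UNIV kronecker_sets by (rule sigma_algebra_kronecker)
  define E where "E = {x. 0 < \<phi> x}"
  have E: "E \<in> kronecker_sets" unfolding E_def by (rule almost_periodic_superlevel[OF \<phi>(1)])
  then have Em [measurable]: "E \<in> sets M" by (simp add: kronecker_sets_def)
  have E': "UNIV - E \<in> kronecker_sets" using K.compl_sets[OF E] .
  then have E'm [measurable]: "UNIV - E \<in> sets M" by (simp add: kronecker_sets_def)
  have ap: "almost_periodic (indicator E)" "almost_periodic (indicator (UNIV - E))"
    using E E' by (auto simp: kronecker_sets_def)
  have int: "integrable M (\<lambda>x. indicator S x * f x)" if "almost_periodic f" "S \<in> sets M" for S and f :: "'a \<Rightarrow> real"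
    using integrable_mult_indicator[OF that(2) almost_periodic_integrable[OF that(1)]] by simp
  have iI: "integrable M (\<lambda>x. indicator S x * indicator S' x :: real)" if "S \<in> sets M" "S' \<in> sets M" for S S'
    using that by (intro integrable_bounded[where B=1]) (auto simp: indicator_def)
  have "prob (U - E) = 0"
  proof -
    have "prob (U - E) = (\<integral>x. indicator (U - E) x \<partial>M)" by simp
    also have "\<dots> = (\<integral>x. indicator (UNIV - E) x * indicator U x \<partial>M)"
      by (intro Bochner_Integration.integral_cong) (auto simp: indicator_def)
    also have "\<dots> = (\<integral>x. indicator (UNIV - E) x * \<phi> x \<partial>M)"
      using \<phi>U[OF ap(2)] iI[OF E'm Um] int[OF \<phi>(1) E'm] by (simp add: right_diff_distrib)
    also have "\<dots> = (\<integral>x. 0 \<partial>M)"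
      using \<phi>(2) by (intro Bochner_Integration.integral_cong) (auto simp: E_def indicator_def not_less intro: antisym)
    finally show ?thesis by simp
  qed
  then have N1: "U - E \<in> kronecker_sets" by (intro null_set_kronecker) auto
  have "prob (V \<inter> E) = 0"
  proof -
    have "prob (V \<inter> E) = (\<integral>x. indicator (V \<inter> E) x \<partial>M)" by simp
    also have "\<dots> = (\<integral>x. indicator E x * indicator V x \<partial>M)"
      by (intro Bochner_Integration.integral_cong) (auto simp: indicator_def)
    also have "\<dots> = (\<integral>x. indicator E x * \<psi> x \<partial>M)"
      using \<psi>V[OF ap(1)] iI[OF Em Vm] int[OF \<psi>(1) Em] by (simp add: right_diff_distrib)
    also have "\<dots> = (\<integral>x. 0 \<partial>M)"
    proof (rule integral_cong_AE)
      show "AE x in M. indicator E x * \<psi> x = 0"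
        using zero by eventually_elim (auto simp: E_def indicator_def)
      show "(\<lambda>x. indicator E x * \<psi> x) \<in> borel_measurable M"
        using int[OF \<psi>(1) Em] by simp
    qed simp
    finally show ?thesis by simp
  qed
  then have N2: "V \<inter> E \<in> kronecker_sets" by (intro null_set_kronecker) auto
  have "(E \<union> (U - E)) - V \<inter> E \<in> kronecker_sets"
    by (rule K.Diff[OF K.Un[OF E N1] N2])
  moreover have "U \<subseteq> (E \<union> (U - E)) - V \<inter> E" using \<open>U \<inter> V = {}\<close> by auto
  moreover have "V \<inter> ((E \<union> (U - E)) - V \<inter> E) = {}" using \<open>U \<inter> V = {}\<close> by auto
  ultimately show ?thesis by blast
qed

lemma integral_product:
  fixes f h :: "'a \<Rightarrow> real"
  assumes [measurable]: "f \<in> borel_measurable M" "h \<in> borel_measurable M"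
    and B: "\<And>x. \<bar>f x\<bar> \<le> 1" "\<And>x. \<bar>h x\<bar> \<le> 1"
  shows "(\<integral>p. f (fst p) * h (snd p) \<partial>(M \<Otimes>\<^sub>M M)) = (\<integral>x. f x \<partial>M) * (\<integral>x. h x \<partial>M)"
proof -
  interpret N: measure_action "M \<Otimes>\<^sub>M M" "\<lambda>s p. (T s (fst p), T s (snd p))" by (rule product_action)
  interpret P: pair_prob_space M M ..
  have "\<bar>f x * h y\<bar> \<le> 1" for x y
    using mult_mono[OF B(1)[of x] B(2)[of y]] by (simp add: abs_mult)
  then have "integrable (M \<Otimes>\<^sub>M M) (\<lambda>p. f (fst p) * h (snd p))"
    by (intro N.integrable_bounded[where B=1]) auto
  from P.integral_fst'[OF this] show ?thesis by simp
qed

lemma avg_abs_tendsto_zero: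
  fixes F :: "nat \<Rightarrow> 'g set"
  assumes "(\<lambda>n. avg (F n) (\<lambda>s. (d s)\<^sup>2)) \<longlonglongrightarrow> 0"
  shows "(\<lambda>n. avg (F n) (\<lambda>s. \<bar>d s\<bar>)) \<longlonglongrightarrow> 0"
proof (rule tendsto_sandwich[OF _ _ tendsto_const])
  show "(\<lambda>n. sqrt (avg (F n) (\<lambda>s. (d s)\<^sup>2))) \<longlonglongrightarrow> 0"
    using tendsto_real_sqrt[OF assms] by simp
  show "\<forall>\<^sub>F n in sequentially. 0 \<le> avg (F n) (\<lambda>s. \<bar>d s\<bar>)"
    by (intro always_eventually allI avg_nonneg) simp
  show "\<forall>\<^sub>F n in sequentially. avg (F n) (\<lambda>s. \<bar>d s\<bar>) \<le> sqrt (avg (F n) (\<lambda>s. (d s)\<^sup>2))"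
    using avg_square_le[of "F n" "\<lambda>s. \<bar>d s\<bar>" for n] by (intro always_eventually allI real_le_rsqrt) simp
qed

text \<open>
The lower bound \<open>c / 4\<close> comes from \<open>c = \<integral> \<phi> \<psi>\<close>, which is positive in the absence of a separating
Kronecker set. A pair \<open>(p, q)\<close> is found in \<open>C \<times> C\<close> for a piece \<open>C\<close> of the given set on which \<open>g \<approx> \<phi>\<close>
oscillates little: otherwise all frequencies would be eventually below \<open>3 c / 8\<close>, against the
average over \<open>C \<times> C\<close>, which is eventually at least \<open>c / 2\<close>.
\<close>
theorem not_kronecker_separated_imp_mean_sensitive:
  fixes F :: "nat \<Rightarrow> 'g set"
  assumes cnt: "countable (UNIV :: 'g set)" and F: "folner_seq F"
    and erg: "\<And>A. A \<in> sets M \<Longrightarrow> (\<And>s. T s ` A = A) \<Longrightarrow> prob A = 0 \<or> prob A = 1"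
    and Um [measurable]: "U \<in> sets M" and Vm [measurable]: "V \<in> sets M" and "U \<inter> V = {}"
    and nosep: "\<not> (\<exists>W\<in>kronecker_sets. U \<subseteq> W \<and> V \<inter> W = {})"
  shows "\<exists>\<epsilon>>0. \<forall>A\<in>sets M. prob A > 0 \<longrightarrow>
           (\<exists>p\<in>A. \<exists>q\<in>A. upper_density F {s. T s p \<in> U \<and> T s q \<in> V} > ereal \<epsilon>)"
proof -
  have fin: "finite (F n)" "F n \<noteq> {}" for n
    using F by (auto simp: folner_seq_finite folner_seq_nonempty)
  have Uf: "(indicator U :: 'a \<Rightarrow> real) \<in> borel_measurable M" "(indicator V :: 'a \<Rightarrow> real) \<in> borel_measurable M"
    by simp_all
  obtain \<phi> where \<phi>: "almost_periodic \<phi>" "\<And>x. 0 \<le> \<phi> x \<and> \<phi> x \<le> 1"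
    and \<phi>U: "\<And>g. almost_periodic g \<Longrightarrow> (\<integral>x. g x * (indicator U x - \<phi> x) \<partial>M) = 0"
    using kronecker_projection[OF Uf(1)] by (auto simp: indicator_def)
  obtain \<psi> where \<psi>: "almost_periodic \<psi>" "\<And>x. 0 \<le> \<psi> x \<and> \<psi> x \<le> 1"
    and \<psi>V: "\<And>g. almost_periodic g \<Longrightarrow> (\<integral>x. g x * (indicator V x - \<psi> x) \<partial>M) = 0"
    using kronecker_projection[OF Uf(2)] by (auto simp: indicator_def)
  have [measurable]: "\<phi> \<in> borel_measurable M" "\<psi> \<in> borel_measurable M"
    using almost_periodic_measurable \<phi>(1) \<psi>(1) by auto
  have \<phi>\<psi>: "0 \<le> \<phi> x * \<psi> x" "\<bar>\<phi> x * \<psi> x\<bar> \<le> 1" for x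
    using \<phi>(2)[of x] \<psi>(2)[of x] by (auto simp: mult_le_one)
  have i\<phi>\<psi>: "integrable M (\<lambda>x. \<phi> x * \<psi> x)" by (rule integrable_bounded[OF _ \<phi>\<psi>(2)]) measurable
  define c where "c = (\<integral>x. \<phi> x * \<psi> x \<partial>M)"
  have "0 < c"
  proof (rule ccontr)
    assume "\<not> 0 < c"
    moreover have "0 \<le> c" unfolding c_def using \<phi>\<psi>(1) by simp
    ultimately have "(\<integral>x. \<phi> x * \<psi> x \<partial>M) = 0" by (simp add: c_def)
    then have "AE x in M. \<phi> x * \<psi> x = 0"
      using i\<phi>\<psi> \<phi>\<psi>(1) by (subst (asm) integral_nonneg_eq_0_iff_AE) auto
    then have "\<exists>W\<in>kronecker_sets. U \<subseteq> W \<and> V \<inter> W = {}"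
      using \<phi> \<psi> by (intro kronecker_disjoint_projections_separate[OF Um Vm \<open>U \<inter> V = {}\<close> \<phi>(1) _ \<phi>U \<psi>(1) _ \<psi>V]) auto
    then show False using nosep by blast
  qed
  have "\<exists>p\<in>A. \<exists>q\<in>A. upper_density F {s. T s p \<in> U \<and> T s q \<in> V} > ereal (c / 4)"
    if A: "A \<in> sets M" "prob A > 0" for A
  proof -
    define \<delta> \<eta> where "\<delta> = c / 8" and "\<eta> = c / 24"
    have pos: "0 < \<delta>" "0 < \<eta>" using \<open>0 < c\<close> by (simp_all add: \<delta>_def \<eta>_def)
    have \<phi>B: "\<bar>\<phi> x\<bar> \<le> 1" for x using \<phi>(2)[of x] by simp
    obtain g where gm [measurable]: "g \<in> borel_measurable M" and gB: "\<And>x. \<bar>g x\<bar> \<le> 1"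
      and close: "(\<integral>x. \<bar>\<phi> x - g x\<bar> \<partial>M) \<le> \<delta>"
      and colour: "\<And>\<eta>. 0 < \<eta> \<Longrightarrow> \<exists>c :: 'g \<Rightarrow> nat. finite (range c) \<and>
                (\<forall>s t x. c s = c t \<longrightarrow> \<bar>g (T s x) - g (T t x)\<bar> \<le> \<eta>)"
      using almost_periodic_uniform_approximation[OF cnt F \<phi>(1) \<phi>B pos(1)] by auto
    obtain k :: "'g \<Rightarrow> nat" where k: "finite (range k)" "\<And>s t x. k s = k t \<Longrightarrow> \<bar>g (T s x) - g (T t x)\<bar> \<le> \<eta>"
      using colour[OF pos(2)] by auto
    have "\<exists>C\<in>sets M. C \<subseteq> A \<and> prob C > 0 \<and>
        (\<forall>p\<in>C. \<forall>q\<in>C. \<forall>s. \<bar>g (T s p) - g (T s q)\<bar> \<le> 3 * \<eta>)"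
      by (rule small_oscillation_subset[OF gm gB pos(2) k(1) _ A]) (rule k(2))
    then obtain C where Cm [measurable]: "C \<in> sets M" and "C \<subseteq> A" and C0: "prob C > 0"
      and osc': "\<forall>p\<in>C. \<forall>q\<in>C. \<forall>s. \<bar>g (T s p) - g (T s q)\<bar> \<le> 3 * \<eta>"
      by (elim bexE conjE) (rule that)
    have osc: "\<bar>g (T s p) - g (T s q)\<bar> \<le> 3 * \<eta>" if "p \<in> C" "q \<in> C" for p q s
      by (rule osc'[rule_format, OF that])
    define m where "m = prob C"
    have m: "0 < m" "m \<le> 1" using C0 by (simp_all add: m_def)
    define E where "E = (\<lambda>f s. \<integral>x. f (T s x) * indicator C x \<partial>M :: real)"
    have E_app: "E f s = (\<integral>x. f (T s x) * indicator C x \<partial>M)" for f s by (simp add: E_def)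
    have fC: "\<bar>f (T s x) * indicator C x\<bar> \<le> b" if "\<And>x. \<bar>f x\<bar> \<le> b" "0 \<le> b" for f s x and b :: real
      using that by (simp add: indicator_def)
    have iE: "integrable M (\<lambda>x. f (T s x) * indicator C x)"
      if [measurable]: "f \<in> borel_measurable M" and "\<And>x. \<bar>f x\<bar> \<le> b" "0 \<le> b" for f s and b :: real
      by (rule integrable_bounded[OF _ fC[OF that(2,3)]]) measurable
    have E1: "\<bar>E f s\<bar> \<le> 1" if [measurable]: "f \<in> borel_measurable M" and "\<And>x. \<bar>f x\<bar> \<le> 1" for f s
    proof -
      have "\<bar>E f s\<bar> \<le> (\<integral>x. \<bar>f (T s x) * indicator C x\<bar> \<partial>M)" unfolding E_def by (rule integral_abs_bound)
      also have "\<dots> \<le> 1" using fC[OF that(2)] by (intro integral_le_bound[where B=1]) auto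
      finally show ?thesis .
    qed
    have E_avg: "(\<lambda>n. avg (F n) (E f)) \<longlonglongrightarrow> (\<integral>x. f x \<partial>M) * m"
      if fm [measurable]: "f \<in> borel_measurable M" and fB: "\<And>x. \<bar>f x\<bar> \<le> b" "0 \<le> b" for f b
    proof -
      have ie: "integrable M (\<lambda>x. erg_avg (F n) f x * indicator C x)" for n
        by (rule integrable_bounded[where B=b]) (use erg_avg_bounded[OF fin fB(1)] fB(2) in \<open>auto simp: indicator_def\<close>)
      have eq: "avg (F n) (E f) - (\<integral>x. f x \<partial>M) * m = (\<integral>x. (erg_avg (F n) f x - (\<integral>y. f y \<partial>M)) * indicator C x \<partial>M)" for n
      proof -
        have "(\<integral>x. erg_avg (F n) f x * indicator C x \<partial>M) = (\<integral>x. (\<Sum>s\<in>F n. f (T s x) * indicator C x) / real (card (F n)) \<partial>M)"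
          unfolding erg_avg_def avg_def by (simp only: sum_distrib_right times_divide_eq_left)
        also have "\<dots> = avg (F n) (E f)"
          unfolding E_def avg_def using iE[OF fm fB]
          by (simp only: integral_divide_zero Bochner_Integration.integral_sum)
        finally have "(\<integral>x. erg_avg (F n) f x * indicator C x \<partial>M) = avg (F n) (E f)" .
        moreover have "integrable M (\<lambda>x. (\<integral>y. f y \<partial>M) * indicator C x)" by (simp add: emeasure_eq_measure)
        ultimately show ?thesis
          using ie by (simp add: left_diff_distrib m_def)
      qed
      have "(\<lambda>n. avg (F n) (E f) - (\<integral>x. f x \<partial>M) * m) \<longlonglongrightarrow> 0"
      proof (rule Lim_null_comparison[OF _ ergodic_averages_L1[OF cnt erg F fm fB(1)]])
        show "\<forall>\<^sub>F n in sequentially. norm (avg (F n) (E f) - (\<integral>x. f x \<partial>M) * m)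
            \<le> (\<integral>x. \<bar>erg_avg (F n) f x - (\<integral>y. f y \<partial>M)\<bar> \<partial>M)"
        proof (intro always_eventually allI)
          fix n
          let ?D = "\<lambda>x. erg_avg (F n) f x - (\<integral>y. f y \<partial>M)"
          have iD: "integrable M ?D"
            by (intro Bochner_Integration.integrable_diff integrable_bounded[OF _ erg_avg_bounded[OF fin fB(1)]]) auto
          have "norm (avg (F n) (E f) - (\<integral>x. f x \<partial>M) * m) \<le> (\<integral>x. \<bar>?D x * indicator C x\<bar> \<partial>M)"
            unfolding eq real_norm_def by (rule integral_abs_bound)
          also have "\<dots> \<le> (\<integral>x. \<bar>?D x\<bar> \<partial>M)"
            using iD integrable_real_mult_indicator[OF Cm iD]
            by (intro integral_mono integrable_abs) (auto simp: indicator_def)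
          finally show "norm (avg (F n) (E f) - (\<integral>x. f x \<partial>M) * m) \<le> (\<integral>x. \<bar>?D x\<bar> \<partial>M)" .
        qed
      qed
      then show ?thesis by (simp add: LIM_zero_iff)
    qed
    have wm: "(\<lambda>n. avg (F n) (\<lambda>s. \<bar>E f s - E \<xi> s\<bar>)) \<longlonglongrightarrow> 0"
      if fm [measurable]: "f \<in> borel_measurable M" "\<xi> \<in> borel_measurable M" and fB: "\<And>x. \<bar>f x\<bar> \<le> 1" "\<And>x. \<bar>\<xi> x\<bar> \<le> 1"
        and orth: "\<And>g. almost_periodic g \<Longrightarrow> (\<integral>x. g x * (f x - \<xi> x) \<partial>M) = 0" for f \<xi>
    proof (rule avg_abs_tendsto_zero)
      have "\<bar>f x - \<xi> x\<bar> \<le> 2" for x using fB(1)[of x] fB(2)[of x] by linarith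
      then have "(\<lambda>n. avg (F n) (\<lambda>s. (\<integral>x. (f (T s x) - \<xi> (T s x)) * indicator C x \<partial>M)\<^sup>2)) \<longlonglongrightarrow> 0"
        by (intro weakly_mixing[OF F _ _ _ _ orth, where B=2 and B'=1]) (auto simp: indicator_def)
      moreover have "(\<integral>x. (f (T s x) - \<xi> (T s x)) * indicator C x \<partial>M) = E f s - E \<xi> s" for s
        unfolding E_def using iE[OF fm(1) fB(1)] iE[OF fm(2) fB(2)] by (simp add: left_diff_distrib)
      ultimately show "(\<lambda>n. avg (F n) (\<lambda>s. (E f s - E \<xi> s)\<^sup>2)) \<longlonglongrightarrow> 0" by simp
    qed
    let ?u = "indicator U :: 'a \<Rightarrow> real" and ?v = "indicator V :: 'a \<Rightarrow> real"
    let ?e = "\<lambda>x. \<bar>\<phi> x - g x\<bar>" and ?h = "\<lambda>x. g x * \<psi> x"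
    have \<psi>B: "\<bar>\<psi> x\<bar> \<le> 1" for x using \<psi>(2)[of x] by simp
    have hB: "\<bar>?h x\<bar> \<le> 1" for x
      using mult_mono[OF gB[of x] \<psi>B[of x]] by (simp add: abs_mult)
    have eB: "\<bar>?e x\<bar> \<le> 2" for x using \<phi>B[of x] gB[of x] by linarith
    have uB: "\<bar>?u x\<bar> \<le> 1" "\<bar>?v x\<bar> \<le> 1" for x by (auto simp: indicator_def)
    have i\<psi>: "integrable M (\<lambda>x. \<psi> (T s x) * indicator C x)" for s
      using iE[of \<psi> 1 s] \<psi>B by auto
    have i\<phi>: "integrable M (\<lambda>x. \<phi> (T s x) * indicator C x)" for s
      using iE[of \<phi> 1 s] \<phi>B by auto
    have ih: "integrable M (\<lambda>x. ?h (T s x) * indicator C x)" for s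
      using iE[of ?h 1 s] hB by auto
    have ie: "integrable M (\<lambda>x. ?e (T s x) * indicator C x)" for s
      using iE[of ?e 2 s] eB by auto
    have iC: "integrable M (indicator C :: 'a \<Rightarrow> real)" by (simp add: emeasure_eq_measure)
    \<comment> \<open>On \<open>C\<close> the values of \<open>g\<close> after moving by \<open>s\<close> differ by at most \<open>3 * \<eta>\<close>, so the product of two
      integrals over \<open>C\<close> is bounded below by a single integral, up to the error \<open>?e\<close>.\<close>
    have lower: "m * E ?h s - 3 * \<eta> * m\<^sup>2 - m * E ?e s \<le> E \<phi> s * E \<psi> s" for s
    proof -
      have E\<psi>: "0 \<le> E \<psi> s" "E \<psi> s \<le> m"
      proof -
        show "0 \<le> E \<psi> s" unfolding E_def using \<psi>(2) by (intro Bochner_Integration.integral_nonneg) auto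
        have "E \<psi> s \<le> (\<integral>x. indicator C x \<partial>M)"
          unfolding E_def
        proof (rule integral_mono[OF i\<psi> iC])
          show "\<psi> (T s x) * indicator C x \<le> indicator C x" for x
            using \<psi>(2) by (simp add: indicator_def)
        qed
        then show "E \<psi> s \<le> m" by (simp add: m_def)
      qed
      have Ee: "0 \<le> E ?e s" unfolding E_def by (intro Bochner_Integration.integral_nonneg) auto
      have inner: "m * g (T s q) - 3 * \<eta> * m - E ?e s \<le> E \<phi> s" if "q \<in> C" for q
      proof -
        have "m * g (T s q) - 3 * \<eta> * m - E ?e s
            = (\<integral>x. (g (T s q) - 3 * \<eta>) * indicator C x - ?e (T s x) * indicator C x \<partial>M)"
          unfolding E_def using ie iC by (simp add: m_def algebra_simps)
        also have "\<dots> \<le> (\<integral>x. \<phi> (T s x) * indicator C x \<partial>M)"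
        proof (rule integral_mono)
          show "integrable M (\<lambda>x. (g (T s q) - 3 * \<eta>) * indicator C x - ?e (T s x) * indicator C x)"
            using ie iC by (intro Bochner_Integration.integrable_diff Bochner_Integration.integrable_mult_right)
          show "integrable M (\<lambda>x. \<phi> (T s x) * indicator C x)" by (rule i\<phi>)
          fix x
          show "(g (T s q) - 3 * \<eta>) * indicator C x - ?e (T s x) * indicator C x \<le> \<phi> (T s x) * indicator C x"
            using osc[OF that, of x s] by (cases "x \<in> C") auto
        qed
        finally show ?thesis by (simp add: E_def)
      qed
      have "m * E ?h s - 3 * \<eta> * m * E \<psi> s - E ?e s * E \<psi> s
          = (\<integral>x. m * (?h (T s x) * indicator C x) - 3 * \<eta> * m * (\<psi> (T s x) * indicator C x)
                - E ?e s * (\<psi> (T s x) * indicator C x) \<partial>M)"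
        unfolding E_app[of ?h] E_app[of \<psi>]
        using ih i\<psi> by simp
      also have "\<dots> \<le> (\<integral>x. E \<phi> s * (\<psi> (T s x) * indicator C x) \<partial>M)"
      proof (rule integral_mono)
        show "integrable M (\<lambda>x. m * (?h (T s x) * indicator C x) - 3 * \<eta> * m * (\<psi> (T s x) * indicator C x)
                - E ?e s * (\<psi> (T s x) * indicator C x))"
          using ih i\<psi>
          by (intro Bochner_Integration.integrable_diff Bochner_Integration.integrable_mult_right)
        show "integrable M (\<lambda>x. E \<phi> s * (\<psi> (T s x) * indicator C x))"
          using i\<psi> by (intro Bochner_Integration.integrable_mult_right)
        fix x
        show "m * (?h (T s x) * indicator C x) - 3 * \<eta> * m * (\<psi> (T s x) * indicator C x)
                - E ?e s * (\<psi> (T s x) * indicator C x) \<le> E \<phi> s * (\<psi> (T s x) * indicator C x)"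
        proof (cases "x \<in> C")
          case True
          from mult_right_mono[OF inner[OF True], of "\<psi> (T s x)"] \<psi>(2)[of "T s x"] True
          show ?thesis by (simp add: algebra_simps)
        qed simp
      qed
      also have "\<dots> = E \<phi> s * E \<psi> s" by (simp add: E_def)
      finally have "m * E ?h s - 3 * \<eta> * m * E \<psi> s - E ?e s * E \<psi> s \<le> E \<phi> s * E \<psi> s" .
      moreover have "3 * \<eta> * m * E \<psi> s \<le> 3 * \<eta> * m\<^sup>2"
        using E\<psi> m pos by (simp add: power2_eq_square mult_left_mono)
      moreover have "E ?e s * E \<psi> s \<le> m * E ?e s"
        using mult_left_mono[OF E\<psi>(2) Ee] by (simp add: mult.commute)
      ultimately show ?thesis by linarith
    qed
    have diff: "\<bar>E ?u s * E ?v s - E \<phi> s * E \<psi> s\<bar> \<le> \<bar>E ?u s - E \<phi> s\<bar> + \<bar>E ?v s - E \<psi> s\<bar>" for s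
    proof -
      have "E ?u s * E ?v s - E \<phi> s * E \<psi> s = (E ?u s - E \<phi> s) * E ?v s + E \<phi> s * (E ?v s - E \<psi> s)"
        by (simp add: algebra_simps)
      then have "\<bar>E ?u s * E ?v s - E \<phi> s * E \<psi> s\<bar> \<le> \<bar>E ?u s - E \<phi> s\<bar> * \<bar>E ?v s\<bar> + \<bar>E \<phi> s\<bar> * \<bar>E ?v s - E \<psi> s\<bar>"
        by (simp add: abs_mult[symmetric] abs_triangle_ineq)
      also have "\<dots> \<le> \<bar>E ?u s - E \<phi> s\<bar> * 1 + 1 * \<bar>E ?v s - E \<psi> s\<bar>"
        using E1[of ?v s] E1[of \<phi> s] uB(2) \<phi>B by (intro add_mono mult_mono) auto
      finally show ?thesis by simp
    qed
    have gap: "5 * c / 8 * m\<^sup>2 \<le> m * ((\<integral>x. ?h x \<partial>M) * m) - 3 * \<eta> * m\<^sup>2 - m * ((\<integral>x. ?e x \<partial>M) * m)"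
    proof -
      have ie: "integrable M ?e" by (rule integrable_bounded[OF _ eB]) measurable
      have ih: "integrable M ?h" by (rule integrable_bounded[OF _ hB]) measurable
      have "c - (\<integral>x. ?h x \<partial>M) = (\<integral>x. (\<phi> x - g x) * \<psi> x \<partial>M)"
        unfolding c_def using i\<phi>\<psi> ih by (simp add: left_diff_distrib)
      also have "\<dots> \<le> (\<integral>x. ?e x \<partial>M)"
      proof (rule integral_mono)
        show "integrable M (\<lambda>x. (\<phi> x - g x) * \<psi> x)" using i\<phi>\<psi> ih by (simp add: left_diff_distrib)
        show "(\<phi> x - g x) * \<psi> x \<le> ?e x" for x
        proof -
          have "(\<phi> x - g x) * \<psi> x \<le> ?e x * \<bar>\<psi> x\<bar>" by (metis abs_ge_self abs_mult)
          also have "\<dots> \<le> ?e x * 1" by (intro mult_left_mono \<psi>B) simp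
          finally show ?thesis by simp
        qed
      qed (rule ie)
      finally have "5 * c / 8 \<le> (\<integral>x. ?h x \<partial>M) - 3 * \<eta> - (\<integral>x. ?e x \<partial>M)"
        using close by (simp add: \<delta>_def \<eta>_def)
      from mult_right_mono[OF this, of "m\<^sup>2"] show ?thesis
        by (simp add: algebra_simps power2_eq_square)
    qed
    define LB where "LB = (\<lambda>n. m * avg (F n) (E ?h) - 3 * \<eta> * m\<^sup>2 - m * avg (F n) (E ?e)
        - (avg (F n) (\<lambda>s. \<bar>E ?u s - E \<phi> s\<bar>) + avg (F n) (\<lambda>s. \<bar>E ?v s - E \<psi> s\<bar>)))"
    have LB_le: "LB n \<le> avg (F n) (\<lambda>s. E ?u s * E ?v s)" for n
    proof -
      have "LB n = avg (F n) (\<lambda>s. m * E ?h s - 3 * \<eta> * m\<^sup>2 - m * E ?e s - (\<bar>E ?u s - E \<phi> s\<bar> + \<bar>E ?v s - E \<psi> s\<bar>))"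
        unfolding LB_def using fin by (simp add: avg_diff avg_add avg_cmult)
      also have "\<dots> \<le> avg (F n) (\<lambda>s. E ?u s * E ?v s)"
      proof (rule avg_mono)
        fix s
        show "m * E ?h s - 3 * \<eta> * m\<^sup>2 - m * E ?e s - (\<bar>E ?u s - E \<phi> s\<bar> + \<bar>E ?v s - E \<psi> s\<bar>) \<le> E ?u s * E ?v s"
          using lower[of s] diff[of s] by linarith
      qed
      finally show ?thesis .
    qed
    have "LB \<longlonglongrightarrow> m * ((\<integral>x. ?h x \<partial>M) * m) - 3 * \<eta> * m\<^sup>2 - m * ((\<integral>x. ?e x \<partial>M) * m) - (0 + 0)"
      unfolding LB_def
      by (intro tendsto_intros E_avg[OF _ hB] E_avg[OF _ eB] wm[OF _ _ uB(1) \<phi>B \<phi>U] wm[OF _ _ uB(2) \<psi>B \<psi>V]) auto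
    moreover have "c / 2 * m\<^sup>2 < m * ((\<integral>x. ?h x \<partial>M) * m) - 3 * \<eta> * m\<^sup>2 - m * ((\<integral>x. ?e x \<partial>M) * m) - (0 + 0)"
    proof -
      have "0 < c * m\<^sup>2" using \<open>0 < c\<close> m by simp
      then show ?thesis using gap by simp
    qed
    ultimately have "\<forall>\<^sub>F n in sequentially. c / 2 * m\<^sup>2 < LB n" by (rule order_tendstoD(1))
    then have many: "\<forall>\<^sub>F n in sequentially. c / 2 * m\<^sup>2 \<le> avg (F n) (\<lambda>s. E ?u s * E ?v s)"
    proof eventually_elim
      case (elim n) then show ?case using LB_le[of n] by linarith
    qed
    show ?thesis
    proof (rule ccontr)
      assume "\<not> ?thesis"
      then have small: "upper_density F {s. T s p \<in> U \<and> T s q \<in> V} \<le> ereal (c / 4)" if "p \<in> C" "q \<in> C" for p q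
        using that \<open>C \<subseteq> A\<close> by (force simp: not_less)
      let ?N = "M \<Otimes>\<^sub>M M"
      interpret N: measure_action ?N "\<lambda>s p. (T s (fst p), T s (snd p))" by (rule product_action)
      define J where "J = (\<lambda>n p. avg (F n) (\<lambda>s. (?u (T s (fst p)) * indicator C (fst p)) * (?v (T s (snd p)) * indicator C (snd p))))"
      \<comment> \<open>The threshold lies strictly between the supposed bound \<open>c / 4\<close> and the average \<open>c / 2\<close>.\<close>
      define I where "I = (\<lambda>p. 3 * c / 8 * (indicator C (fst p) * indicator C (snd p)) :: real)"
      have Jm [measurable]: "J n \<in> borel_measurable ?N" for n unfolding J_def avg_def by measurable
      have Im [measurable]: "I \<in> borel_measurable ?N" unfolding I_def by measurable
      have J01: "0 \<le> J n p" "J n p \<le> 1" for n p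
        unfolding J_def by (auto intro!: avg_nonneg avg_le[OF fin] simp: indicator_def)
      have I0: "0 \<le> I p" for p using \<open>0 < c\<close> by (simp add: I_def)
      have iJ: "integrable ?N (J n)" for n using J01 by (intro N.integrable_bounded[where B=1]) auto
      have uC: "\<bar>f (T s x) * indicator C x :: real\<bar> \<le> 1" if "\<And>x. \<bar>f x\<bar> \<le> 1" for f s x by (rule fC[OF that]) simp
      have intJ: "(\<integral>p. J n p \<partial>?N) = avg (F n) (\<lambda>s. E ?u s * E ?v s)" for n
      proof -
        have "(\<integral>p. (?u (T s (fst p)) * indicator C (fst p)) * (?v (T s (snd p)) * indicator C (snd p)) \<partial>?N) = E ?u s * E ?v s" for s
          unfolding E_def
          by (rule integral_product[of "\<lambda>x. ?u (T s x) * indicator C x" "\<lambda>x. ?v (T s x) * indicator C x"])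
            (use uC[OF uB(1)] uC[OF uB(2)] in auto)
        moreover have "integrable ?N (\<lambda>p. (?u (T s (fst p)) * indicator C (fst p)) * (?v (T s (snd p)) * indicator C (snd p)))" for s
          by (rule N.integrable_bounded[where B=1]) (auto simp: indicator_def)
        ultimately show ?thesis
          unfolding J_def avg_def by (simp only: integral_divide_zero Bochner_Integration.integral_sum)
      qed
      have intI: "(\<integral>p. I p \<partial>?N) = 3 * c / 8 * m\<^sup>2" "integrable ?N I"
      proof -
        show "(\<integral>p. I p \<partial>?N) = 3 * c / 8 * m\<^sup>2"
          unfolding I_def using integral_product[of "indicator C" "indicator C"]
          by (simp add: m_def power2_eq_square)
        show "integrable ?N I" unfolding I_def
          by (intro Bochner_Integration.integrable_mult_right N.integrable_bounded[where B=1]) (auto simp: indicator_def)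
      qed
      have "(\<lambda>n. \<integral>p. max 0 (J n p - I p) \<partial>?N) \<longlonglongrightarrow> (\<integral>p. 0 \<partial>?N)"
      proof (rule integral_dominated_convergence[where w="\<lambda>_. 1"])
        show "AE p in ?N. norm (max 0 (J n p - I p)) \<le> 1" for n
        proof (intro always_eventually allI)
          fix p show "norm (max 0 (J n p - I p)) \<le> 1" using J01(2)[of n p] I0[of p] by simp
        qed
        show "AE p in ?N. (\<lambda>n. max 0 (J n p - I p)) \<longlonglongrightarrow> 0"
        proof (intro always_eventually allI)
          fix p :: "'a \<times> 'a"
          obtain x y where p: "p = (x, y)" by (cases p)
          have "\<forall>\<^sub>F n in sequentially. J n p \<le> I p"
          proof (cases "x \<in> C \<and> y \<in> C")
            case True
            let ?S = "{s. T s x \<in> U \<and> T s y \<in> V}"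
            have "ereal (c / 4) < ereal (3 * c / 8)" using \<open>0 < c\<close> by simp
            then have "upper_density F ?S < ereal (3 * c / 8)"
              using small[of x y] True by (blast intro: le_less_trans)
            then have "\<forall>\<^sub>F n in sequentially. ereal (real (card (?S \<inter> F n)) / real (card (F n))) < ereal (3 * c / 8)"
              unfolding upper_density_def by (rule Limsup_lessD)
            then show ?thesis
            proof eventually_elim
              case (elim n)
              have "J n p = avg (F n) (indicator ?S)"
                unfolding J_def p using True by (intro avg_cong) (auto simp: indicator_def)
              then show ?case
                using elim True by (simp add: p I_def avg_indicator[OF fin(1)])
            qed
          next
            case False
            have "J n p = 0" for n unfolding J_def p avg_def using False by (auto intro!: sum.neutral)
            then show ?thesis using I0 by simp
          qed
          then show "(\<lambda>n. max 0 (J n p - I p)) \<longlonglongrightarrow> 0"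
            by (intro tendsto_eventually) (auto elim: eventually_mono)
        qed
      qed auto
      then have lim0: "(\<lambda>n. \<integral>p. max 0 (J n p - I p) \<partial>?N) \<longlonglongrightarrow> 0" by simp
      have "0 < c / 8 * m\<^sup>2" using \<open>0 < c\<close> m by simp
      from order_tendstoD(2)[OF lim0 this] many
      have "\<forall>\<^sub>F n in sequentially. False"
      proof eventually_elim
        case (elim n)
        have iM: "integrable ?N (\<lambda>p. max 0 (J n p - I p))" using iJ intI(2) by (intro integrable_max) auto
        have "(\<integral>p. J n p \<partial>?N) \<le> (\<integral>p. I p + max 0 (J n p - I p) \<partial>?N)"
          using iJ intI(2) iM by (intro integral_mono) auto
        also have "\<dots> = 3 * c / 8 * m\<^sup>2 + (\<integral>p. max 0 (J n p - I p) \<partial>?N)"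
          using intI iM by simp
        also have "\<dots> < 3 * c / 8 * m\<^sup>2 + c / 8 * m\<^sup>2" using elim(1) by simp
        finally show False using elim(2) unfolding intJ by simp
      qed
      then show False by simp
    qed
  qed
  then show ?thesis using \<open>0 < c\<close> by (intro exI[of _ "c / 4"]) auto
qed

end

lemma ergodic_borel_prob_imp_measure_action:
  fixes act :: "'g::ab_group_add \<Rightarrow> 'x::metric_space \<Rightarrow> 'x"
  assumes act: "continuous_action act" and erg: "ergodic_borel_prob act \<mu>"
  shows "measure_action \<mu> act"
proof -
  have sets: "sets \<mu> = sets borel" and "prob_space \<mu>"
    and inv: "\<And>s A. A \<in> sets borel \<Longrightarrow> measure \<mu> (act s -` A) = measure \<mu> A"
    using erg unfolding ergodic_borel_prob_def by auto
  interpret prob_space \<mu> by fact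
  have space: "space \<mu> = UNIV" using sets_eq_imp_space_eq[OF sets] by simp
  have m: "act s \<in> measurable \<mu> \<mu>" for s
  proof -
    have "act s \<in> measurable borel borel"
      using act unfolding continuous_action_def by (intro borel_measurable_continuous_onI) auto
    then show ?thesis using measurable_cong_sets[OF sets sets] by blast
  qed
  show ?thesis
  proof
    show "distr \<mu> \<mu> (act s) = \<mu>" for s
    proof (rule measure_eqI)
      fix A assume "A \<in> sets (distr \<mu> \<mu> (act s))"
      then have A: "A \<in> sets \<mu>" by simp
      then show "emeasure (distr \<mu> \<mu> (act s)) A = emeasure \<mu> A"
        using inv[of A s] m by (simp add: emeasure_distr space sets emeasure_eq_measure)
    qed simp
  qed (use m space act in \<open>auto simp: continuous_action_def\<close>)
qed

theorem theorem3p6: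
  fixes act :: "'g::ab_group_add \<Rightarrow> 'x::metric_space \<Rightarrow> 'x"
    and \<mu> :: "'x measure"
    and x y :: 'x
  assumes "countable (UNIV :: 'g set)"
    and "compact (UNIV :: 'x set)"
    and "continuous_action act"
    and "ergodic_borel_prob act \<mu>"
  shows "(sequence_entropy_pair act \<mu> x y \<longleftrightarrow>
            (\<exists>F. folner_seq F \<and> tempered F \<and> mean_sensitivity_pair act \<mu> F x y)) \<and>
         ((\<exists>F. folner_seq F \<and> tempered F \<and> mean_sensitivity_pair act \<mu> F x y) \<longleftrightarrow>
            (\<forall>F. folner_seq F \<and> tempered F \<longrightarrow> mean_sensitivity_pair act \<mu> F x y))"
proof -
  have sets: "sets \<mu> = sets borel"
    and ergodic: "\<And>A. A \<in> sets borel \<Longrightarrow> (\<And>s. act s ` A = A) \<Longrightarrow> measure \<mu> A = 0 \<or> measure \<mu> A = 1"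
    using assms(4) unfolding ergodic_borel_prob_def by auto
  interpret measure_action \<mu> act
    by (rule ergodic_borel_prob_imp_measure_action[OF assms(3,4)])
  have entropy_imp: "mean_sensitivity_pair act \<mu> F x y"
    if pair: "sequence_entropy_pair act \<mu> x y" and F: "folner_seq F" for F
    unfolding mean_sensitivity_pair_def
  proof (intro conjI allI impI)
    show "x \<noteq> y" using pair by (simp add: sequence_entropy_pair_def)
    then obtain U0 V0 where UV0: "open U0" "open V0" "x \<in> U0" "y \<in> V0" "U0 \<inter> V0 = {}"
      using hausdorff[of x y] by blast
    fix U V assume UV: "open U \<and> x \<in> U \<and> open V \<and> y \<in> V"
    \<comment> \<open>Smaller neighbourhoods are made disjoint; this only decreases the densities.\<close>
    define U' V' where "U' = U \<inter> U0" and "V' = V \<inter> V0"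
    have o: "open U'" "open V'" "x \<in> U'" "y \<in> V'" "U' \<inter> V' = {}"
      using UV UV0 by (auto simp: U'_def V'_def)
    have "\<not> (\<exists>W\<in>kronecker_sets. U' \<subseteq> W \<and> V' \<inter> W = {})"
    proof
      assume "\<exists>W\<in>kronecker_sets. U' \<subseteq> W \<and> V' \<inter> W = {}"
      then obtain W where W: "W \<in> kronecker_sets" "U' \<subseteq> W" "V' \<inter> W = {}" by blast
      let ?P = "{W, UNIV - W}"
      have "W \<in> sets borel" using W(1) sets by (simp add: kronecker_sets_def)
      moreover have P: "partition_on UNIV ?P"
        using W o by (auto simp: partition_on_def disjoint_def)
      ultimately have "finite_borel_partition ?P" by (simp add: finite_borel_partition_def)
      moreover have "y \<notin> closure W"
        using W(3) o open_Int_closure_eq_empty[OF o(2), of W] by blast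
      moreover have "x \<notin> closure (UNIV - W)"
        using W(2) o open_Int_closure_eq_empty[OF o(1), of "UNIV - W"] by blast
      ultimately obtain s where "sequence_entropy act \<mu> s ?P > 0"
        using pair unfolding sequence_entropy_pair_def by blast
      then show False
        using almost_periodic_imp_zero_sequence_entropy[OF W(1) P, of s] by simp
    qed
    note nosep = this
    have m: "U' \<in> sets \<mu>" "V' \<in> sets \<mu>" using o sets by auto
    have "\<exists>\<epsilon>>0. \<forall>A\<in>sets \<mu>. measure \<mu> A > 0 \<longrightarrow>
        (\<exists>p\<in>A. \<exists>q\<in>A. upper_density F {s. act s p \<in> U' \<and> act s q \<in> V'} > ereal \<epsilon>)"
      by (rule not_kronecker_separated_imp_mean_sensitive[OF assms(1) F _ m o(5) nosep])
        (rule ergodic, simp_all add: sets)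
    then obtain \<epsilon> where "\<epsilon> > 0" and \<epsilon>: "\<forall>A\<in>sets \<mu>. measure \<mu> A > 0 \<longrightarrow>
        (\<exists>p\<in>A. \<exists>q\<in>A. upper_density F {s. act s p \<in> U' \<and> act s q \<in> V'} > ereal \<epsilon>)"
      by (elim exE conjE) (rule that)
    have "\<exists>p\<in>A. \<exists>q\<in>A. upper_density F {s. act s p \<in> U \<and> act s q \<in> V} > ereal \<epsilon>"
      if "A \<in> sets borel" "measure \<mu> A > 0" for A
    proof -
      have "A \<in> sets \<mu>" using that(1) sets by simp
      from \<epsilon>[rule_format, OF this \<open>measure \<mu> A > 0\<close>]
      obtain p q where pq: "p \<in> A" "q \<in> A" "upper_density F {s. act s p \<in> U' \<and> act s q \<in> V'} > ereal \<epsilon>"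
        by (elim bexE) (rule that)
      have "upper_density F {s. act s p \<in> U' \<and> act s q \<in> V'} \<le> upper_density F {s. act s p \<in> U \<and> act s q \<in> V}"
        by (rule upper_density_mono[OF F]) (auto simp: U'_def V'_def)
      then show ?thesis 
        by (intro bexI[OF _ pq(1)] bexI[OF _ pq(2)] less_le_trans[OF pq(3)])
    qed
    then show "\<exists>\<epsilon>>0. \<forall>A\<in>sets borel. measure \<mu> A > 0 \<longrightarrow>
        (\<exists>p\<in>A. \<exists>q\<in>A. upper_density F {s. act s p \<in> U \<and> act s q \<in> V} > ereal \<epsilon>)"
      using \<open>\<epsilon> > 0\<close> by (intro exI[of _ \<epsilon>] conjI ballI impI)
  qed
  have sensitive_imp: "sequence_entropy_pair act \<mu> x y"
    if F: "folner_seq F" "tempered F" and ms: "mean_sensitivity_pair act \<mu> F x y" for F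
    unfolding sequence_entropy_pair_def
  proof (intro conjI allI impI)
    show "x \<noteq> y" using ms by (simp add: mean_sensitivity_pair_def)
    fix P assume P: "finite_borel_partition P \<and> \<not> (\<exists>A\<in>P. x \<in> closure A \<and> y \<in> closure A)"
    then have fP: "finite P" and Pm: "P \<subseteq> sets \<mu>" and part: "partition_on UNIV P"
      using sets by (auto simp: finite_borel_partition_def)
    show "\<exists>s. sequence_entropy act \<mu> s P > 0"
    proof (rule ccontr)
      assume "\<not> ?thesis"
      then have blocks: "A \<in> kronecker_sets" if "A \<in> P" for A
        using positive_sequence_entropy[OF F(1) fP Pm part that] by blast
      interpret K: sigma_algebra UNIV kronecker_sets by (rule sigma_algebra_kronecker)
      \<comment> \<open>As there are finitely many blocks, the complement of the closure of \<open>\<Union> Py\<close> is a neighbourhood of \<open>x\<close>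
        that lies in \<open>\<Union> Px\<close>.\<close>
      define Px Py where "Px = {A \<in> P. x \<in> closure A}" and "Py = {A \<in> P. x \<notin> closure A}"
      have fin: "finite Px" "finite Py" using fP by (auto simp: Px_def Py_def)
      define W where "W = \<Union> Px"
      have W: "W \<in> kronecker_sets"
        unfolding W_def using fin blocks by (intro K.finite_Union) (auto simp: Px_def)
      define U V where "U = - closure (\<Union> Py)" and "V = - closure W"
      have cl: "closure (\<Union> Q) = (\<Union>A\<in>Q. closure A)" if "finite Q" for Q :: "'x set set"
        using that by (induction Q) (simp_all add: closure_Un)
      have "open U" "open V" by (auto simp: U_def V_def intro: open_Compl)
      moreover have "x \<in> U" "y \<in> V"
        using P by (auto simp: U_def V_def W_def cl[OF fin(1)] cl[OF fin(2)]) (auto simp: Px_def Py_def)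
      ultimately have nb: "open U \<and> x \<in> U \<and> open V \<and> y \<in> V" by blast
      from ms have "\<forall>U V. open U \<and> x \<in> U \<and> open V \<and> y \<in> V \<longrightarrow>
          (\<exists>\<epsilon>::real. \<epsilon> > 0 \<and> (\<forall>A\<in>sets borel. measure \<mu> A > 0 \<longrightarrow>
             (\<exists>p\<in>A. \<exists>q\<in>A. upper_density F {s. act s p \<in> U \<and> act s q \<in> V} > ereal \<epsilon>)))"
        unfolding mean_sensitivity_pair_def by (rule conjunct2)
      from this[rule_format, OF nb]
      obtain \<epsilon> :: real where "\<epsilon> > 0" and \<epsilon>: "\<forall>A\<in>sets borel. measure \<mu> A > 0 \<longrightarrow>
          (\<exists>p\<in>A. \<exists>q\<in>A. upper_density F {s. act s p \<in> U \<and> act s q \<in> V} > ereal \<epsilon>)"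
        by (elim exE conjE) (rule that)
      have "U \<subseteq> W"
      proof
        fix z assume "z \<in> U"
        then have "z \<notin> \<Union> Py" using closure_subset[of "\<Union> Py"] by (auto simp: U_def)
        moreover have "z \<in> \<Union> P" using partition_onD1[OF part] by blast
        ultimately show "z \<in> W" by (auto simp: W_def Px_def Py_def)
      qed
      moreover have "V \<inter> W = {}" using closure_subset[of W] by (auto simp: V_def)
      ultimately obtain A where A: "A \<in> sets \<mu>" "measure \<mu> A > 0"
        and le: "\<And>p q. p \<in> A \<Longrightarrow> q \<in> A \<Longrightarrow> upper_density F {s. act s p \<in> U \<and> act s q \<in> V} \<le> ereal \<epsilon>"
        using kronecker_separation_imp_not_mean_sensitive[OF assms(1) F W _ _ \<open>\<epsilon> > 0\<close>, of U V] by auto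
      from A(1) have "A \<in> sets borel" using sets by simp
      from \<epsilon>[rule_format, OF this A(2)] obtain p q where "p \<in> A" "q \<in> A"
        and gt: "upper_density F {s. act s p \<in> U \<and> act s q \<in> V} > ereal \<epsilon>"
        by (elim bexE) (rule that)
      from le[OF this(1,2)] gt show False by simp
    qed
  qed
  obtain F\<^sub>0 :: "nat \<Rightarrow> 'g set" where F\<^sub>0: "folner_seq F\<^sub>0" "tempered F\<^sub>0"
    using exists_tempered_folner_seq[OF assms(1)] by blast
  let ?some = "\<exists>F. folner_seq F \<and> tempered F \<and> mean_sensitivity_pair act \<mu> F x y"
  let ?all = "\<forall>F. folner_seq F \<and> tempered F \<longrightarrow> mean_sensitivity_pair act \<mu> F x y"
  have "?all" if "sequence_entropy_pair act \<mu> x y"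
    using entropy_imp[OF that] by (intro allI impI) (elim conjE)
  moreover have "?some" if ?all
    using that F\<^sub>0 by (intro exI[of _ F\<^sub>0]) simp
  moreover have "sequence_entropy_pair act \<mu> x y" if ?some
    using that sensitive_imp by (elim exE conjE)
  ultimately show ?thesis by argo
qed

end
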